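(* Let $(M,\eta)$ be a contact manifold endowed with a bi-Legendrian structure $({\mathcal F}_1,{\mathcal F}_2)$ with bi-Legendrian connection $\nabla^{bl}$, such that $\nabla^{bl}\Pi_{{\mathcal F}_1}=0$ (respectively, $\nabla^{bl}\Pi_{{\mathcal F}_2}=0$). Assume that ${\mathcal F}_1$ is positive definite (respectively, flat) and ${\mathcal F}_2$ is flat (respectively, negative definite). Then for each $0<c\leq4$ (respectively, $-4\leq c<0$) $(M,\eta)$ admits a compatible contact metric $(\kappa,\mu)$-structure, whose associated bi-Legendrian structure is $({\mathcal F}_1,{\mathcal F}_2)$, where $$\kappa=1-\frac{c^2}{16},\qquad \mu=2\left(1-\frac{c}{4}\right).$$
   Context: Convention: $2d\eta(X,Y)=X(\eta(Y))-Y(\eta(X))-\eta([X,Y])$. A contact manifold is a $(2n+1)$-dimensional smooth manifold $M$ with a 1-form $\eta$ such that $\eta\wedge(d\eta)^n\neq0$ everywhere; its Reeb vector field $\xi$ is determined by $\eta(\xi)=1$, $i_\xi d\eta=0$. A contact metric structure $(\varphi,\xi,\eta,g)$ compatible with $\eta$ consists of $\eta$, its Reeb field $\xi$, a $(1,1)$-tensor field $\varphi$ and a Riemannian metric $g$ with $\varphi^2=-I+\eta\otimes\xi$, $d\eta(X,Y)=g(X,\varphi Y)$, $g(\varphi X,\varphi Y)=g(X,Y)-\eta(X)\eta(Y)$. Put $h=\frac12{\mathcal L}_\xi\varphi$. It is a contact metric $(\kappa,\mu)$-structure ($\kappa,\mu\in\mathbb{R}$) if the Levi-Civita curvature satisfies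 $R_{XY}\xi=\kappa(\eta(Y)X-\eta(X)Y)+\mu(\eta(Y)hX-\eta(X)hY)$ for all $X,Y$. If $\kappa<1$, then $TM$ is the orthogonal sum of $\mathbb{R}\xi$ and the eigendistributions ${\mathcal D}(\lambda)$, ${\mathcal D}(-\lambda)$ of $h$, $\lambda=\sqrt{1-\kappa}$, which define two Legendre foliations; $({\mathcal D}(\lambda),{\mathcal D}(-\lambda))$ is the associated bi-Legendrian structure. A Legendre foliation ${\mathcal F}$ of $(M^{2n+1},\eta)$ is a foliation whose tangent bundle $T{\mathcal F}$ is an $n$-dimensional subbundle of $\ker\eta$ (on which $d\eta$ then vanishes). Its Pang invariant is the symmetric bilinear form on $T{\mathcal F}$, $\Pi_{\mathcal F}(X,X')=-({\mathcal L}_X{\mathcal L}_{X'}\eta)(\xi)=2d\eta([\xi,X],X')$. ${\mathcal F}$ is flat if $\Pi_{\mathcal F}\equiv0$, positive (negative) definite if $\Pi_{\mathcal F}$ is positive (negative) definite. A bi-Legendrian structure on $(M,\eta)$ is a pair $({\mathcal F}_1,{\mathcal F}_2)$ of transversal Legendre foliations, so that $TM=L_1\oplus L_2\oplus\mathbb{R}\xi$ with $L_i=T{\mathcal F}_i$. Its bi-Legendrian connection $\nabla^{bl}$ is the unique linear connection such that: (i) $\nabla^{bl}L_1\subset L_1$, $\nabla^{bl}L_2\subset L_2$; (ii) $\nabla^{bl}\xi=0$, $\nabla^{bl}d\eta=0$; (iii) its torsion satisfies $T^{bl}(X,Y)=2d\eta(X,Y)\xi$ for $X\in\Gamma(L_1)$,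 $Y\in\Gamma(L_2)$, and $T^{bl}(X,\xi)=[\xi,X_{L_1}]_{L_2}+[\xi,X_{L_2}]_{L_1}$ for all $X\in\Gamma(TM)$, where subscripts denote projections onto $L_1,L_2$ in the splitting $TM=L_1\oplus L_2\oplus\mathbb{R}\xi$. *)

theory Defs
  imports "HOL-Analysis.Analysis" "HOL-Library.Function_Algebras"
begin

section \<open>Smooth manifolds\<close>

fun Ck_on :: "nat \<Rightarrow> 'a::real_normed_vector set \<Rightarrow> ('a \<Rightarrow> 'b::real_normed_vector) \<Rightarrow> bool" where
  "Ck_on 0 S f \<longleftrightarrow> continuous_on S f"
| "Ck_on (Suc k) S f \<longleftrightarrow>
     (\<forall>x\<in>S. f differentiable (at x)) \<and>
     (\<forall>v. Ck_on k S (\<lambda>x. frechet_derivative f (at x) v))"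

text \<open>Intended for open \<open>S\<close> in a finite-dimensional space, where continuity of all iterated
  directional derivatives is the usual notion of smoothness.\<close>

definition smooth_on :: "'a::real_normed_vector set \<Rightarrow> ('a \<Rightarrow> 'b::real_normed_vector) \<Rightarrow> bool" where
  "smooth_on S f \<longleftrightarrow> (\<forall>k. Ck_on k S f)"

text \<open>The manifold is the whole type \<open>'m\<close>, the model space \<open>'e\<close> plays the role of the
  coordinate space, and the dimension of the manifold is \<open>DIM('e)\<close>.
  A chart is a pair of its domain and its coordinate map.\<close>

type_synonym ('m, 'e) chart = "'m set \<times> ('m \<Rightarrow> 'e)"

definition is_chart :: "('m::topological_space, 'e::euclidean_space) chart \<Rightarrow> bool" where
  "is_chart = (\<lambda>(U, \<psi>). open U \<and> open (\<psi> ` U) \<and> homeomorphism U (\<psi> ` U) \<psi> (inv_into U \<psi>))"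

definition chart_compatible ::
  "('m::topological_space, 'e::euclidean_space) chart \<Rightarrow> ('m, 'e) chart \<Rightarrow> bool" where
  "chart_compatible = (\<lambda>(U, \<psi>) (V, \<theta>).
     smooth_on (\<psi> ` (U \<inter> V)) (\<theta> \<circ> inv_into U \<psi>) \<and>
     smooth_on (\<theta> ` (U \<inter> V)) (\<psi> \<circ> inv_into V \<theta>))"

definition smooth_atlas :: "('m::topological_space, 'e::euclidean_space) chart set \<Rightarrow> bool" where
  "smooth_atlas A \<longleftrightarrow>
     (\<forall>c\<in>A. is_chart c) \<and> (\<Union>c\<in>A. fst c) = UNIV \<and>
     (\<forall>c\<in>A. \<forall>d\<in>A. chart_compatible c d)"

text \<open>The charts of the maximal atlas determined by \<open>A\<close>:\<close>

definition smooth_chart ::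
  "('m::topological_space, 'e::euclidean_space) chart set \<Rightarrow> ('m, 'e) chart \<Rightarrow> bool" where
  "smooth_chart A c \<longleftrightarrow> is_chart c \<and> (\<forall>d\<in>A. chart_compatible c d)"

definition smooth_fun ::
  "('m::topological_space, 'e::euclidean_space) chart set \<Rightarrow> ('m \<Rightarrow> real) \<Rightarrow> bool" where
  "smooth_fun A f \<longleftrightarrow> (\<forall>(U, \<psi>)\<in>A. smooth_on (\<psi> ` U) (f \<circ> inv_into U \<psi>))"


section \<open>Tangent vectors and vector fields\<close>

text \<open>Tangent vectors are derivations of the algebra of smooth functions. The value on
  functions that are not smooth is fixed to be \<open>0\<close>, so that equality of tangent vectors
  and of vector fields is equality of HOL functions.\<close>

type_synonym 'm tvec = "('m \<Rightarrow> real) \<Rightarrow> real"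
type_synonym 'm vfield = "'m \<Rightarrow> 'm tvec"

definition tangent_space ::
  "('m::topological_space, 'e::euclidean_space) chart set \<Rightarrow> 'm \<Rightarrow> 'm tvec set" where
  "tangent_space A p = {v.
     (\<forall>f g. smooth_fun A f \<and> smooth_fun A g \<longrightarrow>
        v (f + g) = v f + v g \<and> v (f * g) = f p * v g + g p * v f) \<and>
     (\<forall>f a. smooth_fun A f \<longrightarrow> v (\<lambda>x. a * f x) = a * v f) \<and>
     (\<forall>f. \<not> smooth_fun A f \<longrightarrow> v f = 0)}"

text \<open>The tangent vector at \<open>p\<close> with constant coordinates \<open>w\<close> in the chart \<open>(U, \<psi>)\<close>:\<close>

definition coord_vector ::
  "('m::topological_space, 'e::euclidean_space) chart set \<Rightarrow> ('m, 'e) chart \<Rightarrow> 'm \<Rightarrow> 'e \<Rightarrow> 'm tvec"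
  where
  "coord_vector A = (\<lambda>(U, \<psi>) p w f.
     if smooth_fun A f then frechet_derivative (f \<circ> inv_into U \<psi>) (at (\<psi> p)) w else 0)"

definition vfield_apply :: "'m vfield \<Rightarrow> ('m \<Rightarrow> real) \<Rightarrow> 'm \<Rightarrow> real" where
  "vfield_apply X f = (\<lambda>p. X p f)"

definition vector_field ::
  "('m::topological_space, 'e::euclidean_space) chart set \<Rightarrow> 'm vfield \<Rightarrow> bool" where
  "vector_field A X \<longleftrightarrow> (\<forall>p. X p \<in> tangent_space A p) \<and>
     (\<forall>f. smooth_fun A f \<longrightarrow> smooth_fun A (vfield_apply X f))"

definition fscale :: "('m \<Rightarrow> real) \<Rightarrow> 'm vfield \<Rightarrow> 'm vfield" (infixr "\<odot>" 75) where
  "f \<odot> X = (\<lambda>p u. f p * X p u)"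

definition cscale :: "real \<Rightarrow> 'm vfield \<Rightarrow> 'm vfield" (infixr "\<cdot>" 75) where
  "a \<cdot> X = (\<lambda>p. a) \<odot> X"

definition bracket :: "'m vfield \<Rightarrow> 'm vfield \<Rightarrow> 'm vfield" where
  "bracket X Y = (\<lambda>p f. X p (vfield_apply Y f) - Y p (vfield_apply X f))"


section \<open>Tensor fields and connections\<close>

text \<open>Tensor fields are given by their action on vector fields, that is, as multilinear maps
  over the ring of smooth functions. Only the values on vector fields matter.\<close>

definition one_form ::
  "('m::topological_space, 'e::euclidean_space) chart set \<Rightarrow> ('m vfield \<Rightarrow> 'm \<Rightarrow> real) \<Rightarrow> bool" where
  "one_form A \<alpha> \<longleftrightarrow>
     (\<forall>X. vector_field A X \<longrightarrow> smooth_fun A (\<alpha> X)) \<and>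
     (\<forall>X Y. vector_field A X \<and> vector_field A Y \<longrightarrow> \<alpha> (X + Y) = \<alpha> X + \<alpha> Y) \<and>
     (\<forall>f X. smooth_fun A f \<and> vector_field A X \<longrightarrow> \<alpha> (f \<odot> X) = f * \<alpha> X)"

definition endo_tensor ::
  "('m::topological_space, 'e::euclidean_space) chart set \<Rightarrow> ('m vfield \<Rightarrow> 'm vfield) \<Rightarrow> bool" where
  "endo_tensor A \<phi> \<longleftrightarrow>
     (\<forall>X. vector_field A X \<longrightarrow> vector_field A (\<phi> X)) \<and>
     (\<forall>X Y. vector_field A X \<and> vector_field A Y \<longrightarrow> \<phi> (X + Y) = \<phi> X + \<phi> Y) \<and>
     (\<forall>f X. smooth_fun A f \<and> vector_field A X \<longrightarrow> \<phi> (f \<odot> X) = f \<odot> \<phi> X)"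

definition riemannian_metric ::
  "('m::topological_space, 'e::euclidean_space) chart set \<Rightarrow>
   ('m vfield \<Rightarrow> 'm vfield \<Rightarrow> 'm \<Rightarrow> real) \<Rightarrow> bool" where
  "riemannian_metric A g \<longleftrightarrow>
     (\<forall>X. vector_field A X \<longrightarrow> one_form A (g X)) \<and>
     (\<forall>X Y. vector_field A X \<and> vector_field A Y \<longrightarrow> g X Y = g Y X) \<and>
     (\<forall>X p. vector_field A X \<and> X p \<noteq> 0 \<longrightarrow> g X X p > 0)"

text \<open>Exterior derivative in the convention
  \<open>2 d\<eta>(X, Y) = X(\<eta>(Y)) - Y(\<eta>(X)) - \<eta>([X, Y])\<close>.\<close>

definition ext_d :: "('m vfield \<Rightarrow> 'm \<Rightarrow> real) \<Rightarrow> 'm vfield \<Rightarrow> 'm vfield \<Rightarrow> 'm \<Rightarrow> real" where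
  "ext_d \<eta> X Y =
     (\<lambda>p. (vfield_apply X (\<eta> Y) p - vfield_apply Y (\<eta> X) p - \<eta> (bracket X Y) p) / 2)"

definition lie_form ::
  "'m vfield \<Rightarrow> ('m vfield \<Rightarrow> 'm \<Rightarrow> real) \<Rightarrow> 'm vfield \<Rightarrow> 'm \<Rightarrow> real" where
  "lie_form X \<alpha> Z = vfield_apply X (\<alpha> Z) - \<alpha> (bracket X Z)"

definition lie_endo :: "'m vfield \<Rightarrow> ('m vfield \<Rightarrow> 'm vfield) \<Rightarrow> 'm vfield \<Rightarrow> 'm vfield" where
  "lie_endo X \<phi> Z = bracket X (\<phi> Z) - \<phi> (bracket X Z)"

definition linear_connection ::
  "('m::topological_space, 'e::euclidean_space) chart set \<Rightarrow>
   ('m vfield \<Rightarrow> 'm vfield \<Rightarrow> 'm vfield) \<Rightarrow> bool" where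
  "linear_connection A D \<longleftrightarrow>
     (\<forall>Y. vector_field A Y \<longrightarrow> endo_tensor A (\<lambda>X. D X Y)) \<and>
     (\<forall>X Y Z. vector_field A X \<and> vector_field A Y \<and> vector_field A Z \<longrightarrow>
        D X (Y + Z) = D X Y + D X Z) \<and>
     (\<forall>f X Y. smooth_fun A f \<and> vector_field A X \<and> vector_field A Y \<longrightarrow>
        D X (f \<odot> Y) = vfield_apply X f \<odot> Y + f \<odot> D X Y)"

definition torsion ::
  "('m vfield \<Rightarrow> 'm vfield \<Rightarrow> 'm vfield) \<Rightarrow> 'm vfield \<Rightarrow> 'm vfield \<Rightarrow> 'm vfield" where
  "torsion D X Y = D X Y - D Y X - bracket X Y"

definition curvature ::
  "('m vfield \<Rightarrow> 'm vfield \<Rightarrow> 'm vfield) \<Rightarrow>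
   'm vfield \<Rightarrow> 'm vfield \<Rightarrow> 'm vfield \<Rightarrow> 'm vfield" where
  "curvature D X Y Z = D X (D Y Z) - D Y (D X Z) - D (bracket X Y) Z"

definition levi_civita ::
  "('m::topological_space, 'e::euclidean_space) chart set \<Rightarrow>
   ('m vfield \<Rightarrow> 'm vfield \<Rightarrow> 'm \<Rightarrow> real) \<Rightarrow> ('m vfield \<Rightarrow> 'm vfield \<Rightarrow> 'm vfield) \<Rightarrow> bool" where
  "levi_civita A g D \<longleftrightarrow> linear_connection A D \<and>
     (\<forall>X Y. vector_field A X \<and> vector_field A Y \<longrightarrow> torsion D X Y = 0) \<and>
     (\<forall>X Y Z. vector_field A X \<and> vector_field A Y \<and> vector_field A Z \<longrightarrow>
        vfield_apply Z (g X Y) = g (D Z X) Y + g X (D Z Y))"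


section \<open>Contact manifolds\<close>

text \<open>\<open>\<eta> \<and> (d\<eta>)^n\<close> evaluated on \<open>Xs 0, ..., Xs (2 n)\<close>; the wedge product is the alternation of
  the tensor product (with the factor \<open>1 / (2 n + 1)!\<close>), which is the normalisation that goes
  with the factor \<open>2\<close> in the convention for \<open>d\<eta>\<close>.\<close>

definition contact_volume ::
  "nat \<Rightarrow> ('m vfield \<Rightarrow> 'm \<Rightarrow> real) \<Rightarrow> (nat \<Rightarrow> 'm vfield) \<Rightarrow> 'm \<Rightarrow> real" where
  "contact_volume n \<eta> Xs p =
     (\<Sum>\<sigma> | \<sigma> permutes {..<2 * n + 1}. of_int (sign \<sigma>) * \<eta> (Xs (\<sigma> 0)) p *
        (\<Prod>i<n. ext_d \<eta> (Xs (\<sigma> (2 * i + 1))) (Xs (\<sigma> (2 * i + 2))) p)) / fact (2 * n + 1)"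

definition contact_form ::
  "('m::topological_space, 'e::euclidean_space) chart set \<Rightarrow> nat \<Rightarrow>
   ('m vfield \<Rightarrow> 'm \<Rightarrow> real) \<Rightarrow> bool" where
  "contact_form A n \<eta> \<longleftrightarrow> DIM('e) = 2 * n + 1 \<and> one_form A \<eta> \<and>
     (\<forall>p. \<exists>Xs. (\<forall>i. vector_field A (Xs i)) \<and> contact_volume n \<eta> Xs p \<noteq> 0)"

definition reeb_field ::
  "('m::topological_space, 'e::euclidean_space) chart set \<Rightarrow> ('m vfield \<Rightarrow> 'm \<Rightarrow> real) \<Rightarrow>
   'm vfield \<Rightarrow> bool" where
  "reeb_field A \<eta> \<xi> \<longleftrightarrow> vector_field A \<xi> \<and> \<eta> \<xi> = 1 \<and>
     (\<forall>X. vector_field A X \<longrightarrow> ext_d \<eta> \<xi> X = 0)"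

definition contact_metric_structure ::
  "('m::topological_space, 'e::euclidean_space) chart set \<Rightarrow> ('m vfield \<Rightarrow> 'm vfield) \<Rightarrow>
   'm vfield \<Rightarrow> ('m vfield \<Rightarrow> 'm \<Rightarrow> real) \<Rightarrow> ('m vfield \<Rightarrow> 'm vfield \<Rightarrow> 'm \<Rightarrow> real) \<Rightarrow> bool" where
  "contact_metric_structure A \<phi> \<xi> \<eta> g \<longleftrightarrow>
     reeb_field A \<eta> \<xi> \<and> endo_tensor A \<phi> \<and> riemannian_metric A g \<and>
     (\<forall>X. vector_field A X \<longrightarrow> \<phi> (\<phi> X) = - X + \<eta> X \<odot> \<xi>) \<and>
     (\<forall>X Y. vector_field A X \<and> vector_field A Y \<longrightarrow> ext_d \<eta> X Y = g X (\<phi> Y)) \<and>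
     (\<forall>X Y. vector_field A X \<and> vector_field A Y \<longrightarrow> g (\<phi> X) (\<phi> Y) = g X Y - \<eta> X * \<eta> Y)"

definition h_tensor :: "('m vfield \<Rightarrow> 'm vfield) \<Rightarrow> 'm vfield \<Rightarrow> 'm vfield \<Rightarrow> 'm vfield" where
  "h_tensor \<phi> \<xi> X = (1 / 2) \<cdot> lie_endo \<xi> \<phi> X"

text \<open>The Levi-Civita connection of \<open>g\<close> exists and is unique, hence the bound variable \<open>D\<close>
  below refers to exactly that connection.\<close>

definition contact_metric_kappa_mu ::
  "('m::topological_space, 'e::euclidean_space) chart set \<Rightarrow> real \<Rightarrow> real \<Rightarrow>
   ('m vfield \<Rightarrow> 'm vfield) \<Rightarrow> 'm vfield \<Rightarrow> ('m vfield \<Rightarrow> 'm \<Rightarrow> real) \<Rightarrow>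
   ('m vfield \<Rightarrow> 'm vfield \<Rightarrow> 'm \<Rightarrow> real) \<Rightarrow> bool" where
  "contact_metric_kappa_mu A \<kappa> \<mu> \<phi> \<xi> \<eta> g \<longleftrightarrow>
     contact_metric_structure A \<phi> \<xi> \<eta> g \<and>
     (\<exists>D. levi_civita A g D \<and>
        (\<forall>X Y. vector_field A X \<and> vector_field A Y \<longrightarrow>
           curvature D X Y \<xi> =
             \<kappa> \<cdot> (\<eta> Y \<odot> X - \<eta> X \<odot> Y) +
             \<mu> \<cdot> (\<eta> Y \<odot> h_tensor \<phi> \<xi> X - \<eta> X \<odot> h_tensor \<phi> \<xi> Y)))"


section \<open>Legendre foliations and bi-Legendrian structures\<close>

text \<open>Distributions are families of sets of tangent vectors.\<close>

type_synonym 'm distrib = "'m \<Rightarrow> 'm tvec set"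

text \<open>\<open>L\<close> is the tangent bundle of an \<open>n\<close>-dimensional foliation: around every point there is a
  foliated chart, that is, a chart of the maximal atlas in which \<open>L\<close> is spanned by the
  coordinate fields of \<open>n\<close> of the coordinates (so that the plaques are the corresponding
  coordinate slices). A foliation is determined by its tangent bundle and is represented by it
  in what follows.\<close>

definition foliation ::
  "('m::topological_space, 'e::euclidean_space) chart set \<Rightarrow> nat \<Rightarrow> 'm distrib \<Rightarrow> bool" where
  "foliation A n L \<longleftrightarrow>
     (\<forall>p. \<exists>c B. smooth_chart A c \<and> p \<in> fst c \<and> B \<subseteq> Basis \<and> card B = n \<and>
        (\<forall>q\<in>fst c. L q = coord_vector A c q ` span B))"

definition section_of ::
  "('m::topological_space, 'e::euclidean_space) chart set \<Rightarrow> 'm distrib \<Rightarrow> 'm vfield \<Rightarrow> bool" where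
  "section_of A L X \<longleftrightarrow> vector_field A X \<and> (\<forall>p. X p \<in> L p)"

definition legendre_foliation ::
  "('m::topological_space, 'e::euclidean_space) chart set \<Rightarrow> nat \<Rightarrow>
   ('m vfield \<Rightarrow> 'm \<Rightarrow> real) \<Rightarrow> 'm distrib \<Rightarrow> bool" where
  "legendre_foliation A n \<eta> L \<longleftrightarrow> foliation A n L \<and>
     (\<forall>X p. vector_field A X \<and> X p \<in> L p \<longrightarrow> \<eta> X p = 0)"

definition pang_invariant ::
  "('m vfield \<Rightarrow> 'm \<Rightarrow> real) \<Rightarrow> 'm vfield \<Rightarrow> 'm vfield \<Rightarrow> 'm vfield \<Rightarrow> 'm \<Rightarrow> real" where
  "pang_invariant \<eta> \<xi> X X' = - lie_form X (lie_form X' \<eta>) \<xi>"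

definition flat_foliation ::
  "('m::topological_space, 'e::euclidean_space) chart set \<Rightarrow> ('m vfield \<Rightarrow> 'm \<Rightarrow> real) \<Rightarrow>
   'm vfield \<Rightarrow> 'm distrib \<Rightarrow> bool" where
  "flat_foliation A \<eta> \<xi> L \<longleftrightarrow>
     (\<forall>X X'. section_of A L X \<and> section_of A L X' \<longrightarrow> pang_invariant \<eta> \<xi> X X' = 0)"

definition positive_definite_foliation ::
  "('m::topological_space, 'e::euclidean_space) chart set \<Rightarrow> ('m vfield \<Rightarrow> 'm \<Rightarrow> real) \<Rightarrow>
   'm vfield \<Rightarrow> 'm distrib \<Rightarrow> bool" where
  "positive_definite_foliation A \<eta> \<xi> L \<longleftrightarrow>
     (\<forall>X p. section_of A L X \<and> X p \<noteq> 0 \<longrightarrow> pang_invariant \<eta> \<xi> X X p > 0)"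

definition negative_definite_foliation ::
  "('m::topological_space, 'e::euclidean_space) chart set \<Rightarrow> ('m vfield \<Rightarrow> 'm \<Rightarrow> real) \<Rightarrow>
   'm vfield \<Rightarrow> 'm distrib \<Rightarrow> bool" where
  "negative_definite_foliation A \<eta> \<xi> L \<longleftrightarrow>
     (\<forall>X p. section_of A L X \<and> X p \<noteq> 0 \<longrightarrow> pang_invariant \<eta> \<xi> X X p < 0)"

text \<open>Transversality is the splitting \<open>TM = L1 \<oplus> L2 \<oplus> \<real>\<xi>\<close>.\<close>

definition bi_legendrian_structure ::
  "('m::topological_space, 'e::euclidean_space) chart set \<Rightarrow> nat \<Rightarrow>
   ('m vfield \<Rightarrow> 'm \<Rightarrow> real) \<Rightarrow> 'm vfield \<Rightarrow> 'm distrib \<Rightarrow> 'm distrib \<Rightarrow> bool" where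
  "bi_legendrian_structure A n \<eta> \<xi> L1 L2 \<longleftrightarrow>
     legendre_foliation A n \<eta> L1 \<and> legendre_foliation A n \<eta> L2 \<and>
     (\<forall>p. \<forall>v\<in>tangent_space A p.
        \<exists>!(u, w, a). u \<in> L1 p \<and> w \<in> L2 p \<and> v = u + w + (a \<cdot> \<xi>) p)"

text \<open>Projection onto \<open>L\<close> in the splitting \<open>TM = L \<oplus> L' \<oplus> \<real>\<xi>\<close>:\<close>

definition splitting_proj ::
  "'m distrib \<Rightarrow> 'm distrib \<Rightarrow> 'm vfield \<Rightarrow> 'm vfield \<Rightarrow> 'm vfield" where
  "splitting_proj L L' \<xi> X =
     (\<lambda>p. THE u. u \<in> L p \<and> (\<exists>w a. w \<in> L' p \<and> X p = u + w + (a \<cdot> \<xi>) p))"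

definition bi_legendrian_connection ::
  "('m::topological_space, 'e::euclidean_space) chart set \<Rightarrow>
   ('m vfield \<Rightarrow> 'm \<Rightarrow> real) \<Rightarrow> 'm vfield \<Rightarrow> 'm distrib \<Rightarrow> 'm distrib \<Rightarrow>
   ('m vfield \<Rightarrow> 'm vfield \<Rightarrow> 'm vfield) \<Rightarrow> bool" where
  "bi_legendrian_connection A \<eta> \<xi> L1 L2 D \<longleftrightarrow> linear_connection A D \<and>
     (\<forall>X Y. vector_field A X \<and> section_of A L1 Y \<longrightarrow> section_of A L1 (D X Y)) \<and>
     (\<forall>X Y. vector_field A X \<and> section_of A L2 Y \<longrightarrow> section_of A L2 (D X Y)) \<and>
     (\<forall>X. vector_field A X \<longrightarrow> D X \<xi> = 0) \<and>
     (\<forall>X Y Z. vector_field A X \<and> vector_field A Y \<and> vector_field A Z \<longrightarrow>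
        vfield_apply Z (ext_d \<eta> X Y) = ext_d \<eta> (D Z X) Y + ext_d \<eta> X (D Z Y)) \<and>
     (\<forall>X Y. section_of A L1 X \<and> section_of A L2 Y \<longrightarrow>
        torsion D X Y = (\<lambda>p. 2 * ext_d \<eta> X Y p) \<odot> \<xi>) \<and>
     (\<forall>X. vector_field A X \<longrightarrow>
        torsion D X \<xi> =
          splitting_proj L2 L1 \<xi> (bracket \<xi> (splitting_proj L1 L2 \<xi> X)) +
          splitting_proj L1 L2 \<xi> (bracket \<xi> (splitting_proj L2 L1 \<xi> X)))"

text \<open>Vanishing of the covariant derivative of the Pang invariant, a bilinear form on the
  bundle \<open>L\<close>, for a connection that preserves \<open>L\<close>:\<close>

definition pang_parallel ::
  "('m::topological_space, 'e::euclidean_space) chart set \<Rightarrow>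
   ('m vfield \<Rightarrow> 'm \<Rightarrow> real) \<Rightarrow> 'm vfield \<Rightarrow> 'm distrib \<Rightarrow>
   ('m vfield \<Rightarrow> 'm vfield \<Rightarrow> 'm vfield) \<Rightarrow> bool" where
  "pang_parallel A \<eta> \<xi> L D \<longleftrightarrow>
     (\<forall>Z X X'. vector_field A Z \<and> section_of A L X \<and> section_of A L X' \<longrightarrow>
        vfield_apply Z (pang_invariant \<eta> \<xi> X X') =
          pang_invariant \<eta> \<xi> (D Z X) X' + pang_invariant \<eta> \<xi> X (D Z X'))"

definition h_eigendistribution ::
  "('m::topological_space, 'e::euclidean_space) chart set \<Rightarrow>
   ('m vfield \<Rightarrow> 'm vfield) \<Rightarrow> 'm vfield \<Rightarrow> real \<Rightarrow> 'm distrib" where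
  "h_eigendistribution A \<phi> \<xi> r p =
     {X p | X. vector_field A X \<and> h_tensor \<phi> \<xi> X p = (r \<cdot> X) p}"

text \<open>\<open>(L1, L2)\<close> is the bi-Legendrian structure \<open>(D(\<lambda>), D(-\<lambda>))\<close>, \<open>\<lambda> = sqrt (1 - \<kappa>)\<close>, associated
  to a contact metric \<open>(\<kappa>, \<mu>)\<close>-structure with \<open>\<kappa> < 1\<close>:\<close>

definition associated_bi_legendrian ::
  "('m::topological_space, 'e::euclidean_space) chart set \<Rightarrow> real \<Rightarrow>
   ('m vfield \<Rightarrow> 'm vfield) \<Rightarrow> 'm vfield \<Rightarrow> 'm distrib \<Rightarrow> 'm distrib \<Rightarrow> bool" where
  "associated_bi_legendrian A \<kappa> \<phi> \<xi> L1 L2 \<longleftrightarrow> \<kappa> < 1 \<and>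
     L1 = h_eigendistribution A \<phi> \<xi> (sqrt (1 - \<kappa>)) \<and>
     L2 = h_eigendistribution A \<phi> \<xi> (- sqrt (1 - \<kappa>))"

text \<open>Existence of a compatible contact metric \<open>(\<kappa>, \<mu>)\<close>-structure with associated bi-Legendrian
  structure \<open>(L1, L2)\<close>:\<close>

definition admits_kappa_mu ::
  "('m::topological_space, 'e::euclidean_space) chart set \<Rightarrow>
   ('m vfield \<Rightarrow> 'm \<Rightarrow> real) \<Rightarrow> 'm vfield \<Rightarrow> 'm distrib \<Rightarrow> 'm distrib \<Rightarrow> real \<Rightarrow> real \<Rightarrow> bool" where
  "admits_kappa_mu A \<eta> \<xi> L1 L2 \<kappa> \<mu> \<longleftrightarrow>
     (\<exists>\<phi> g. contact_metric_kappa_mu A \<kappa> \<mu> \<phi> \<xi> \<eta> g \<and>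
        associated_bi_legendrian A \<kappa> \<phi> \<xi> L1 L2)"

end

theory Submission
  imports Defs
begin

text \<open>
  Let \<open>(F, G)\<close> be the pair in which \<open>F\<close> is the definite and \<open>G\<close> the flat foliation. An
  eigenbundle condition \<open>h = c/4\<close> on \<open>F\<close> forces \<open>\<phi> X = (2/c) [\<xi>, X]\<^bsub>G\<^esub>\<close> for \<open>X\<close> in \<open>F\<close>, so the
  structure is determined by the bundle map \<open>\<psi> X = [\<xi>, X\<^bsub>F\<^esub>]\<^bsub>G\<^esub>\<close>, for which
  \<open>\<Pi>\<^bsub>F\<^esub>(X, Y) = 2 d\<eta>(\<psi> X, Y)\<close>. Definiteness makes \<open>\<psi> : F \<rightarrow> G\<close> invertible and, up to the factor
  \<open>1/c\<close>, turns \<open>\<Pi>\<^bsub>F\<^esub>\<close> into the metric on \<open>F\<close>; since \<open>d\<eta>\<close> and \<open>\<Pi>\<^bsub>F\<^esub>\<close> are parallel, so are \<open>\<psi>\<close>, \<open>\<phi>\<close> and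
  the metric. The bi-Legendrian connection is therefore metric, and its torsion is
  \<open>2 d\<eta>(X, Y) \<xi> + \<eta>(Y) \<psi> X - \<eta>(X) \<psi> Y\<close>. Subtracting the contorsion gives the Levi-Civita
  connection explicitly, and as all tensors involved are parallel, its curvature on \<open>\<xi>\<close> is
  algebraic in \<open>\<phi>\<close>, \<open>h\<close> and \<open>\<eta>\<close>. The two cases of the theorem are \<open>(F, G) = (L1, L2)\<close> with
  \<open>c > 0\<close> and \<open>(F, G) = (L2, L1)\<close> with \<open>c < 0\<close>.
\<close>

text \<open>The constants come from expanding h = (1/2) L_\<xi> \<phi> on X in F. Flatness of G
  keeps [\<xi>, \<phi> X] inside G, so the F part of h X is -(1/2) \<phi> [\<xi>, X]_G; equating it
  with (c/4) X gives the factor 2/c, and \<phi>^2 = -I on ker \<eta> then forces -c/2 times the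
  inverse of \<open>\<psi>\<close> on G. The curvature operator X \<mapsto> R(X, \<xi>) \<xi> acts
  on F and G by \<kappa> + \<mu> c/4 and \<kappa> - \<mu> c/4, which is where \<kappa> and \<mu> are
  read off. The algebra is short; the length is due to smoothness. Tensors act on global fields,
  tangent vectors are bare derivations, and foliations are visible only in charts. The projections
  of the splitting and the inverse of \<open>\<psi>\<close> are at first known pointwise. Dual
  coframes show them to be smooth, and cut-off functions turn local frames into global sections.
  Definiteness has a second task: it supplies the nondegeneracy of d\<eta> between F and G by which
  identities tested against sections become identities of fields.\<close>

section \<open>Smooth functions on open sets\<close>

text \<open>Openness turns agreement on \<open>S\<close> into agreement near each of its points, so
  the derivatives, taken with the full filter \<open>at x\<close>, agree as well.\<close>

lemma Ck_on_cong:
  assumes "open S" "Ck_on k S f" "\<And>x. x \<in> S \<Longrightarrow> f x = g x"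
  shows "Ck_on k S g"
  using assms(2,3)
proof (induction k arbitrary: f g)
  case 0
  then show ?case by (simp cong: continuous_on_cong)
next
  case (Suc k)
  have d: "(g has_derivative frechet_derivative f (at x)) (at x)" if "x \<in> S" for x
    using Suc.prems that assms(1)
    by (metis Ck_on.simps(2) frechet_derivative_works has_derivative_transform_within_open)
  have e: "frechet_derivative f (at x) = frechet_derivative g (at x)" if "x \<in> S" for x
    using frechet_derivative_at[OF d[OF that]] .
  show ?case
    using Suc.IH[of "\<lambda>x. frechet_derivative f (at x) v" "\<lambda>x. frechet_derivative g (at x) v" for v]
      Suc.prems d e by (auto simp: differentiable_def)
qed

text \<open>A derivative at a point is unique, so any known one may replace the chosen
  \<open>frechet_derivative\<close>; the calculus rules enter the inductions below in this
  form.\<close>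

lemma Ck_on_SucI:
  assumes "open S" "\<And>x. x \<in> S \<Longrightarrow> (f has_derivative f' x) (at x)" "\<And>v. Ck_on k S (\<lambda>x. f' x v)"
  shows "Ck_on (Suc k) S f"
proof -
  have "frechet_derivative f (at x) = f' x" if "x \<in> S" for x
    using frechet_derivative_at[OF assms(2)[OF that]] by simp
  then have "Ck_on k S (\<lambda>x. frechet_derivative f (at x) v)" for v
    by (intro Ck_on_cong[OF assms(1) assms(3)[of v]]) simp
  with assms(2) show ?thesis by (auto simp: differentiable_def)
qed

lemma Ck_on_SucD:
  assumes "Ck_on (Suc k) S f" "x \<in> S"
  shows "(f has_derivative frechet_derivative f (at x)) (at x)"
  using assms by (simp add: frechet_derivative_works[symmetric])

lemma Ck_on_Suc_imp: "Ck_on (Suc k) S f \<Longrightarrow> Ck_on k S f"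
proof (induction k arbitrary: f)
  case 0
  then show ?case
    by (auto intro!: continuous_at_imp_continuous_on differentiable_imp_continuous_within)
qed auto

lemma Ck_on_subset: "Ck_on k S f \<Longrightarrow> T \<subseteq> S \<Longrightarrow> Ck_on k T f"
  by (induction k arbitrary: f) (auto intro: continuous_on_subset)

lemma Ck_on_local:
  assumes "\<And>x. x \<in> S \<Longrightarrow> \<exists>T. open T \<and> x \<in> T \<and> Ck_on k T f"
  shows "Ck_on k S f"
  using assms
proof (induction k arbitrary: f)
  case 0
  then show ?case
    by (auto intro!: continuous_at_imp_continuous_on simp: continuous_on_eq_continuous_at)
      (metis continuous_on_eq_continuous_at)
next
  case (Suc k)
  show ?case
    unfolding Ck_on.simps
  proof (intro conjI ballI allI Suc.IH)
    show "f differentiable at x" if "x \<in> S" for x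
      using Suc.prems[OF that] by auto
    show "\<exists>T. open T \<and> x \<in> T \<and> Ck_on k T (\<lambda>x. frechet_derivative f (at x) v)" if "x \<in> S" for x v
      using Suc.prems[OF that] by auto
  qed
qed

lemma Ck_on_const: "open S \<Longrightarrow> Ck_on k S (\<lambda>x. a)"
  by (induction k arbitrary: a) auto

lemma Ck_on_add:
  assumes "open S" "Ck_on k S f" "Ck_on k S g"
  shows "Ck_on k S (\<lambda>x. f x + g x)"
  using assms(2,3)
proof (induction k arbitrary: f g)
  case (Suc k)
  show ?case
    by (rule Ck_on_SucI[OF assms(1) has_derivative_add[OF Ck_on_SucD[OF Suc.prems(1)] Ck_on_SucD[OF Suc.prems(2)]]])
       (use Suc in auto)
qed (auto intro: continuous_intros)

lemma Ck_on_mult: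
  fixes f g :: "'a::real_normed_vector \<Rightarrow> real"
  assumes "open S" "Ck_on k S f" "Ck_on k S g"
  shows "Ck_on k S (\<lambda>x. f x * g x)"
  using assms(2,3)
proof (induction k arbitrary: f g)
  case (Suc k)
  \<comment> \<open>Each term of the product rule keeps one factor undifferentiated, which is
    therefore needed at the lower order.\<close>
  have "Ck_on k S f" "Ck_on k S g"
    using Suc.prems Ck_on_Suc_imp by blast+
  then have "Ck_on k S (\<lambda>x. f x * frechet_derivative g (at x) v + frechet_derivative f (at x) v * g x)" for v
    using Suc.prems by (intro Ck_on_add Suc.IH assms(1)) simp_all
  then show ?case
    by (intro Ck_on_SucI[OF assms(1) has_derivative_mult[OF Ck_on_SucD[OF Suc.prems(1)] Ck_on_SucD[OF Suc.prems(2)]]]) auto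
qed (auto intro: continuous_intros)

lemma Ck_on_bounded_linear:
  assumes "open S" "Ck_on k S f" "bounded_linear l"
  shows "Ck_on k S (\<lambda>x. l (f x))"
  using assms(2)
proof (induction k arbitrary: f)
  case 0
  then show ?case using assms(3) by (auto intro: bounded_linear.continuous_on)
next
  case (Suc k)
  show ?case
    by (rule Ck_on_SucI[OF assms(1) bounded_linear.has_derivative[OF assms(3) Ck_on_SucD[OF Suc.prems]]])
       (use Suc in auto)
qed

lemma Ck_on_ident: "open S \<Longrightarrow> Ck_on k S (\<lambda>x. x)"
proof (cases k)
  case (Suc j)
  assume "open S"
  then show ?thesis unfolding Suc by (intro Ck_on_SucI[where f'="\<lambda>_ v. v"]) (auto intro: Ck_on_const)
qed simp

lemma Ck_on_sum:
  assumes "open S" "\<And>i. i \<in> I \<Longrightarrow> Ck_on k S (f i)"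
  shows "Ck_on k S (\<lambda>x. \<Sum>i\<in>I. f i x)"
  using assms(2)
  by (induction I rule: infinite_finite_induct) (auto intro: Ck_on_const Ck_on_add assms(1))

lemma Ck_on_inverse:
  fixes f :: "'a::real_normed_vector \<Rightarrow> real"
  assumes "open S" "Ck_on k S f" "\<And>x. x \<in> S \<Longrightarrow> f x \<noteq> 0"
  shows "Ck_on k S (\<lambda>x. inverse (f x))"
  using assms(2,3)
proof (induction k arbitrary: f)
  case 0
  then show ?case by (auto intro: continuous_intros)
next
  case (Suc k)
  have i: "Ck_on k S (\<lambda>x. inverse (f x))"
    using Suc Ck_on_Suc_imp by blast
  have "Ck_on k S (\<lambda>x. (- 1) * (inverse (f x) * frechet_derivative f (at x) v * inverse (f x)))" for v
    using Suc.prems by (intro Ck_on_mult i assms(1) Ck_on_const) auto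
  then show ?case
    by (intro Ck_on_SucI[OF assms(1) Deriv.has_derivative_inverse[OF Suc.prems(2) Ck_on_SucD[OF Suc.prems(1)]]])
       auto
qed

text \<open>The chain rule differentiates \<open>g\<close> in the moving direction
  \<open>frechet_derivative f (at x) v\<close>, while \<open>Ck_on\<close> speaks of fixed
  directions. Expanding the direction over \<open>Basis\<close> leaves sums of products of functions
  of lower order.\<close>

lemma Ck_on_compose:
  fixes f :: "'a::real_normed_vector \<Rightarrow> 'b::euclidean_space" and g :: "'b \<Rightarrow> real"
  assumes "open S" "open T" "Ck_on k S f" "Ck_on k T g" "f ` S \<subseteq> T"
  shows "Ck_on k S (\<lambda>x. g (f x))"
  using assms(3-)
proof (induction k arbitrary: g)
  case 0
  then show ?case by (auto intro: continuous_on_compose2)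
next
  case (Suc k)
  have c: "Ck_on k S (\<lambda>x. frechet_derivative g (at (f x)) b)" for b
    using Suc.IH[of "\<lambda>y. frechet_derivative g (at y) b"] Ck_on_Suc_imp[OF Suc.prems(1)] Suc.prems
    by simp
  have eq: "frechet_derivative g (at (f x)) w
      = (\<Sum>b\<in>Basis. (w \<bullet> b) * frechet_derivative g (at (f x)) b)" if "x \<in> S" for x w
  proof -
    have "linear (frechet_derivative g (at (f x)))"
      using Suc.prems that by (intro linear_frechet_derivative) auto
    moreover have "frechet_derivative g (at (f x)) w
        = frechet_derivative g (at (f x)) (\<Sum>b\<in>Basis. (w \<bullet> b) *\<^sub>R b)"
      by (simp add: euclidean_representation)
    ultimately show ?thesis
      by (simp add: linear_sum linear_scale del: euclidean_representation_sum)
  qed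
  show ?case
  proof (rule Ck_on_SucI[OF assms(1)])
    show "((\<lambda>x. g (f x)) has_derivative
        (\<lambda>v. frechet_derivative g (at (f x)) (frechet_derivative f (at x) v))) (at x)" if "x \<in> S" for x
      using has_derivative_compose[OF Ck_on_SucD[OF Suc.prems(1) that] Ck_on_SucD[OF Suc.prems(2)]]
        Suc.prems(3) that by auto
    show "Ck_on k S (\<lambda>x. frechet_derivative g (at (f x)) (frechet_derivative f (at x) v))" for v
    proof (rule Ck_on_cong[OF assms(1), rotated])
      show "(\<Sum>b\<in>Basis. (frechet_derivative f (at x) v \<bullet> b) * frechet_derivative g (at (f x)) b)
          = frechet_derivative g (at (f x)) (frechet_derivative f (at x) v)" if "x \<in> S" for x
        by (rule eq[OF that, symmetric])
      show "Ck_on k S (\<lambda>x. \<Sum>b\<in>Basis. (frechet_derivative f (at x) v \<bullet> b) * frechet_derivative g (at (f x)) b)"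
        using Suc.prems(1)
        by (intro Ck_on_sum Ck_on_mult c assms(1)
            Ck_on_bounded_linear[OF assms(1) _ bounded_linear_inner_left]) auto
    qed
  qed
qed

lemma smooth_on_cong: "open S \<Longrightarrow> smooth_on S f \<Longrightarrow> (\<And>x. x \<in> S \<Longrightarrow> f x = g x) \<Longrightarrow> smooth_on S g"
  unfolding smooth_on_def using Ck_on_cong by blast

lemma smooth_on_subset: "smooth_on S f \<Longrightarrow> T \<subseteq> S \<Longrightarrow> smooth_on T f"
  unfolding smooth_on_def using Ck_on_subset by blast

lemma smooth_on_local:
  assumes "\<And>x. x \<in> S \<Longrightarrow> \<exists>T. open T \<and> x \<in> T \<and> smooth_on T f"
  shows "smooth_on S f"
  unfolding smooth_on_def by (intro allI Ck_on_local) (metis assms smooth_on_def)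

lemma smooth_on_const: "open S \<Longrightarrow> smooth_on S (\<lambda>x. a)"
  by (simp add: smooth_on_def Ck_on_const)

lemma smooth_on_ident: "open S \<Longrightarrow> smooth_on S (\<lambda>x. x)"
  by (simp add: smooth_on_def Ck_on_ident)

lemma smooth_on_add: "open S \<Longrightarrow> smooth_on S f \<Longrightarrow> smooth_on S g \<Longrightarrow> smooth_on S (\<lambda>x. f x + g x)"
  by (simp add: smooth_on_def Ck_on_add)

lemma smooth_on_mult:
  fixes f g :: "'a::real_normed_vector \<Rightarrow> real"
  shows "open S \<Longrightarrow> smooth_on S f \<Longrightarrow> smooth_on S g \<Longrightarrow> smooth_on S (\<lambda>x. f x * g x)"
  by (simp add: smooth_on_def Ck_on_mult)

lemma smooth_on_sum:
  "open S \<Longrightarrow> (\<And>i. i \<in> I \<Longrightarrow> smooth_on S (f i)) \<Longrightarrow> smooth_on S (\<lambda>x. \<Sum>i\<in>I. f i x)"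
  by (simp add: smooth_on_def Ck_on_sum)

lemma smooth_on_bounded_linear:
  "open S \<Longrightarrow> smooth_on S f \<Longrightarrow> bounded_linear l \<Longrightarrow> smooth_on S (\<lambda>x. l (f x))"
  by (simp add: smooth_on_def Ck_on_bounded_linear)

lemma smooth_on_inverse:
  fixes f :: "'a::real_normed_vector \<Rightarrow> real"
  shows "open S \<Longrightarrow> smooth_on S f \<Longrightarrow> (\<And>x. x \<in> S \<Longrightarrow> f x \<noteq> 0) \<Longrightarrow> smooth_on S (\<lambda>x. inverse (f x))"
  by (simp add: smooth_on_def Ck_on_inverse)

lemma smooth_on_compose:
  fixes f :: "'a::real_normed_vector \<Rightarrow> 'b::euclidean_space" and g :: "'b \<Rightarrow> real"
  assumes "open S" "open T" "smooth_on S f" "smooth_on T g" "f ` S \<subseteq> T"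
  shows "smooth_on S (\<lambda>x. g (f x))"
  using assms Ck_on_compose by (simp add: smooth_on_def) blast

lemma smooth_on_imp_continuous_on: "smooth_on S f \<Longrightarrow> continuous_on S f"
  by (metis Ck_on.simps(1) smooth_on_def)

lemma smooth_on_has_derivative:
  "smooth_on S f \<Longrightarrow> x \<in> S \<Longrightarrow> (f has_derivative frechet_derivative f (at x)) (at x)"
  by (meson Ck_on_SucD smooth_on_def)

lemma smooth_on_frechet_derivative:
  "smooth_on S f \<Longrightarrow> smooth_on S (\<lambda>x. frechet_derivative f (at x) v)"
  unfolding smooth_on_def by (metis Ck_on.simps(2))

text \<open>The family \<open>t\<^sup>-\<^sup>n exp (- 1 / t)\<close> is, up to linear combinations, closed under differentiation.\<close>

definition exp_tail :: "nat \<Rightarrow> real \<Rightarrow> real" where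
  "exp_tail n t = (if t > 0 then inverse t ^ n * exp (- inverse t) else 0)"

text \<open>From the right, the substitution s = 1 / t reduces the limit to the decay of s^n / exp s
  at infinity; from the left the function is 0.\<close>

lemma exp_tail_tendsto_0: "(exp_tail n \<longlongrightarrow> 0) (at 0)"
proof -
  have "((\<lambda>x::real. x ^ n / exp x) \<longlongrightarrow> 0) at_top"
    by (rule tendsto_power_div_exp_0)
  from filterlim_compose[OF this filterlim_inverse_at_top_right]
  have "((\<lambda>t::real. inverse t ^ n * exp (- inverse t)) \<longlongrightarrow> 0) (at_right 0)"
    by (simp add: exp_minus divide_inverse)
  then have r: "(exp_tail n \<longlongrightarrow> 0) (at_right 0)"
    by (rule Lim_transform_eventually)
       (auto simp: exp_tail_def eventually_at_filter)
  have "(exp_tail n \<longlongrightarrow> 0) (at_left 0)"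
    by (rule Lim_transform_eventually[OF tendsto_const])
       (auto simp: exp_tail_def eventually_at_filter)
  with r show ?thesis
    using filterlim_split_at by blast
qed

lemma exp_tail_deriv:
  "(exp_tail n has_real_derivative exp_tail (n + 2) t - real n * exp_tail (n + 1) t) (at t)"
proof -
  consider "t > 0" | "t < 0" | "t = 0" by linarith
  then show ?thesis
  proof cases
    case 1
    have pw: "k = 0 \<or> t ^ k = t * t ^ (k - Suc 0)" for k
      by (cases k) auto
    have "((\<lambda>t. inverse t ^ n * exp (- inverse t)) has_real_derivative
        exp_tail (n + 2) t - real n * exp_tail (n + 1) t) (at t)"
      using 1 pw by (cases n) (auto intro!: derivative_eq_intros simp: exp_tail_def field_simps)
    then show ?thesis
      by (rule has_field_derivative_transform_within_open[where S="{0<..}"])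
         (use 1 in \<open>auto simp: exp_tail_def\<close>)
  next
    case 2
    have "((\<lambda>_. 0) has_real_derivative exp_tail (n + 2) t - real n * exp_tail (n + 1) t) (at t)"
      using 2 by (auto simp: exp_tail_def)
    then show ?thesis
      by (rule has_field_derivative_transform_within_open[where S="{..<0}"])
         (use 2 in \<open>auto simp: exp_tail_def\<close>)
  next
    case 3
    \<comment> \<open>The difference quotient at 0 is the next member of the family, so its limit is
      0.\<close>
    have "exp_tail n h / h = exp_tail (n + 1) h" "exp_tail k 0 = 0" for h k
      by (simp_all add: exp_tail_def field_simps)
    then show ?thesis
      using exp_tail_tendsto_0[of "n + 1"] 3 by (simp add: DERIV_def)
  qed
qed

lemma smooth_on_exp_tail: "smooth_on UNIV (exp_tail n)"
proof -
  have "Ck_on k UNIV (exp_tail n)" for k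
  proof (induction k arbitrary: n)
    case 0
    then show ?case
      using DERIV_isCont[OF exp_tail_deriv] by (auto simp: continuous_on_eq_continuous_at)
  next
    case (Suc k)
    have "Ck_on k UNIV (\<lambda>t. (exp_tail (n + 2) t + (- real n) * exp_tail (n + 1) t) * v)" for v
      by (intro Ck_on_mult Ck_on_add Ck_on_const Suc) auto
    then show ?case
      by (intro Ck_on_SucI[OF _ exp_tail_deriv[unfolded has_field_derivative_def]]) simp_all
  qed
  then show ?thesis by (simp add: smooth_on_def)
qed

lemma smooth_bump_euclidean:
  fixes y :: "'a::euclidean_space"
  assumes "r > 0"
  obtains b :: "'a \<Rightarrow> real" where "smooth_on UNIV b" "\<And>x. b x \<ge> 0" "\<And>x. b x \<le> 1"
    "\<And>x. dist x y < r \<Longrightarrow> b x = 1" "\<And>x. dist x y \<ge> 2 * r \<Longrightarrow> b x = 0"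
proof -
  \<comment> \<open>A smooth step: 0 for t \<le> 0 and 1 for t \<ge> 1. The two terms of the
    denominator never vanish together.\<close>
  define s where "s = (\<lambda>t::real. exp_tail 0 t * inverse (exp_tail 0 t + exp_tail 0 (1 - t)))"
  \<comment> \<open>Affine in the squared distance, which unlike the distance is smooth at
    \<open>y\<close>. The coefficients give the value 1 at distance r and 0 at distance 2 r.\<close>
  define u where "u = (\<lambda>x::'a. 4 / 3 + (- 1 / (3 * r\<^sup>2)) * (\<Sum>i\<in>Basis. ((x - y) \<bullet> i) * ((x - y) \<bullet> i)))"
  have pos: "exp_tail 0 t + exp_tail 0 (1 - t) > 0" for t
    by (auto simp: exp_tail_def add_pos_nonneg)
  have nn: "exp_tail 0 t \<ge> 0" for t
    by (simp add: exp_tail_def)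
  have flip: "smooth_on UNIV (\<lambda>t::real. 1 - t)"
    using smooth_on_add[OF open_UNIV smooth_on_const[OF open_UNIV] smooth_on_bounded_linear[OF open_UNIV smooth_on_ident[OF open_UNIV] bounded_linear_minus[OF bounded_linear_ident]], of "1::real"]
    by simp
  have "smooth_on UNIV s"
    unfolding s_def using pos
    by (intro smooth_on_mult smooth_on_inverse smooth_on_add smooth_on_exp_tail
          smooth_on_compose[OF open_UNIV open_UNIV flip]) (auto simp: less_imp_neq[symmetric])
  have sh: "smooth_on UNIV (\<lambda>x. x - y)"
    using smooth_on_add[OF open_UNIV smooth_on_ident[OF open_UNIV] smooth_on_const[OF open_UNIV], of "- y"]
    by simp
  have "smooth_on UNIV u"
    unfolding u_def
    by (intro smooth_on_mult smooth_on_add smooth_on_sum smooth_on_const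
          smooth_on_bounded_linear[OF open_UNIV sh bounded_linear_inner_left]) auto
  have u_eq: "u x = 4 / 3 - (dist x y)\<^sup>2 / (3 * r\<^sup>2)" for x
    by (simp add: u_def euclidean_inner[symmetric] dist_norm power2_norm_eq_inner)
  have "smooth_on UNIV (\<lambda>x. s (u x))"
    using smooth_on_compose[OF open_UNIV open_UNIV \<open>smooth_on UNIV u\<close> \<open>smooth_on UNIV s\<close>] by simp
  moreover have "s t \<ge> 0" for t
    using nn[of t] pos[of t] by (simp add: s_def)
  moreover have "s t \<le> 1" for t
    using nn[of "1 - t"] pos[of t] by (simp add: s_def field_simps)
  moreover have "s (u x) = 1" if "dist x y < r" for x
  proof -
    have "(dist x y)\<^sup>2 \<le> r\<^sup>2" using that by (intro power_mono) auto
    then have "u x \<ge> 1" using assms by (simp add: u_eq field_simps)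
    then show ?thesis by (simp add: s_def exp_tail_def)
  qed
  moreover have "s (u x) = 0" if "dist x y \<ge> 2 * r" for x
  proof -
    have "(2 * r)\<^sup>2 \<le> (dist x y)\<^sup>2" using that assms by (intro power_mono) auto
    then have "u x \<le> 0" using assms by (simp add: u_eq field_simps)
    then show ?thesis by (simp add: s_def exp_tail_def)
  qed
  ultimately show thesis using that[of "\<lambda>x. s (u x)"] by blast
qed

section \<open>Smooth functions and vector fields on a manifold\<close>

lemma chart_image_open:
  assumes "is_chart (U, \<psi>)" "open W"
  shows "open (\<psi> ` (U \<inter> W))"
proof -
  have h: "open (\<psi> ` U)" "homeomorphism U (\<psi> ` U) \<psi> (inv_into U \<psi>)"
    using assms(1) by (auto simp: is_chart_def)
  have "\<psi> ` (U \<inter> W) = \<psi> ` U \<inter> inv_into U \<psi> -` W"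
    using h(2) by (auto simp: homeomorphism_def)
  then show ?thesis
    using continuous_open_preimage[OF _ h(1) assms(2)] h(2) by (auto simp: homeomorphism_def)
qed

lemma chart_inv: "is_chart (U, \<psi>) \<Longrightarrow> q \<in> U \<Longrightarrow> inv_into U \<psi> (\<psi> q) = q"
  by (auto simp: is_chart_def homeomorphism_def)

locale smooth_manifold =
  fixes A :: "('m::t2_space, 'e::euclidean_space) chart set"
  assumes atlas: "smooth_atlas A"
begin

abbreviation "SF \<equiv> smooth_fun A"
abbreviation "VF \<equiv> vector_field A"

lemma atlas_chart: "c \<in> A \<Longrightarrow> smooth_chart A c"
  using atlas by (auto simp: smooth_atlas_def smooth_chart_def)

lemma atlas_chart_at:
  obtains U \<psi> where "(U, \<psi>) \<in> A" "p \<in> U" "is_chart (U, \<psi>)"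
proof -
  have "p \<in> (\<Union>c\<in>A. fst c)"
    using atlas by (simp add: smooth_atlas_def)
  then show ?thesis
    using that atlas by (auto simp: smooth_atlas_def)
qed

text \<open>\<open>smooth_fun\<close> inspects only the charts of \<open>A\<close>. Near each point
  a chart of the maximal atlas is compared with one of those through a smooth transition
  map.\<close>

lemma smooth_fun_chart:
  assumes "SF f" "smooth_chart A (U, \<psi>)"
  shows "smooth_on (\<psi> ` U) (f \<circ> inv_into U \<psi>)"
proof (rule smooth_on_local)
  fix y assume "y \<in> \<psi> ` U"
  then obtain q where q: "q \<in> U" "y = \<psi> q" by auto
  obtain V \<theta> where V: "(V, \<theta>) \<in> A" "q \<in> V" "is_chart (V, \<theta>)"
    by (rule atlas_chart_at)
  have c: "is_chart (U, \<psi>)" and tr: "smooth_on (\<psi> ` (U \<inter> V)) (\<theta> \<circ> inv_into U \<psi>)"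
    using assms(2) V by (auto simp: smooth_chart_def chart_compatible_def)
  have op: "open (\<psi> ` (U \<inter> V))"
    using chart_image_open[OF c] V(3) by (auto simp: is_chart_def)
  have sf: "smooth_on (\<theta> ` V) (f \<circ> inv_into V \<theta>)"
    using assms(1) V(1) by (auto simp: smooth_fun_def)
  have "smooth_on (\<psi> ` (U \<inter> V)) (\<lambda>x. (f \<circ> inv_into V \<theta>) ((\<theta> \<circ> inv_into U \<psi>) x))"
    using V(3) by (intro smooth_on_compose[OF op _ tr sf]) (auto simp: is_chart_def chart_inv[OF c])
  then have "smooth_on (\<psi> ` (U \<inter> V)) (f \<circ> inv_into U \<psi>)"
    by (rule smooth_on_cong[OF op]) (auto simp: chart_inv[OF c] chart_inv[OF V(3)])
  then show "\<exists>T. open T \<and> y \<in> T \<and> smooth_on T (f \<circ> inv_into U \<psi>)"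
    using op q V(2) by blast
qed

lemma smooth_fun_local:
  assumes "\<And>p. \<exists>V g. open V \<and> p \<in> V \<and> SF g \<and> (\<forall>q\<in>V. f q = g q)"
  shows "SF f"
  unfolding smooth_fun_def
proof clarify
  fix U \<psi> assume c: "(U, \<psi>) \<in> A"
  then have ch: "is_chart (U, \<psi>)"
    using atlas by (auto simp: smooth_atlas_def)
  show "smooth_on (\<psi> ` U) (f \<circ> inv_into U \<psi>)"
  proof (rule smooth_on_local)
    fix y assume "y \<in> \<psi> ` U"
    then obtain p where p: "p \<in> U" "y = \<psi> p" by auto
    obtain V g where V: "open V" "p \<in> V" "SF g" "\<forall>q\<in>V. f q = g q"
      using assms by blast
    have op: "open (\<psi> ` (U \<inter> V))"
      by (rule chart_image_open[OF ch V(1)])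
    have "smooth_on (\<psi> ` (U \<inter> V)) (g \<circ> inv_into U \<psi>)"
      using V(3) c by (auto simp: smooth_fun_def intro: smooth_on_subset)
    then have "smooth_on (\<psi> ` (U \<inter> V)) (f \<circ> inv_into U \<psi>)"
      by (rule smooth_on_cong[OF op]) (use V(4) in \<open>auto simp: chart_inv[OF ch]\<close>)
    then show "\<exists>T. open T \<and> y \<in> T \<and> smooth_on T (f \<circ> inv_into U \<psi>)"
      using op p V(2) by blast
  qed
qed

lemma atlas_image_open: "(U, \<psi>) \<in> A \<Longrightarrow> open (\<psi> ` U)"
  using atlas by (auto simp: smooth_atlas_def is_chart_def)

lemma smooth_fun_const: "SF (\<lambda>_. a)"
  by (auto simp: smooth_fun_def o_def intro: smooth_on_const atlas_image_open)

lemma smooth_fun_0 [simp]: "SF 0" and smooth_fun_1 [simp]: "SF 1"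
  using smooth_fun_const[of 0] smooth_fun_const[of 1] by (simp_all add: zero_fun_def one_fun_def)

lemma smooth_fun_add [simp]: "SF f \<Longrightarrow> SF g \<Longrightarrow> SF (f + g)"
  by (auto simp: smooth_fun_def o_def plus_fun_def intro: smooth_on_add atlas_image_open)

lemma smooth_fun_mult [simp]: "SF f \<Longrightarrow> SF g \<Longrightarrow> SF (f * g)"
  by (auto simp: smooth_fun_def o_def times_fun_def intro: smooth_on_mult atlas_image_open)

lemma smooth_fun_scale: "SF f \<Longrightarrow> SF (\<lambda>q. a * f q)"
  using smooth_fun_mult[OF smooth_fun_const[of a]] by (simp add: times_fun_def)

lemma smooth_fun_uminus [simp]: "SF f \<Longrightarrow> SF (- f)"
  using smooth_fun_scale[of f "-1"] by (simp add: fun_Compl_def)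

lemma smooth_fun_diff [simp]: "SF f \<Longrightarrow> SF g \<Longrightarrow> SF (f - g)"
  using smooth_fun_add[of f "- g"] by simp

lemma smooth_fun_sum: "(\<And>i. i \<in> I \<Longrightarrow> SF (f i)) \<Longrightarrow> SF (\<lambda>q. \<Sum>i\<in>I. f i q)"
  by (auto simp: smooth_fun_def o_def split_beta intro!: smooth_on_sum atlas_image_open)

lemma smooth_fun_inverse: "SF f \<Longrightarrow> (\<And>q. f q \<noteq> 0) \<Longrightarrow> SF (\<lambda>q. inverse (f q))"
  by (auto simp: smooth_fun_def o_def intro!: smooth_on_inverse atlas_image_open)

section \<open>Cut-off functions and local inverses\<close>

lemma smooth_fun_open_neq:
  assumes "SF f" "f p \<noteq> a"
  shows "\<exists>V. open V \<and> p \<in> V \<and> (\<forall>q\<in>V. f q \<noteq> a)"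
proof -
  obtain U \<psi> where U: "(U, \<psi>) \<in> A" "p \<in> U" "is_chart (U, \<psi>)"
    by (rule atlas_chart_at)
  have sf: "smooth_on (\<psi> ` U) (f \<circ> inv_into U \<psi>)"
    using assms(1) U(1) by (auto simp: smooth_fun_def)
  have "continuous_on U \<psi>"
    using U(3) by (simp add: is_chart_def homeomorphism_def)
  then have "continuous_on U (\<lambda>q. (f \<circ> inv_into U \<psi>) (\<psi> q))"
    using continuous_on_compose2[OF smooth_on_imp_continuous_on[OF sf]] by blast
  then have "continuous_on U f"
    by (rule continuous_on_eq) (auto simp: chart_inv[OF U(3)])
  then have "open (U \<inter> f -` (- {a}))"
    using U(3) by (intro continuous_open_preimage) (auto simp: is_chart_def)
  then show ?thesis
    using U(2) assms(2) by (intro exI[of _ "U \<inter> f -` (- {a})"]) auto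
qed

text \<open>\<open>U\<close> and the complement of \<open>K\<close> form an open cover: on the first
  the coordinate expression is smooth, on the second \<open>f\<close> is 0. The second set is open
  because \<open>K\<close> is closed in the whole manifold and not merely in
  \<open>U\<close>.\<close>

lemma smooth_fun_extend:
  assumes c: "smooth_chart A (U, \<psi>)" and K: "closed K" "K \<subseteq> U" "\<And>q. q \<notin> K \<Longrightarrow> f q = 0"
    and f: "smooth_on (\<psi> ` U) (f \<circ> inv_into U \<psi>)"
  shows "SF f"
  unfolding smooth_fun_def
proof clarify
  fix V \<theta> assume d: "(V, \<theta>) \<in> A"
  then have V: "is_chart (V, \<theta>)" and U: "is_chart (U, \<psi>)"
    and tr: "smooth_on (\<theta> ` (V \<inter> U)) (\<psi> \<circ> inv_into V \<theta>)"
    using atlas c by (auto simp: smooth_atlas_def smooth_chart_def chart_compatible_def Int_commute)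
  show "smooth_on (\<theta> ` V) (f \<circ> inv_into V \<theta>)"
  proof (rule smooth_on_local)
    fix y assume "y \<in> \<theta> ` V"
    then obtain q where q: "q \<in> V" "y = \<theta> q" by auto
    show "\<exists>T. open T \<and> y \<in> T \<and> smooth_on T (f \<circ> inv_into V \<theta>)"
    proof (cases "q \<in> U")
      case True
      have op: "open (\<theta> ` (V \<inter> U))"
        using chart_image_open[OF V] U by (auto simp: is_chart_def)
      have "smooth_on (\<theta> ` (V \<inter> U)) (\<lambda>x. (f \<circ> inv_into U \<psi>) ((\<psi> \<circ> inv_into V \<theta>) x))"
        using U by (intro smooth_on_compose[OF op _ tr f]) (auto simp: is_chart_def chart_inv[OF V])
      then have "smooth_on (\<theta> ` (V \<inter> U)) (f \<circ> inv_into V \<theta>)"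
        by (rule smooth_on_cong[OF op]) (auto simp: chart_inv[OF U] chart_inv[OF V])
      then show ?thesis
        using op q True by blast
    next
      case False
      have op: "open (\<theta> ` (V \<inter> - K))"
        using chart_image_open[OF V] K(1) by auto
      have "smooth_on (\<theta> ` (V \<inter> - K)) (f \<circ> inv_into V \<theta>)"
        by (rule smooth_on_cong[OF op smooth_on_const[OF op, of 0]]) (auto simp: chart_inv[OF V] K(3))
      then show ?thesis
        using op q False K(2) by blast
    qed
  qed
qed

lemma bump_exists:
  assumes "open V" "p \<in> V"
  obtains b W K where "SF b" "open W" "p \<in> W" "W \<subseteq> K" "closed K" "K \<subseteq> V"
    "\<And>q. q \<in> W \<Longrightarrow> b q = 1" "\<And>q. q \<notin> K \<Longrightarrow> b q = 0" "\<And>q. 0 \<le> b q" "\<And>q. b q \<le> 1"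
proof -
  obtain U \<psi> where U: "(U, \<psi>) \<in> A" "p \<in> U" "is_chart (U, \<psi>)"
    by (rule atlas_chart_at)
  have h: "open U" "continuous_on U \<psi>" "continuous_on (\<psi> ` U) (inv_into U \<psi>)"
    using U(3) by (auto simp: is_chart_def homeomorphism_def)
  have "open (\<psi> ` (U \<inter> V))"
    by (rule chart_image_open[OF U(3) assms(1)])
  then obtain e where e: "e > 0" "cball (\<psi> p) e \<subseteq> \<psi> ` (U \<inter> V)"
    using U(2) assms(2) open_contains_cball by blast
  obtain \<beta> :: "'e \<Rightarrow> real" where \<beta>: "smooth_on UNIV \<beta>" "\<And>x. \<beta> x \<ge> 0" "\<And>x. \<beta> x \<le> 1"
    "\<And>x. dist x (\<psi> p) < e / 2 \<Longrightarrow> \<beta> x = 1" "\<And>x. dist x (\<psi> p) \<ge> 2 * (e / 2) \<Longrightarrow> \<beta> x = 0"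
    using smooth_bump_euclidean[of "e / 2" "\<psi> p"] e(1) by auto
  define K where "K = inv_into U \<psi> ` cball (\<psi> p) e"
  define W where "W = U \<inter> \<psi> -` ball (\<psi> p) (e / 2)"
  define b where "b = (\<lambda>q. if q \<in> U then \<beta> (\<psi> q) else 0)"
  have K_eq: "K = {q \<in> U. dist (\<psi> q) (\<psi> p) \<le> e}"
  proof -
    have "inv_into U \<psi> x \<in> U \<and> \<psi> (inv_into U \<psi> x) = x" if "x \<in> cball (\<psi> p) e" for x
    proof -
      have "x \<in> \<psi> ` U" using e(2) that by auto
      then show ?thesis by (simp add: inv_into_into f_inv_into_f)
    qed
    then have "K \<subseteq> {q \<in> U. dist (\<psi> q) (\<psi> p) \<le> e}"
      by (auto simp: K_def dist_commute)
    moreover have "q \<in> K" if "q \<in> U" "dist (\<psi> q) (\<psi> p) \<le> e" for q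
      unfolding K_def using that
      by (intro image_eqI[of _ _ "\<psi> q"]) (auto simp: chart_inv[OF U(3)] dist_commute)
    ultimately show ?thesis by blast
  qed
  \<comment> \<open>\<open>K\<close> is the image of a closed ball under the inverse of the chart.
    In a Hausdorff space compactness makes it closed globally, as \<open>smooth_fun_extend\<close>
    demands.\<close>
  have "compact K"
    unfolding K_def using e(2) by (intro compact_continuous_image continuous_on_subset[OF h(3)]) auto
  then have "closed K"
    by (rule compact_imp_closed)
  have KUV: "K \<subseteq> U \<inter> V"
  proof
    fix q assume "q \<in> K"
    then obtain x where x: "x \<in> cball (\<psi> p) e" "q = inv_into U \<psi> x" by (auto simp: K_def)
    with e(2) show "q \<in> U \<inter> V"
      by (auto simp: chart_inv[OF U(3)])
  qed
  have b0: "b q = 0" if "q \<notin> K" for q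
    using that \<beta>(5)[of "\<psi> q"] by (auto simp: b_def K_eq)
  have "smooth_on (\<psi> ` U) (b \<circ> inv_into U \<psi>)"
    by (rule smooth_on_cong[OF atlas_image_open[OF U(1)] smooth_on_subset[OF \<beta>(1)]])
       (auto simp: b_def chart_inv[OF U(3)])
  then have "SF b"
    using smooth_fun_extend[OF atlas_chart[OF U(1)] \<open>closed K\<close>] KUV b0 by blast
  moreover have "open W"
    unfolding W_def by (rule continuous_open_preimage[OF h(2,1)]) auto
  moreover have "p \<in> W" "W \<subseteq> K" "\<And>q. q \<in> W \<Longrightarrow> b q = 1"
    using U(2) e(1) \<beta>(4) by (auto simp: W_def K_eq b_def dist_commute)
  ultimately show thesis
    using that[of b W K] \<open>closed K\<close> KUV b0 \<beta>(2,3) by (auto simp: b_def)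
qed

text \<open>The square of \<open>f\<close> is nonnegative, and adding \<open>1 - b\<close> makes it
  positive everywhere without changing it near \<open>p\<close>. Dividing \<open>f\<close> by this
  sum gives a global smooth function that inverts \<open>f\<close> near \<open>p\<close>.\<close>

lemma smooth_fun_local_inverse:
  assumes "SF f" "f p \<noteq> 0"
  obtains g V where "SF g" "open V" "p \<in> V" "\<And>q. q \<in> V \<Longrightarrow> g q * f q = 1"
proof -
  define h where "h = f * f"
  have h: "SF h" "h p \<noteq> 0" "\<And>q. h q \<ge> 0"
    using assms by (auto simp: h_def)
  obtain V where V: "open V" "p \<in> V" "\<And>q. q \<in> V \<Longrightarrow> h q \<noteq> 0"
    using smooth_fun_open_neq[OF h(1,2)] by blast
  obtain b W K where b: "SF b" "open W" "p \<in> W" "W \<subseteq> K" "K \<subseteq> V"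
    "\<And>q. q \<in> W \<Longrightarrow> b q = 1" "\<And>q. q \<notin> K \<Longrightarrow> b q = 0" "\<And>q. 0 \<le> b q" "\<And>q. b q \<le> 1"
    using bump_exists[OF V(1,2)] by metis
  define k where "k = h + (1 - b)"
  have "k q \<noteq> 0" for q
  proof (cases "q \<in> V")
    case True
    then have "h q > 0" using V(3)[OF True] h(3)[of q] by simp
    then show ?thesis using b(9)[of q] by (simp add: k_def)
  next
    case False
    then have "b q = 0" using b(5,7) by blast
    then show ?thesis using h(3)[of q] by (simp add: k_def)
  qed
  moreover have "SF k"
    unfolding k_def using h(1) b(1) by (intro smooth_fun_add smooth_fun_diff smooth_fun_1)
  ultimately have "SF (f * (\<lambda>q. inverse (k q)))"
    using assms(1) by (intro smooth_fun_mult smooth_fun_inverse)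
  then show thesis
  proof (rule that[OF _ b(2,3)])
    fix q assume "q \<in> W"
    then have "h q \<noteq> 0" "b q = 1"
      using b(4,5,6) V(3) by blast+
    then show "(f * (\<lambda>q. inverse (k q))) q * f q = 1"
      by (simp add: k_def) (simp add: h_def field_simps)
  qed
qed

section \<open>Derivations, vector fields and the Lie bracket\<close>

abbreviation "TS \<equiv> tangent_space A"

lemma tangent_add: "v \<in> TS p \<Longrightarrow> SF f \<Longrightarrow> SF g \<Longrightarrow> v (f + g) = v f + v g"
  and tangent_mult: "v \<in> TS p \<Longrightarrow> SF f \<Longrightarrow> SF g \<Longrightarrow> v (f * g) = f p * v g + g p * v f"
  and tangent_scale: "v \<in> TS p \<Longrightarrow> SF f \<Longrightarrow> v (\<lambda>x. a * f x) = a * v f"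
  and tangent_not_smooth: "v \<in> TS p \<Longrightarrow> \<not> SF f \<Longrightarrow> v f = 0"
  by (simp_all add: tangent_space_def)

lemma tangent_0: "v \<in> TS p \<Longrightarrow> v 0 = 0"
  using tangent_add[of v p 0 0] by simp

lemma tangent_uminus: "v \<in> TS p \<Longrightarrow> SF f \<Longrightarrow> v (- f) = - v f"
  using tangent_scale[of v p f "-1"] by (simp add: fun_Compl_def)

lemma tangent_diff: "v \<in> TS p \<Longrightarrow> SF f \<Longrightarrow> SF g \<Longrightarrow> v (f - g) = v f - v g"
  using tangent_add[of v p f "- g"] by (simp add: tangent_uminus)

lemma tangent_const:
  assumes "v \<in> TS p"
  shows "v (\<lambda>_. a) = 0"
proof -
  have "v (1 * 1) = 0"
    using tangent_mult[OF assms, of 1 1] by (simp del: mult_1_left mult_1_right) simp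
  then show ?thesis
    using tangent_scale[OF assms, of 1 a] by simp
qed

text \<open>With a cut-off \<open>b\<close> supported in \<open>V\<close>, f - g = (1 - b) (f - g)
  is a product of two functions that vanish at \<open>p\<close>, and the Leibniz rule annihilates
  such a product.\<close>

lemma tangent_local:
  assumes "v \<in> TS p" "SF f" "SF g" "open V" "p \<in> V" "\<And>q. q \<in> V \<Longrightarrow> f q = g q"
  shows "v f = v g"
proof -
  obtain b W K where b: "SF b" "p \<in> W" "K \<subseteq> V" "\<And>q. q \<in> W \<Longrightarrow> b q = 1" "\<And>q. q \<notin> K \<Longrightarrow> b q = 0"
    using bump_exists[OF assms(4,5)] by metis
  have "f - g = (1 - b) * (f - g)"
  proof
    fix q show "(f - g) q = ((1 - b) * (f - g)) q"
      using assms(6)[of q] b(3) b(5)[of q] by (cases "q \<in> K") auto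
  qed
  then have "v (f - g) = v ((1 - b) * (f - g))" by simp
  also have "\<dots> = 0"
    using tangent_mult[OF assms(1), of "1 - b" "f - g"] assms(2,3,5,6) b by simp
  finally show ?thesis
    by (simp add: tangent_diff[OF assms(1-3)])
qed

lemma vector_field_tangent: "VF X \<Longrightarrow> X p \<in> TS p"
  by (simp add: vector_field_def)

lemma vector_field_smooth [simp]: "VF X \<Longrightarrow> SF f \<Longrightarrow> SF (vfield_apply X f)"
  by (simp add: vector_field_def)

lemma vector_field_smooth_fun: "VF X \<Longrightarrow> SF f \<Longrightarrow> SF (\<lambda>q. X q f)"
  using vector_field_smooth[of X f] by (simp add: vfield_apply_def)

lemma tangent_space_0: "0 \<in> TS p"
  by (simp add: tangent_space_def)

lemma tangent_space_add: "v \<in> TS p \<Longrightarrow> w \<in> TS p \<Longrightarrow> v + w \<in> TS p"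
  by (simp add: tangent_space_def algebra_simps)

lemma tangent_space_scale: "v \<in> TS p \<Longrightarrow> (\<lambda>f. a * v f) \<in> TS p"
  by (simp add: tangent_space_def algebra_simps)

lemma vector_field_0: "VF 0"
  using smooth_fun_const[of 0] by (simp add: vector_field_def tangent_space_0 vfield_apply_def)

lemma vector_field_add [simp]:
  assumes "VF X" "VF Y"
  shows "VF (X + Y)"
proof -
  have "vfield_apply (X + Y) f = vfield_apply X f + vfield_apply Y f" for f
    by (auto simp: vfield_apply_def)
  then show ?thesis
    using assms by (simp add: vector_field_def tangent_space_add)
qed

lemma vector_field_fscale [simp]: "SF f \<Longrightarrow> VF X \<Longrightarrow> VF (f \<odot> X)"
  using smooth_fun_mult
  by (auto simp: vector_field_def tangent_space_scale vfield_apply_def fscale_def times_fun_def)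

lemma vector_field_cscale [simp]: "VF X \<Longrightarrow> VF (a \<cdot> X)"
  by (simp add: cscale_def smooth_fun_const)

lemma vector_field_uminus [simp]: "VF X \<Longrightarrow> VF (- X)"
  using vector_field_cscale[of X "-1"] by (simp add: cscale_def fscale_def fun_Compl_def)

lemma vector_field_diff [simp]: "VF X \<Longrightarrow> VF Y \<Longrightarrow> VF (X - Y)"
  using vector_field_add[of X "- Y"] by simp

lemma vector_field_local:
  assumes "\<And>p. \<exists>V Y. open V \<and> p \<in> V \<and> VF Y \<and> (\<forall>q\<in>V. X q = Y q)"
  shows "VF X"
  unfolding vector_field_def
proof (intro conjI allI impI)
  show "X p \<in> TS p" for p
    using assms[of p] by (auto simp: vector_field_def)
  fix f assume f: "SF f"
  show "SF (vfield_apply X f)"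
  proof (rule smooth_fun_local)
    fix p
    show "\<exists>V g. open V \<and> p \<in> V \<and> SF g \<and> (\<forall>q\<in>V. vfield_apply X f q = g q)"
      using assms[of p] f vector_field_smooth by (metis vfield_apply_def)
  qed
qed

text \<open>The cross terms in the Leibniz expansions of X (Y (f g)) and Y (X (f g)) coincide and
  cancel, which leaves a derivation. On non-smooth functions the default value 0 of both fields is
  inherited.\<close>

lemma vector_field_bracket [simp]:
  assumes X: "VF X" and Y: "VF Y"
  shows "VF (bracket X Y)"
  unfolding vector_field_def
proof (intro conjI allI impI)
  have ap: "vfield_apply Z (f + g) = vfield_apply Z f + vfield_apply Z g"
    "vfield_apply Z (f * g) = f * vfield_apply Z g + g * vfield_apply Z f"
    "vfield_apply Z (\<lambda>x. a * f x) = (\<lambda>x. a * vfield_apply Z f x)" if "VF Z" "SF f" "SF g" for Z f g a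
    using that tangent_add[OF vector_field_tangent[OF that(1)]] tangent_mult[OF vector_field_tangent[OF that(1)]]
      tangent_scale[OF vector_field_tangent[OF that(1)]]
    by (auto simp: vfield_apply_def fun_eq_iff)
  have ns: "vfield_apply Z f = 0" if "VF Z" "\<not> SF f" for Z f
    using tangent_not_smooth[OF vector_field_tangent[OF that(1)] that(2)]
    by (auto simp: vfield_apply_def fun_eq_iff)
  show "bracket X Y p \<in> TS p" for p
    unfolding tangent_space_def bracket_def mem_Collect_eq
  proof (intro conjI allI impI)
    note tv = vector_field_tangent[OF X, of p] vector_field_tangent[OF Y, of p]
    { fix f g assume *: "SF f \<and> SF g"
      show "X p (vfield_apply Y (f + g)) - Y p (vfield_apply X (f + g)) =
         X p (vfield_apply Y f) - Y p (vfield_apply X f) + (X p (vfield_apply Y g) - Y p (vfield_apply X g))"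
        using * X Y by (simp add: ap tangent_add[OF tv(1)] tangent_add[OF tv(2)])
      have "vfield_apply X f p = X p f" "vfield_apply X g p = X p g"
         "vfield_apply Y f p = Y p f" "vfield_apply Y g p = Y p g"
        by (simp_all add: vfield_apply_def)
      then show "X p (vfield_apply Y (f * g)) - Y p (vfield_apply X (f * g)) =
         f p * (X p (vfield_apply Y g) - Y p (vfield_apply X g)) + g p * (X p (vfield_apply Y f) - Y p (vfield_apply X f))"
        using * X Y
        by (simp add: ap tangent_add[OF tv(1)] tangent_add[OF tv(2)] tangent_mult[OF tv(1)]
            tangent_mult[OF tv(2)] algebra_simps)
    }
    show "X p (vfield_apply Y (\<lambda>x. a * f x)) - Y p (vfield_apply X (\<lambda>x. a * f x)) =
         a * (X p (vfield_apply Y f) - Y p (vfield_apply X f))" if "SF f" for f a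
      using that X Y by (simp add: ap tangent_scale[OF tv(1)] tangent_scale[OF tv(2)] algebra_simps)
    show "X p (vfield_apply Y f) - Y p (vfield_apply X f) = 0" if "\<not> SF f" for f
      using that by (simp add: ns X Y tangent_0[OF tv(1)] tangent_0[OF tv(2)])
  qed
  fix f assume "SF f"
  then have "SF (vfield_apply X (vfield_apply Y f) - vfield_apply Y (vfield_apply X f))"
    using X Y by simp
  then show "SF (vfield_apply (bracket X Y) f)"
    by (rule back_subst[of SF]) (auto simp: vfield_apply_def bracket_def)
qed

section \<open>Coordinate vectors, coordinate fields and coordinate functions\<close>

lemma coord_vector_linear:
  assumes "smooth_chart A (U, \<psi>)" "q \<in> U"
  shows "coord_vector A (U, \<psi>) q (v + w) = coord_vector A (U, \<psi>) q v + coord_vector A (U, \<psi>) q w"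
    and "coord_vector A (U, \<psi>) q (a *\<^sub>R w) = (\<lambda>f. a * coord_vector A (U, \<psi>) q w f)"
    and "coord_vector A (U, \<psi>) q 0 = 0"
proof -
  have l: "linear (frechet_derivative (f \<circ> inv_into U \<psi>) (at (\<psi> q)))" if "SF f" for f
    using smooth_on_has_derivative[OF smooth_fun_chart[OF that assms(1)]] assms(2)
    by (auto intro: has_derivative_linear)
  show "coord_vector A (U, \<psi>) q (v + w) = coord_vector A (U, \<psi>) q v + coord_vector A (U, \<psi>) q w"
    and "coord_vector A (U, \<psi>) q (a *\<^sub>R w) = (\<lambda>f. a * coord_vector A (U, \<psi>) q w f)"
    and "coord_vector A (U, \<psi>) q 0 = 0"
    using linear_add[OF l] linear_scale[OF l] linear_0[OF l] by (auto simp: coord_vector_def fun_eq_iff)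
qed

lemma coord_vector_tangent:
  assumes c: "smooth_chart A (U, \<psi>)" and q: "q \<in> U"
  shows "coord_vector A (U, \<psi>) q w \<in> TS q"
proof -
  have ch: "is_chart (U, \<psi>)"
    using c by (simp add: smooth_chart_def)
  define h where "h = (\<lambda>f :: 'm \<Rightarrow> real. f \<circ> inv_into U \<psi>)"
  have d: "(h f has_derivative frechet_derivative (h f) (at (\<psi> q))) (at (\<psi> q))" if "SF f" for f
    unfolding h_def using smooth_on_has_derivative[OF smooth_fun_chart[OF that c]] q by auto
  have e: "h (f + g) = (\<lambda>x. h f x + h g x)" "h (f * g) = (\<lambda>x. h f x * h g x)"
    "h (\<lambda>x. a * f x) = (\<lambda>x. a * h f x)" "h f (\<psi> q) = f q" for f g a
    by (auto simp: h_def chart_inv[OF ch q])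
  have "frechet_derivative (h (f + g)) (at (\<psi> q)) w
      = frechet_derivative (h f) (at (\<psi> q)) w + frechet_derivative (h g) (at (\<psi> q)) w"
    if "SF f" "SF g" for f g
    unfolding e frechet_derivative_at[OF has_derivative_add[OF d[OF that(1)] d[OF that(2)]], symmetric] ..
  moreover have "frechet_derivative (h (f * g)) (at (\<psi> q)) w
      = f q * frechet_derivative (h g) (at (\<psi> q)) w + g q * frechet_derivative (h f) (at (\<psi> q)) w"
    if "SF f" "SF g" for f g
    unfolding e(2) frechet_derivative_at[OF has_derivative_mult[OF d[OF that(1)] d[OF that(2)]], symmetric] e(4)
    by simp
  moreover have "frechet_derivative (h (\<lambda>x. a * f x)) (at (\<psi> q)) w
      = a * frechet_derivative (h f) (at (\<psi> q)) w" if "SF f" for f a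
    unfolding e(3) frechet_derivative_at[OF has_derivative_mult_right[OF d[OF that]], symmetric] ..
  ultimately show ?thesis
    by (simp add: tangent_space_def coord_vector_def h_def smooth_fun_scale)
qed

text \<open>A coordinate field times a cut-off. The last two clauses control it away from
  \<open>W\<close>: being a multiple of the direction \<open>w\<close> on \<open>U\<close> and 0
  elsewhere, it is a global section of any distribution of subspaces that contains this direction on
  \<open>U\<close>.\<close>

lemma coord_field:
  assumes c: "smooth_chart A (U, \<psi>)" and p: "p \<in> U"
  obtains E W where "VF E" "open W" "p \<in> W" "W \<subseteq> U" "\<And>q. q \<in> W \<Longrightarrow> E q = coord_vector A (U, \<psi>) q w"
    "\<And>q. q \<in> U \<Longrightarrow> \<exists>t. E q = coord_vector A (U, \<psi>) q (t *\<^sub>R w)" "\<And>q. q \<notin> U \<Longrightarrow> E q = 0"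
proof -
  have ch: "is_chart (U, \<psi>)"
    using c by (simp add: smooth_chart_def)
  then have "open U" "open (\<psi> ` U)"
    by (auto simp: is_chart_def)
  obtain b W K where b: "SF b" "open W" "p \<in> W" "W \<subseteq> K" "closed K" "K \<subseteq> U"
    "\<And>q. q \<in> W \<Longrightarrow> b q = 1" "\<And>q. q \<notin> K \<Longrightarrow> b q = 0"
    using bump_exists[OF \<open>open U\<close> p] by metis
  define E where "E = (\<lambda>q. if q \<in> U then coord_vector A (U, \<psi>) q (b q *\<^sub>R w) else 0)"
  have E_eq: "E q f = b q * frechet_derivative (f \<circ> inv_into U \<psi>) (at (\<psi> q)) w" if "SF f" for f q
    using that coord_vector_linear(2)[OF c, of q "b q" w] b(6,8)
    by (auto simp: E_def coord_vector_def fun_eq_iff)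
  have "VF E"
    unfolding vector_field_def
  proof (intro conjI allI impI)
    show "E q \<in> TS q" for q
      using coord_vector_tangent[OF c] by (auto simp: E_def tangent_space_0)
    fix f assume f: "SF f"
    show "SF (vfield_apply E f)"
    proof (rule smooth_fun_extend[OF c b(5,6)])
      show "vfield_apply E f q = 0" if "q \<notin> K" for q
        using b(8)[OF that] f by (simp add: vfield_apply_def E_eq)
      have "smooth_on (\<psi> ` U) (\<lambda>x. (b \<circ> inv_into U \<psi>) x * frechet_derivative (f \<circ> inv_into U \<psi>) (at x) w)"
        by (intro smooth_on_mult \<open>open (\<psi> ` U)\<close> smooth_fun_chart[OF b(1) c] smooth_on_frechet_derivative
            smooth_fun_chart[OF f c])
      then show "smooth_on (\<psi> ` U) (vfield_apply E f \<circ> inv_into U \<psi>)"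
        by (rule smooth_on_cong[OF \<open>open (\<psi> ` U)\<close>])
           (auto simp: vfield_apply_def E_eq[OF f] chart_inv[OF ch])
    qed
  qed
  then show thesis
  proof (rule that[OF _ b(2,3)])
    show "W \<subseteq> U"
      using b(4,6) by blast
    then show "E q = coord_vector A (U, \<psi>) q w" if "q \<in> W" for q
      using that b(7)[OF that] by (auto simp: E_def)
  qed (auto simp: E_def)
qed

text \<open>Such functions read off the coordinates of a tangent vector. They give the injectivity
  of \<open>coord_vector\<close> and, applied to directions transverse to the leaves,
  involutivity.\<close>

lemma coord_function:
  fixes l :: "'e \<Rightarrow> real"
  assumes c: "smooth_chart A (U, \<psi>)" and p: "p \<in> U" and l: "bounded_linear l"
  obtains x W where "SF x" "open W" "p \<in> W" "W \<subseteq> U"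
    "\<And>q v. q \<in> W \<Longrightarrow> coord_vector A (U, \<psi>) q v x = l v"
proof -
  have ch: "is_chart (U, \<psi>)"
    using c by (simp add: smooth_chart_def)
  then have "open U" "open (\<psi> ` U)"
    by (auto simp: is_chart_def)
  obtain b W K where b: "SF b" "open W" "p \<in> W" "W \<subseteq> K" "closed K" "K \<subseteq> U"
    "\<And>q. q \<in> W \<Longrightarrow> b q = 1" "\<And>q. q \<notin> K \<Longrightarrow> b q = 0"
    using bump_exists[OF \<open>open U\<close> p] by metis
  define x where "x = (\<lambda>q. b q * l (\<psi> q))"
  have "SF x"
  proof (rule smooth_fun_extend[OF c b(5,6)])
    show "x q = 0" if "q \<notin> K" for q
      using b(8)[OF that] by (simp add: x_def)
    have "smooth_on (\<psi> ` U) (\<lambda>y. (b \<circ> inv_into U \<psi>) y * l y)"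
      by (intro smooth_on_mult \<open>open (\<psi> ` U)\<close> smooth_fun_chart[OF b(1) c]
          smooth_on_bounded_linear[OF _ smooth_on_ident l])
    then show "smooth_on (\<psi> ` U) (x \<circ> inv_into U \<psi>)"
      by (rule smooth_on_cong[OF \<open>open (\<psi> ` U)\<close>]) (auto simp: x_def chart_inv[OF ch])
  qed
  moreover have "coord_vector A (U, \<psi>) q v x = l v" if "q \<in> W" for q v
  proof -
    have "open (\<psi> ` (U \<inter> W))"
      by (rule chart_image_open[OF ch b(2)])
    moreover have "\<psi> q \<in> \<psi> ` (U \<inter> W)"
      using that b(4,6) by auto
    ultimately have "((x \<circ> inv_into U \<psi>) has_derivative l) (at (\<psi> q))"
      by (rule has_derivative_transform_within_open[OF bounded_linear_imp_has_derivative[OF l]])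
         (auto simp: x_def chart_inv[OF ch] b(7))
    then show ?thesis
      using frechet_derivative_at[of "x \<circ> inv_into U \<psi>" l "\<psi> q"] \<open>SF x\<close> by (simp add: coord_vector_def)
  qed
  ultimately show thesis
    using that[of x W] b by auto
qed

end

section \<open>Local frames and dual coframes\<close>

text \<open>The type of tangent vectors has no \<open>real_vector\<close> instance, so their linear algebra is an
  interpretation of the locale \<open>vector_space\<close>.\<close>

definition tscale :: "real \<Rightarrow> 'm tvec \<Rightarrow> 'm tvec" where
  "tscale a v = (\<lambda>f. a * v f)"

lemma tscale_apply [simp]: "tscale a v f = a * v f"
  by (simp add: tscale_def)

interpretation tv: vector_space tscale
  by unfold_locales (auto simp: fun_eq_iff algebra_simps)

lemma sum_fun_apply [simp]: "(\<Sum>i\<in>I. F i) x = (\<Sum>i\<in>I. F i x)"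
  by (induction I rule: infinite_finite_induct) auto

lemma fscale_at [simp]: "(f \<odot> X) p = tscale (f p) (X p)"
  by (simp add: fscale_def tscale_def)

lemma cscale_at [simp]: "(a \<cdot> X) p = tscale a (X p)"
  by (simp add: cscale_def)

text \<open>An independent set in the span of \<open>T\<close> cannot outnumber \<open>T\<close>. If
  it already has \<open>card T\<close> elements, there is no room for a further independent vector
  and none for a redundant vector in \<open>T\<close>. The dimension counts below rest on this form
  of the exchange argument.\<close>

lemma (in vector_space) span_independent_card:
  assumes "finite T" "independent S" "S \<subseteq> span T" "card T \<le> card S"
  shows "span T \<subseteq> span S" "independent T" "card T = card S"
proof -
  have fin: "finite S" and le: "card S \<le> card T"
    using independent_span_bound[OF assms(1-3)] by auto
  then show card: "card T = card S"
    using assms(4) by simp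
  have "t \<in> span S" if "t \<in> T" for t
  proof (rule ccontr)
    assume t: "t \<notin> span S"
    then have "independent (insert t S)" "t \<notin> S"
      using assms(2) span_base by (auto simp: independent_insert)
    moreover have "insert t S \<subseteq> span T"
      using that assms(3) span_base by auto
    ultimately have "card (insert t S) \<le> card T"
      using independent_span_bound[OF assms(1)] by blast
    with \<open>t \<notin> S\<close> fin card show False by simp
  qed
  then show "span T \<subseteq> span S"
    by (intro span_minimal) auto
  show "independent T"
  proof
    assume "dependent T"
    then obtain t where t: "t \<in> T" "t \<in> span (T - {t})"
      by (auto simp: dependent_def)
    then have "span (T - {t}) = span T"
      using span_redundant[of t "T - {t}"] by (simp add: insert_absorb)
    then have "card S \<le> card (T - {t})"
      using independent_span_bound[of "T - {t}" S] assms by auto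
    moreover have "card (T - {t}) < card T"
      using t(1) assms(1) by (intro psubset_card_mono) auto
    ultimately show False
      using card by simp
  qed
qed

context smooth_manifold
begin

text \<open>A \<open>one_form\<close> acts on fields, whereas coefficients in a frame need covectors
  that act on single vectors. Linearity is asked on all functionals, so that linear combinations
  need no tangency side conditions.\<close>

definition covector_field :: "('m \<Rightarrow> 'm tvec \<Rightarrow> real) \<Rightarrow> bool" where
  "covector_field \<alpha> \<longleftrightarrow> (\<forall>q v w. \<alpha> q (v + w) = \<alpha> q v + \<alpha> q w) \<and>
     (\<forall>q a v. \<alpha> q (tscale a v) = a * \<alpha> q v) \<and> (\<forall>X. VF X \<longrightarrow> SF (\<lambda>q. \<alpha> q (X q)))"

lemma covector_field_0: "covector_field \<alpha> \<Longrightarrow> \<alpha> q 0 = 0"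
  unfolding covector_field_def by (metis add.right_neutral add_cancel_right_right)

definition coframe_on :: "'m set \<Rightarrow> 'm vfield set \<Rightarrow> ('m vfield \<Rightarrow> 'm \<Rightarrow> 'm tvec \<Rightarrow> real) \<Rightarrow> bool" where
  "coframe_on V I \<alpha> \<longleftrightarrow> finite I \<and> (\<forall>E\<in>I. VF E \<and> covector_field (\<alpha> E)) \<and>
     (\<forall>q\<in>V. \<forall>E\<in>I. \<forall>E'\<in>I. \<alpha> E q (E' q) = of_bool (E = E'))"

lemma coframe_expand:
  assumes "coframe_on V I \<alpha>" "q \<in> V" "v \<in> tv.span ((\<lambda>E. E q) ` I)"
  shows "v = (\<Sum>E\<in>I. tscale (\<alpha> E q v) (E q))"
  using assms(3)
proof (induction rule: tv.span_induct)
  case base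
  show ?case
    using assms(1) unfolding module.subspace_def[OF tv.module_axioms]
    by (auto simp: coframe_on_def covector_field_0 covector_field_def tv.scale_left_distrib
        sum.distrib tv.scale_sum_right fun_eq_iff sum_distrib_left algebra_simps)
next
  case (step v)
  then obtain E where E: "E \<in> I" "v = E q" by auto
  have "(\<Sum>E'\<in>I. tscale (\<alpha> E' q (E q)) (E' q)) = (\<Sum>E'\<in>I. if E' = E then E' q else 0)"
    using assms(1,2) E(1) by (intro sum.cong) (auto simp: coframe_on_def fun_eq_iff)
  also have "\<dots> = E q"
    using assms(1) E(1) by (simp add: coframe_on_def)
  finally have "(\<Sum>E'\<in>I. tscale (\<alpha> E' q (E q)) (E' q)) = E q" .
  then show ?case
    unfolding E(2) by (rule sym)
qed

lemma coframe_independent: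
  assumes "coframe_on V I \<alpha>" "q \<in> V"
  shows "tv.independent ((\<lambda>E. E q) ` I)" "inj_on (\<lambda>E. E q) I"
proof -
  show inj: "inj_on (\<lambda>E. E q) I"
  proof (rule inj_onI)
    fix E E' assume *: "E \<in> I" "E' \<in> I" "E q = E' q"
    have "\<alpha> E q (E q) = 1" "\<alpha> E q (E' q) = of_bool (E = E')"
      using *(1,2) assms by (auto simp: coframe_on_def)
    with *(3) show "E = E'"
      by (cases "E = E'") auto
  qed
  show "tv.independent ((\<lambda>E. E q) ` I)"
    unfolding tv.dependent_def
  proof
    assume "\<exists>a\<in>(\<lambda>E. E q) ` I. a \<in> tv.span ((\<lambda>E. E q) ` I - {a})"
    then obtain E where E: "E \<in> I" "E q \<in> tv.span ((\<lambda>E. E q) ` I - {E q})" by auto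
    have "\<alpha> E q (E q) = 0"
      using E(2)
    proof (induction rule: tv.span_induct)
      case base
      show ?case
        using assms E(1) unfolding module.subspace_def[OF tv.module_axioms]
        by (auto simp: coframe_on_def covector_field_0 covector_field_def)
    next
      case (step v)
      then obtain E' where "E' \<in> I" "v = E' q" "E' \<noteq> E" by auto
      then show ?case
        using assms E(1) by (auto simp: coframe_on_def)
    qed
    then show False
      using assms E(1) by (simp add: coframe_on_def)
  qed
qed

text \<open>Gram--Schmidt without a metric: the part of a new field \<open>N\<close> that is not in the span of the
  previous ones is detected near \<open>p\<close> by some function \<open>u\<close>, and \<open>w \<mapsto> (w - projection of w) u\<close> is the
  new covector up to normalisation.\<close>

lemma dual_coframe_exists:
  assumes "finite I" "\<And>E. E \<in> I \<Longrightarrow> VF E" "tv.independent ((\<lambda>E. E p) ` I)" "inj_on (\<lambda>E. E p) I"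
  shows "\<exists>\<alpha> V. open V \<and> p \<in> V \<and> coframe_on V I \<alpha>"
  using assms
proof (induction I rule: finite_induct)
  case empty
  then show ?case by (auto simp: coframe_on_def)
next
  case (insert N I)
  have notin: "N p \<notin> (\<lambda>E. E p) ` I"
    using insert.prems(3) insert.hyps(2) by auto
  with insert.prems(2) have ind: "tv.independent ((\<lambda>E. E p) ` I)" "N p \<notin> tv.span ((\<lambda>E. E p) ` I)"
    unfolding image_insert tv.independent_insert by metis+
  obtain \<alpha> V where V: "open V" "p \<in> V" "coframe_on V I \<alpha>"
    using insert.IH[OF _ ind(1)] insert.prems by auto
  have cov: "VF E" "covector_field (\<alpha> E)" if "E \<in> I" for E
    using V(3) that by (auto simp: coframe_on_def)
  have VFN: "VF N"
    using insert.prems by auto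
  define v where "v = N p - (\<Sum>E\<in>I. tscale (\<alpha> E p (N p)) (E p))"
  have "(\<Sum>E\<in>I. tscale (\<alpha> E p (N p)) (E p)) \<in> tv.span ((\<lambda>E. E p) ` I)"
    by (intro tv.span_sum tv.span_scale tv.span_base) auto
  with ind(2) have "v \<noteq> 0"
    by (auto simp: v_def)
  then obtain u where u: "v u \<noteq> 0"
    by (auto simp: fun_eq_iff)
  \<comment> \<open>Derivations are 0 on non-smooth functions, so a function on which
    \<open>v\<close> is nonzero is smooth.\<close>
  have "SF u"
  proof (rule ccontr)
    assume "\<not> SF u"
    then have "N p u = 0" "(\<Sum>E\<in>I. \<alpha> E p (N p) * E p u) = 0"
      using VFN cov(1) tangent_not_smooth[OF vector_field_tangent] by (auto intro!: sum.neutral)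
    with u show False by (simp add: v_def)
  qed
  define \<beta> where "\<beta> = (\<lambda>q w. w u - (\<Sum>E\<in>I. \<alpha> E q w * E q u))"
  have \<beta>: "covector_field \<beta>"
    unfolding covector_field_def
  proof (intro conjI allI impI)
    show "\<beta> q (x + y) = \<beta> q x + \<beta> q y" for q x y
      using cov(2) by (simp add: \<beta>_def covector_field_def sum.distrib algebra_simps)
    show "\<beta> q (tscale a x) = a * \<beta> q x" for q a x
      using cov(2) by (simp add: \<beta>_def covector_field_def sum_distrib_left algebra_simps)
    fix X assume X: "VF X"
    have "SF (\<lambda>q. \<alpha> E q (X q) * E q u)" if "E \<in> I" for E
      using smooth_fun_mult[of "\<lambda>q. \<alpha> E q (X q)" "\<lambda>q. E q u"] cov[OF that] X
        vector_field_smooth_fun[OF cov(1)[OF that] \<open>SF u\<close>]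
      by (simp add: covector_field_def times_fun_def)
    then show "SF (\<lambda>q. \<beta> q (X q))"
      using smooth_fun_diff[OF vector_field_smooth_fun[OF X \<open>SF u\<close>] smooth_fun_sum[of I]]
      by (simp add: \<beta>_def fun_diff_def)
  qed
  have \<beta>I: "\<beta> q (E q) = 0" if "q \<in> V" "E \<in> I" for q E
  proof -
    have "(\<Sum>E'\<in>I. \<alpha> E' q (E q) * E' q u) = (\<Sum>E'\<in>I. if E' = E then E' q u else 0)"
      using V(3) that by (intro sum.cong) (auto simp: coframe_on_def)
    then show ?thesis
      using that insert.hyps(1) by (simp add: \<beta>_def)
  qed
  have "\<beta> p (N p) \<noteq> 0"
    using u by (simp add: v_def \<beta>_def)
  moreover have "SF (\<lambda>q. \<beta> q (N q))"
    using \<beta> VFN by (simp add: covector_field_def)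
  ultimately obtain r W where W: "SF r" "open W" "p \<in> W" "\<And>q. q \<in> W \<Longrightarrow> r q * \<beta> q (N q) = 1"
    using smooth_fun_local_inverse[of "\<lambda>q. \<beta> q (N q)" p] by metis
  define \<nu> where "\<nu> = (\<lambda>q w. r q * \<beta> q w)"
  have \<nu>: "covector_field \<nu>"
    unfolding covector_field_def
  proof (intro conjI allI impI)
    fix X assume "VF X"
    then have "SF (r * (\<lambda>q. \<beta> q (X q)))"
      using \<beta> W(1) by (intro smooth_fun_mult) (auto simp: covector_field_def)
    then show "SF (\<lambda>q. \<nu> q (X q))"
      by (simp add: \<nu>_def times_fun_def)
  qed (use \<beta> in \<open>auto simp: covector_field_def \<nu>_def algebra_simps\<close>)
  \<comment> \<open>Subtracting multiples of \<open>\<nu>\<close> makes the old covectors vanish on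
    \<open>N\<close> and keeps their values on \<open>I\<close>, where \<open>\<nu>\<close> is
    0.\<close>
  define \<alpha>' where "\<alpha>' = (\<lambda>E. if E = N then \<nu> else (\<lambda>q w. \<alpha> E q w - \<alpha> E q (N q) * \<nu> q w))"
  have "covector_field (\<lambda>q w. \<alpha> E q w - \<alpha> E q (N q) * \<nu> q w)" if "E \<in> I" for E
    unfolding covector_field_def
  proof (intro conjI allI impI)
    fix X assume X: "VF X"
    have "SF ((\<lambda>q. \<alpha> E q (X q)) - (\<lambda>q. \<alpha> E q (N q)) * (\<lambda>q. \<nu> q (X q)))"
      using cov(2)[OF that] \<nu> X VFN by (intro smooth_fun_diff smooth_fun_mult) (auto simp: covector_field_def)
    then show "SF (\<lambda>q. \<alpha> E q (X q) - \<alpha> E q (N q) * \<nu> q (X q))"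
      by (simp add: fun_diff_def times_fun_def)
  qed (use cov(2)[OF that] \<nu> in \<open>auto simp: covector_field_def algebra_simps\<close>)
  then have "coframe_on (V \<inter> W) (insert N I) \<alpha>'"
    using V(3) \<nu> VFN insert.hyps W(4) \<beta>I
    by (auto simp: coframe_on_def \<alpha>'_def \<nu>_def)
  then show ?case
    using V(1,2) W(2,3) by (intro exI[of _ \<alpha>'] exI[of _ "V \<inter> W"]) auto
qed

lemma coframe_on_subset: "coframe_on V I \<alpha> \<Longrightarrow> W \<subseteq> V \<Longrightarrow> coframe_on W I \<alpha>"
  by (auto simp: coframe_on_def)

section \<open>Coordinate frames of a foliation\<close>

lemma coord_vector_span:
  assumes c: "smooth_chart A (U, \<psi>)" and q: "q \<in> U"
  shows "coord_vector A (U, \<psi>) q ` span B = tv.span (coord_vector A (U, \<psi>) q ` B)"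
proof -
  interpret l: Vector_Spaces.linear scaleR tscale "coord_vector A (U, \<psi>) q"
    by unfold_locales (use coord_vector_linear[OF c q] in \<open>auto simp: tscale_def scaleR_add_right scaleR_add_left\<close>)
  show ?thesis
    by (simp add: l.span_image span_raw_def)
qed

lemma coord_vector_independent:
  assumes c: "smooth_chart A (U, \<psi>)" and q: "q \<in> U"
  shows "inj (coord_vector A (U, \<psi>) q)" "tv.independent (coord_vector A (U, \<psi>) q ` Basis)"
proof -
  interpret l: Vector_Spaces.linear scaleR tscale "coord_vector A (U, \<psi>) q"
    by unfold_locales (use coord_vector_linear[OF c q] in \<open>auto simp: tscale_def scaleR_add_right scaleR_add_left\<close>)
  show inj: "inj (coord_vector A (U, \<psi>) q)"
  proof (rule injI)
    fix v w assume *: "coord_vector A (U, \<psi>) q v = coord_vector A (U, \<psi>) q w"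
    have "v \<bullet> b = w \<bullet> b" for b
    proof -
      obtain x W where "q \<in> W" "\<And>q v. q \<in> W \<Longrightarrow> coord_vector A (U, \<psi>) q v x = v \<bullet> b"
        using coord_function[OF c q bounded_linear_inner_left[of b]] by metis
      then show ?thesis
        using * by metis
    qed
    then show "v = w"
      by (metis inner_eq_zero_iff inner_diff_left right_minus_eq)
  qed
  show "tv.independent (coord_vector A (U, \<psi>) q ` Basis)"
    using l.independent_inj_image[OF _ inj] independent_Basis by (simp add: dependent_raw_def)
qed

lemma vector_field_sum: "(\<And>i. i \<in> I \<Longrightarrow> VF (X i)) \<Longrightarrow> VF (\<Sum>i\<in>I. X i)"
  by (induction I rule: infinite_finite_induct) (auto simp: vector_field_0)

lemma foliation_subspace:
  assumes "foliation A n L"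
  shows "tv.subspace (L q)" "L q \<subseteq> TS q"
proof -
  obtain U \<psi> B where c: "smooth_chart A (U, \<psi>)" "q \<in> U" and L: "L q = coord_vector A (U, \<psi>) q ` span B"
    using assms unfolding foliation_def by (metis fst_conv surj_pair)
  show "tv.subspace (L q)"
    unfolding L coord_vector_span[OF c] by (rule tv.subspace_span)
  show "L q \<subseteq> TS q"
    unfolding L using coord_vector_tangent[OF c] by auto
qed

text \<open>Only an upper bound for the number of fields is recorded. That there are exactly n of
  them and that they are independent comes out later, from the dimension count for the whole
  splitting.\<close>

definition spanning_on :: "'m set \<Rightarrow> nat \<Rightarrow> 'm distrib \<Rightarrow> 'm vfield set \<Rightarrow> bool" where
  "spanning_on V n L I \<longleftrightarrow> finite I \<and> card I \<le> n \<and> (\<forall>E\<in>I. section_of A L E) \<and>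
    (\<forall>q\<in>V. L q \<subseteq> tv.span ((\<lambda>E. E q) ` I))"

lemma foliation_frame:
  assumes "foliation A n L"
  shows "\<exists>I V. open V \<and> p \<in> V \<and> spanning_on V n L I"
proof -
  obtain c B where c0: "smooth_chart A c" "p \<in> fst c" "B \<subseteq> Basis" "card B = n"
    and L0: "\<forall>q\<in>fst c. L q = coord_vector A c q ` span B"
    using assms unfolding foliation_def by metis
  obtain U \<psi> where cU: "c = (U, \<psi>)" by (cases c)
  note c = c0[unfolded cU fst_conv] and L = L0[unfolded cU fst_conv]
  have "\<forall>b. \<exists>E W. VF E \<and> open W \<and> p \<in> W \<and> W \<subseteq> U \<and> (\<forall>q\<in>W. E q = coord_vector A (U, \<psi>) q b) \<and>
      (\<forall>q\<in>U. \<exists>t. E q = coord_vector A (U, \<psi>) q (t *\<^sub>R b)) \<and> (\<forall>q. q \<notin> U \<longrightarrow> E q = 0)"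
    using coord_field[OF c(1,2)] by metis
  then obtain E W where E: "\<And>b. VF (E b)" "\<And>b. open (W b)" "\<And>b. p \<in> W b" "\<And>b. W b \<subseteq> U"
      "\<And>b q. q \<in> W b \<Longrightarrow> E b q = coord_vector A (U, \<psi>) q b"
      "\<And>b q. q \<in> U \<Longrightarrow> \<exists>t. E b q = coord_vector A (U, \<psi>) q (t *\<^sub>R b)" "\<And>b q. q \<notin> U \<Longrightarrow> E b q = 0"
    by metis
  have finB: "finite B"
    using c(3) finite_Basis finite_subset by blast
  show ?thesis
    unfolding spanning_on_def
  proof (intro exI[of _ "E ` B"] exI[of _ "U \<inter> (\<Inter>b\<in>B. W b)"] conjI ballI)
    show "finite (E ` B)" "card (E ` B) \<le> n"
      using finB c(4) card_image_le[OF finB, of E] by auto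
    show "section_of A L X" if "X \<in> E ` B" for X
    proof -
      obtain b where b: "b \<in> B" "X = E b" using \<open>X \<in> E ` B\<close> by blast
      have "E b q \<in> L q" for q
      proof (cases "q \<in> U")
        case True
        obtain t where "E b q = coord_vector A (U, \<psi>) q (t *\<^sub>R b)"
          using E(6)[OF True, of b] by blast
        moreover have "t *\<^sub>R b \<in> span B"
          using b(1) by (intro span_scale span_base)
        ultimately show ?thesis
          using L True by blast
      next
        case False
        then show ?thesis
          using E(7) tv.subspace_0[OF foliation_subspace(1)[OF assms]] by simp
      qed
      then show ?thesis
        using E(1) b(2) by (simp add: section_of_def)
    qed
    show "open (U \<inter> (\<Inter>b\<in>B. W b))"
      using c(1) finB E(2) by (intro open_Int open_INT) (auto simp: smooth_chart_def is_chart_def)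
    show "p \<in> U \<inter> (\<Inter>b\<in>B. W b)"
      using c(2) E(3) by auto
    show "L q \<subseteq> tv.span ((\<lambda>E. E q) ` E ` B)" if "q \<in> U \<inter> (\<Inter>b\<in>B. W b)" for q
    proof -
      have "(\<lambda>E. E q) ` E ` B = coord_vector A (U, \<psi>) q ` B"
        using that E(5) unfolding image_image by (intro image_cong) auto
      then show ?thesis
        using L that coord_vector_span[OF c(1)] by auto
    qed
  qed
qed

end

section \<open>Bi-Legendrian structures\<close>

locale bi_legendrian = smooth_manifold A
  for A :: "('m::t2_space, 'e::euclidean_space) chart set" +
  fixes n :: nat and \<eta> :: "'m vfield \<Rightarrow> 'm \<Rightarrow> real" and \<xi> :: "'m vfield" and L1 L2 :: "'m distrib"
  assumes dim: "DIM('e) = 2 * n + 1" and form: "one_form A \<eta>" and reeb: "reeb_field A \<eta> \<xi>"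
    and bileg: "bi_legendrian_structure A n \<eta> \<xi> L1 L2"
begin

lemma VF_xi [simp]: "VF \<xi>" and eta_xi: "\<eta> \<xi> = 1" and d_eta_xi: "VF X \<Longrightarrow> ext_d \<eta> \<xi> X = 0"
  using reeb by (auto simp: reeb_field_def)

lemma foliations: "foliation A n L1" "foliation A n L2"
  using bileg by (auto simp: bi_legendrian_structure_def legendre_foliation_def)

lemmas L1_subspace = foliation_subspace(1)[OF foliations(1)]
lemmas L2_subspace = foliation_subspace(1)[OF foliations(2)]

lemma eta_L1: "VF X \<Longrightarrow> X p \<in> L1 p \<Longrightarrow> \<eta> X p = 0"
  using bileg by (auto simp: bi_legendrian_structure_def legendre_foliation_def)

lemma split_tangent:
  assumes "u \<in> L1 p" "w \<in> L2 p"
  shows "u + w + tscale a (\<xi> p) \<in> TS p"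
  using assms foliation_subspace(2)[OF foliations(1)] foliation_subspace(2)[OF foliations(2)]
    vector_field_tangent[OF VF_xi]
  by (intro tangent_space_add) (auto simp: tscale_def intro: tangent_space_scale)

lemma split_unique:
  assumes "u \<in> L1 p" "w \<in> L2 p" "u' \<in> L1 p" "w' \<in> L2 p"
    "u + w + tscale a (\<xi> p) = u' + w' + tscale a' (\<xi> p)"
  shows "u = u' \<and> w = w' \<and> a = a'"
proof -
  define v where "v = u + w + tscale a (\<xi> p)"
  have "v \<in> TS p"
    unfolding v_def by (rule split_tangent[OF assms(1,2)])
  then have "\<exists>!(u, w, a). u \<in> L1 p \<and> w \<in> L2 p \<and> v = u + w + (a \<cdot> \<xi>) p"
    using bileg by (auto simp: bi_legendrian_structure_def)
  then have "(u, w, a) = (u', w', a')"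
    by (rule ex1E) (use assms in \<open>auto simp: v_def\<close>)
  then show ?thesis by simp
qed

lemma split_exists:
  assumes "v \<in> TS p"
  obtains u w a where "u \<in> L1 p" "w \<in> L2 p" "v = u + w + tscale a (\<xi> p)"
proof -
  have "\<exists>!(u, w, a). u \<in> L1 p \<and> w \<in> L2 p \<and> v = u + w + (a \<cdot> \<xi>) p"
    using bileg assms by (auto simp: bi_legendrian_structure_def)
  then show thesis
    using that by (elim ex1E) auto
qed

lemma splitting_proj_eq:
  assumes "u \<in> L1 p" "w \<in> L2 p" "X p = u + w + tscale a (\<xi> p)"
  shows "splitting_proj L1 L2 \<xi> X p = u"
  unfolding splitting_proj_def
proof (rule the_equality)
  show "u \<in> L1 p \<and> (\<exists>w a. w \<in> L2 p \<and> X p = u + w + (a \<cdot> \<xi>) p)"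
    using assms by auto
  show "u' = u" if u': "u' \<in> L1 p \<and> (\<exists>w a. w \<in> L2 p \<and> X p = u' + w + (a \<cdot> \<xi>) p)" for u'
  proof -
    obtain w' a' where w': "u' \<in> L1 p" "w' \<in> L2 p" "X p = u' + w' + tscale a' (\<xi> p)"
      using u' by auto
    show ?thesis
      using split_unique[OF w'(1,2) assms(1,2) trans[OF w'(3)[symmetric] assms(3)]] ..
  qed
qed

text \<open>The assumptions are symmetric in the two foliations. Many facts about \<open>L2\<close>
  are instances of facts about \<open>L1\<close> through this exchange, and so is the whole negative
  definite case.\<close>

lemma bi_legendrian_swap: "bi_legendrian A n \<eta> \<xi> L2 L1"
proof -
  have "\<exists>!(w, u, a). w \<in> L2 p \<and> u \<in> L1 p \<and> v = w + u + (a \<cdot> \<xi>) p" if v: "v \<in> TS p" for p v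
  proof -
    obtain u w a where uwa: "u \<in> L1 p" "w \<in> L2 p" "v = u + w + tscale a (\<xi> p)"
      by (rule split_exists[OF v])
    show ?thesis
    proof (rule ex1I[of _ "(w, u, a)"])
      show "case (w, u, a) of (w, u, a) \<Rightarrow> w \<in> L2 p \<and> u \<in> L1 p \<and> v = w + u + (a \<cdot> \<xi>) p"
        using uwa by (simp add: add.commute)
      show "y = (w, u, a)" if y: "case y of (w, u, a) \<Rightarrow> w \<in> L2 p \<and> u \<in> L1 p \<and> v = w + u + (a \<cdot> \<xi>) p" for y
      proof -
        obtain w' u' a' where y': "y = (w', u', a')" by (cases y)
        then have *: "w' \<in> L2 p" "u' \<in> L1 p" "v = u' + w' + tscale a' (\<xi> p)"
          using y by (simp_all add: add.commute)
        show ?thesis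
          using split_unique[OF *(2,1) uwa(1,2) trans[OF *(3)[symmetric] uwa(3)]] y' by simp
      qed
    qed
  qed
  then show ?thesis
    using bileg dim form reeb by unfold_locales (auto simp: bi_legendrian_structure_def)
qed

section \<open>Frames adapted to the splitting and the dimension of the tangent space\<close>

definition adapted :: "'m set \<Rightarrow> 'm vfield set \<Rightarrow> 'm vfield set \<Rightarrow> ('m vfield \<Rightarrow> 'm \<Rightarrow> 'm tvec \<Rightarrow> real) \<Rightarrow> bool"
  where "adapted V I1 I2 \<alpha> \<longleftrightarrow> finite I1 \<and> finite I2 \<and> card I1 = n \<and> card I2 = n \<and>
     I1 \<inter> I2 = {} \<and> \<xi> \<notin> I1 \<union> I2 \<and> (\<forall>E\<in>I1. section_of A L1 E) \<and> (\<forall>E\<in>I2. section_of A L2 E) \<and>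
     coframe_on V (insert \<xi> (I1 \<union> I2)) \<alpha> \<and>
     (\<forall>q\<in>V. TS q \<subseteq> tv.span ((\<lambda>E. E q) ` insert \<xi> (I1 \<union> I2)) \<and>
       L1 q \<subseteq> tv.span ((\<lambda>E. E q) ` I1) \<and> L2 q \<subseteq> tv.span ((\<lambda>E. E q) ` I2))"

lemma adaptedD:
  assumes "adapted V I1 I2 \<alpha>"
  shows "finite I1" "finite I2" "card I1 = n" "card I2 = n" "I1 \<inter> I2 = {}" "\<xi> \<notin> I1 \<union> I2"
    "\<And>E. E \<in> I1 \<Longrightarrow> section_of A L1 E" "\<And>E. E \<in> I2 \<Longrightarrow> section_of A L2 E"
    "coframe_on V (insert \<xi> (I1 \<union> I2)) \<alpha>"
    "\<And>q. q \<in> V \<Longrightarrow> TS q \<subseteq> tv.span ((\<lambda>E. E q) ` insert \<xi> (I1 \<union> I2))"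
    "\<And>q. q \<in> V \<Longrightarrow> L1 q \<subseteq> tv.span ((\<lambda>E. E q) ` I1)"
    "\<And>q. q \<in> V \<Longrightarrow> L2 q \<subseteq> tv.span ((\<lambda>E. E q) ` I2)"
  using assms unfolding adapted_def by blast+

text \<open>That every derivation at \<open>p\<close> is a coordinate vector follows by counting dimensions: the
  splitting provides \<open>2 n + 1\<close> spanning vectors, and there are as many independent coordinate
  vectors.\<close>

lemma adapted_frame: "\<exists>I1 I2 \<alpha> V. open V \<and> p \<in> V \<and> adapted V I1 I2 \<alpha>"
  and tangent_space_chart: "smooth_chart A (U, \<psi>) \<Longrightarrow> p \<in> U \<Longrightarrow> TS p = range (coord_vector A (U, \<psi>) p)"
proof -
  obtain I1 V1 where V1: "open V1" "p \<in> V1" and sp1: "spanning_on V1 n L1 I1"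
    using foliation_frame[OF foliations(1), of p] by metis
  obtain I2 V2 where V2: "open V2" "p \<in> V2" and sp2: "spanning_on V2 n L2 I2"
    using foliation_frame[OF foliations(2), of p] by metis
  have I1: "finite I1" "card I1 \<le> n" "\<And>E. E \<in> I1 \<Longrightarrow> section_of A L1 E" "open V1" "p \<in> V1"
    "\<And>q. q \<in> V1 \<Longrightarrow> L1 q \<subseteq> tv.span ((\<lambda>E. E q) ` I1)"
    using sp1 V1 unfolding spanning_on_def by simp_all
  have I2: "finite I2" "card I2 \<le> n" "\<And>E. E \<in> I2 \<Longrightarrow> section_of A L2 E" "open V2" "p \<in> V2"
    "\<And>q. q \<in> V2 \<Longrightarrow> L2 q \<subseteq> tv.span ((\<lambda>E. E q) ` I2)"
    using sp2 V2 unfolding spanning_on_def by simp_all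
  define I where "I = insert \<xi> (I1 \<union> I2)"
  have finI: "finite I" and VFI: "\<And>E. E \<in> I \<Longrightarrow> VF E"
    using I1(1,3) I2(1,3) VF_xi by (auto simp: I_def section_of_def)
  have sp: "TS q \<subseteq> tv.span ((\<lambda>E. E q) ` I)" if q: "q \<in> V1 \<inter> V2" for q
  proof
    fix v assume "v \<in> TS q"
    then obtain u w a where v: "u \<in> L1 q" "w \<in> L2 q" "v = u + w + tscale a (\<xi> q)"
      by (rule split_exists)
    have "tv.span ((\<lambda>E. E q) ` I1) \<subseteq> tv.span ((\<lambda>E. E q) ` I)"
      "tv.span ((\<lambda>E. E q) ` I2) \<subseteq> tv.span ((\<lambda>E. E q) ` I)"
      by (intro tv.span_mono image_mono; auto simp: I_def)+
    moreover have "u \<in> tv.span ((\<lambda>E. E q) ` I1)" "w \<in> tv.span ((\<lambda>E. E q) ` I2)"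
      using I1(6)[of q] I2(6)[of q] q v(1,2) by blast+
    ultimately have "u \<in> tv.span ((\<lambda>E. E q) ` I)" "w \<in> tv.span ((\<lambda>E. E q) ` I)"
      by blast+
    moreover have "\<xi> q \<in> tv.span ((\<lambda>E. E q) ` I)"
      by (intro tv.span_base imageI) (simp add: I_def)
    ultimately show "v \<in> tv.span ((\<lambda>E. E q) ` I)"
      unfolding v(3) by (metis tv.span_add tv.span_scale)
  qed
  have cardI: "card I \<le> card I1 + card I2 + 1"
    using card_insert_le_m1[of "card I1 + card I2 + 1" "I1 \<union> I2" \<xi>] card_Un_le[of I1 I2]
    by (simp add: I_def)
  have cardIp: "card ((\<lambda>E. E p) ` I) \<le> card I"
    by (rule card_image_le[OF finI])
  have chart: "tv.span ((\<lambda>E. E p) ` I) \<subseteq> range (coord_vector A (U, \<psi>) p) \<and>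
      tv.independent ((\<lambda>E. E p) ` I) \<and> card ((\<lambda>E. E p) ` I) = 2 * n + 1"
    if c: "smooth_chart A (U, \<psi>)" "p \<in> U" for U \<psi>
  proof -
    let ?S = "coord_vector A (U, \<psi>) p ` Basis"
    have card: "card ?S = 2 * n + 1"
      using dim card_image[OF inj_on_subset[OF coord_vector_independent(1)[OF c]], of Basis] by simp
    have "?S \<subseteq> tv.span ((\<lambda>E. E p) ` I)"
      using sp[of p] I1(5) I2(5) coord_vector_tangent[OF c] by blast
    moreover have "card ((\<lambda>E. E p) ` I) \<le> card ?S"
      using cardIp cardI I1(2) I2(2) card by linarith
    ultimately have *: "tv.span ((\<lambda>E. E p) ` I) \<subseteq> tv.span ?S" "tv.independent ((\<lambda>E. E p) ` I)"
       "card ((\<lambda>E. E p) ` I) = card ?S"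
      using tv.span_independent_card[OF finite_imageI[OF finI] coord_vector_independent(2)[OF c]] by blast+
    then show ?thesis
      using card coord_vector_span[OF c, of Basis] by simp
  qed
  obtain U \<psi> where "(U, \<psi>) \<in> A" "p \<in> U"
    by (rule atlas_chart_at)
  then have ind: "tv.independent ((\<lambda>E. E p) ` I)" and cp: "card ((\<lambda>E. E p) ` I) = 2 * n + 1"
    using chart[OF atlas_chart] by blast+
  \<comment> \<open>The chain of inequalities between the cardinalities is tight. Hence both frames
    have n elements, distinct fields have distinct values at \<open>p\<close>, and
    \<open>I1\<close>, \<open>I2\<close> and \<open>\<xi>\<close> do not overlap.\<close>
  have cI: "card I = 2 * n + 1" "card I1 = n" "card I2 = n"
    using cp cardIp cardI I1(2) I2(2) by linarith+
  then have inj: "inj_on (\<lambda>E. E p) I"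
    using cp finI by (intro eq_card_imp_inj_on) auto
  have notin: "\<xi> \<notin> I1 \<union> I2"
  proof
    assume "\<xi> \<in> I1 \<union> I2"
    then have "card I \<le> card I1 + card I2"
      using card_Un_le[of I1 I2] by (simp add: I_def insert_absorb)
    then show False using cI by simp
  qed
  have "card (I1 \<inter> I2) = 0"
    using cI notin I1(1) I2(1) card_Un_Int[OF I1(1) I2(1)] by (simp add: I_def)
  then have disj: "I1 \<inter> I2 = {}"
    using I1(1) by simp
  \<comment> \<open>Independence is known at \<open>p\<close> only; the dual coframe carries it to a
    neighbourhood.\<close>
  obtain \<alpha> V where V: "open V" "p \<in> V" "coframe_on V I \<alpha>"
    using dual_coframe_exists[OF finI VFI ind inj] by auto
  have "adapted (V1 \<inter> V2 \<inter> V) I1 I2 \<alpha>"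
    unfolding adapted_def
  proof (intro conjI ballI)
    show "coframe_on (V1 \<inter> V2 \<inter> V) (insert \<xi> (I1 \<union> I2)) \<alpha>"
      using coframe_on_subset[OF V(3)] by (auto simp: I_def)
    fix q assume q: "q \<in> V1 \<inter> V2 \<inter> V"
    show "TS q \<subseteq> tv.span ((\<lambda>E. E q) ` insert \<xi> (I1 \<union> I2))"
      using sp[of q] q by (auto simp: I_def)
    show "L1 q \<subseteq> tv.span ((\<lambda>E. E q) ` I1)" "L2 q \<subseteq> tv.span ((\<lambda>E. E q) ` I2)"
      using I1(6)[of q] I2(6)[of q] q by blast+
  next
    show "section_of A L1 E" if "E \<in> I1" for E
      by (rule I1(3)[OF that])
    show "section_of A L2 E" if "E \<in> I2" for E
      by (rule I2(3)[OF that])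
  qed (fact I1(1) I2(1) cI(2,3) disj notin)+
  moreover have "open (V1 \<inter> V2 \<inter> V)" "p \<in> V1 \<inter> V2 \<inter> V"
    using I1(4,5) I2(4,5) V(1,2) by auto
  ultimately show "\<exists>I1 I2 \<alpha> V. open V \<and> p \<in> V \<and> adapted V I1 I2 \<alpha>"
    by metis
  show "TS p = range (coord_vector A (U, \<psi>) p)" if c: "smooth_chart A (U, \<psi>)" "p \<in> U" for U \<psi>
    using chart[OF c] sp[of p] I1(5) I2(5) coord_vector_tangent[OF c] by blast
qed

end

section \<open>Brackets, forms and tensors\<close>

context smooth_manifold
begin

lemma vfield_apply_add [simp]: "vfield_apply (X + Y) f = vfield_apply X f + vfield_apply Y f"
  and vfield_apply_fscale [simp]: "vfield_apply (g \<odot> X) f = g * vfield_apply X f"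
  by (simp_all add: vfield_apply_def fscale_def fun_eq_iff)

lemma vfield_apply_function:
  assumes "VF X" "SF f" "SF g"
  shows "vfield_apply X (f + g) = vfield_apply X f + vfield_apply X g"
    and "vfield_apply X (f - g) = vfield_apply X f - vfield_apply X g"
    and "vfield_apply X (f * g) = f * vfield_apply X g + g * vfield_apply X f"
  using tangent_add[OF vector_field_tangent] tangent_mult[OF vector_field_tangent]
    tangent_diff[OF vector_field_tangent] assms
  by (simp_all add: vfield_apply_def fun_eq_iff)

lemma vector_field_eqI:
  assumes "VF X" "VF Y" "\<And>p f. SF f \<Longrightarrow> X p f = Y p f"
  shows "X = Y"
proof (intro ext)
  show "X p f = Y p f" for p f
    using assms(3) tangent_not_smooth[OF vector_field_tangent[OF assms(1)]]
      tangent_not_smooth[OF vector_field_tangent[OF assms(2)]] by (cases "SF f") auto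
qed

lemma bracket_antisym: "bracket X Y = - bracket Y X"
  by (simp add: bracket_def fun_eq_iff)

lemma bracket_add_right:
  assumes "VF X" "VF Y" "VF Z"
  shows "bracket X (Y + Z) = bracket X Y + bracket X Z"
proof (rule vector_field_eqI)
  show "bracket X (Y + Z) p f = (bracket X Y + bracket X Z) p f" if "SF f" for p f
    using assms that by (simp add: bracket_def tangent_add[OF vector_field_tangent])
qed (simp_all add: assms)

lemma bracket_fscale_right:
  assumes "SF g" "VF X" "VF Y"
  shows "bracket X (g \<odot> Y) = vfield_apply X g \<odot> Y + g \<odot> bracket X Y"
proof (rule vector_field_eqI)
  show "bracket X (g \<odot> Y) p f = (vfield_apply X g \<odot> Y + g \<odot> bracket X Y) p f" if "SF f" for p f
    using assms that tangent_mult[OF vector_field_tangent[OF assms(2)], of g "vfield_apply Y f" p]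
    by (simp add: bracket_def) (simp add: vfield_apply_def algebra_simps)
qed (simp_all add: assms)

lemma vfield_apply_bracket:
  "vfield_apply (bracket U V) f = vfield_apply U (vfield_apply V f) - vfield_apply V (vfield_apply U f)"
  by (simp add: bracket_def vfield_apply_def fun_eq_iff)

lemma bracket_apply: "bracket U V p f = U p (vfield_apply V f) - V p (vfield_apply U f)"
  by (simp add: bracket_def)

lemma bracket_jacobi:
  assumes "VF X" "VF Y" "VF Z"
  shows "bracket (bracket X Y) Z + bracket (bracket Y Z) X + bracket (bracket Z X) Y = 0"
proof (rule vector_field_eqI)
  show "(bracket (bracket X Y) Z + bracket (bracket Y Z) X + bracket (bracket Z X) Y) p f = 0 p f"
    if "SF f" for p f
    using assms that
    by (simp add: bracket_apply vfield_apply_bracket tangent_diff[OF vector_field_tangent])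
qed (simp_all add: vector_field_0 assms)

section \<open>One-forms, endomorphism fields and the exterior derivative\<close>

lemma one_formD:
  assumes "one_form A \<omega>"
  shows "VF X \<Longrightarrow> SF (\<omega> X)" "VF X \<Longrightarrow> VF Y \<Longrightarrow> \<omega> (X + Y) = \<omega> X + \<omega> Y"
    "SF f \<Longrightarrow> VF X \<Longrightarrow> \<omega> (f \<odot> X) = f * \<omega> X"
  using assms by (auto simp: one_form_def)

lemma one_form_cscale:
  assumes "one_form A \<omega>" "VF X"
  shows "\<omega> (a \<cdot> X) = (\<lambda>p. a * \<omega> X p)"
  using one_formD(3)[OF assms(1) smooth_fun_const assms(2), of a] by (simp add: cscale_def times_fun_def)

lemma uminus_eq_cscale: "- X = (- 1) \<cdot> (X :: 'm vfield)"
  by (simp add: cscale_def fscale_def fun_Compl_def)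

lemma one_form_uminus: "one_form A \<omega> \<Longrightarrow> VF X \<Longrightarrow> \<omega> (- X) = - \<omega> X"
  by (simp add: uminus_eq_cscale one_form_cscale fun_Compl_def)

lemma one_form_diff: "one_form A \<omega> \<Longrightarrow> VF X \<Longrightarrow> VF Y \<Longrightarrow> \<omega> (X - Y) = \<omega> X - \<omega> Y"
  using one_formD(2)[of \<omega> X "- Y"] by (simp add: one_form_uminus fun_eq_iff)

lemma one_form_0: "one_form A \<omega> \<Longrightarrow> \<omega> 0 = 0"
  using one_form_diff[of \<omega> 0 0] by (simp add: vector_field_0)

lemma one_form_sum:
  "one_form A \<omega> \<Longrightarrow> (\<And>i. i \<in> I \<Longrightarrow> VF (X i)) \<Longrightarrow> \<omega> (\<Sum>i\<in>I. X i) = (\<Sum>i\<in>I. \<omega> (X i))"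
  by (induction I rule: infinite_finite_induct) (auto simp: one_form_0 one_formD(2) vector_field_sum)

lemma endo_tensorD:
  assumes "endo_tensor A \<Phi>"
  shows "VF X \<Longrightarrow> VF (\<Phi> X)" "VF X \<Longrightarrow> VF Y \<Longrightarrow> \<Phi> (X + Y) = \<Phi> X + \<Phi> Y"
    "SF f \<Longrightarrow> VF X \<Longrightarrow> \<Phi> (f \<odot> X) = f \<odot> \<Phi> X"
  using assms by (auto simp: endo_tensor_def)

lemma endo_tensor_cscale: "endo_tensor A \<Phi> \<Longrightarrow> VF X \<Longrightarrow> \<Phi> (a \<cdot> X) = a \<cdot> \<Phi> X"
  unfolding cscale_def by (rule endo_tensorD(3)[OF _ smooth_fun_const])

lemma endo_tensor_uminus: "endo_tensor A \<Phi> \<Longrightarrow> VF X \<Longrightarrow> \<Phi> (- X) = - \<Phi> X"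
  unfolding uminus_eq_cscale by (rule endo_tensor_cscale)

lemma endo_tensor_diff: "endo_tensor A \<Phi> \<Longrightarrow> VF X \<Longrightarrow> VF Y \<Longrightarrow> \<Phi> (X - Y) = \<Phi> X - \<Phi> Y"
  using endo_tensorD(2)[of \<Phi> X "- Y"] endo_tensor_uminus[of \<Phi> Y] by simp

lemma endo_tensor_0: "endo_tensor A \<Phi> \<Longrightarrow> \<Phi> 0 = 0"
  using endo_tensor_diff[of \<Phi> 0 0] by (simp add: vector_field_0)

lemma ext_d_antisym: "one_form A \<omega> \<Longrightarrow> VF X \<Longrightarrow> VF Y \<Longrightarrow> ext_d \<omega> X Y = - ext_d \<omega> Y X"
  by (simp add: ext_d_def fun_eq_iff bracket_antisym[of X Y] one_form_uminus field_simps)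

lemma ext_d_one_form:
  assumes "one_form A \<omega>" "VF X"
  shows "one_form A (ext_d \<omega> X)"
proof -
  have eq: "ext_d \<omega> X Y = (\<lambda>_. 1 / 2) * (vfield_apply X (\<omega> Y) - vfield_apply Y (\<omega> X) - \<omega> (bracket X Y))" for Y
    by (simp add: ext_d_def fun_eq_iff)
  have a: "SF (\<omega> Y)" if "VF Y" for Y
    using one_formD[OF assms(1)] that by simp
  show ?thesis
    unfolding one_form_def
  proof (intro conjI allI impI)
    show "SF (ext_d \<omega> X Y)" if "VF Y" for Y
      unfolding eq using assms that a by (simp add: smooth_fun_const)
    show "ext_d \<omega> X (Y + Z) = ext_d \<omega> X Y + ext_d \<omega> X Z" if "VF Y \<and> VF Z" for Y Z
      unfolding eq using assms that a
      by (simp add: one_formD[OF assms(1)] bracket_add_right vfield_apply_function algebra_simps)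
    show "ext_d \<omega> X (f \<odot> Y) = f * ext_d \<omega> X Y" if "SF f \<and> VF Y" for f Y
      unfolding eq using assms that a
      by (simp add: one_formD[OF assms(1)] bracket_fscale_right vfield_apply_function algebra_simps)
  qed
qed

text \<open>In the cyclic sum the second derivatives of the functions \<omega>(X) cancel, and so do
  the first derivatives of \<omega> on brackets. What remains is \<omega> of the Jacobi
  expression.\<close>

lemma ext_d_closed:
  assumes w: "one_form A \<omega>" and "VF X" "VF Y" "VF Z"
  shows "vfield_apply X (ext_d \<omega> Y Z) + vfield_apply Y (ext_d \<omega> Z X) + vfield_apply Z (ext_d \<omega> X Y)
     - ext_d \<omega> (bracket X Y) Z - ext_d \<omega> (bracket Y Z) X - ext_d \<omega> (bracket Z X) Y = 0"
proof
  fix p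
  have eq: "ext_d \<omega> U V = (\<lambda>q. 1 / 2 * (vfield_apply U (\<omega> V) - vfield_apply V (\<omega> U) - \<omega> (bracket U V)) q)" for U V
    by (simp add: ext_d_def fun_eq_iff)
  have d: "W p (ext_d \<omega> U V) = (W p (vfield_apply U (\<omega> V)) - W p (vfield_apply V (\<omega> U)) - W p (\<omega> (bracket U V))) / 2"
    if "VF U" "VF V" "VF W" for U V W
    unfolding eq using that one_formD(1)[OF w]
    by (subst tangent_scale[OF vector_field_tangent]) (simp_all add: tangent_diff[OF vector_field_tangent])
  have "\<omega> (bracket (bracket X Y) Z + bracket (bracket Y Z) X + bracket (bracket Z X) Y) = 0"
    using bracket_jacobi[OF assms(2-)] one_form_0[OF w] by simp
  then have j: "\<omega> (bracket (bracket X Y) Z) p + \<omega> (bracket (bracket Y Z) X) p + \<omega> (bracket (bracket Z X) Y) p = 0"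
    using assms by (simp add: one_formD(2)[OF w] fun_eq_iff)
  have b: "bracket U V p (\<omega> W) = U p (vfield_apply V (\<omega> W)) - V p (vfield_apply U (\<omega> W))" for U V W
    by (simp add: bracket_def)
  have e: "ext_d \<omega> (bracket U V) W p = (bracket U V p (\<omega> W) - W p (\<omega> (bracket U V)) - \<omega> (bracket (bracket U V) W) p) / 2" for U V W
    by (simp add: ext_d_def vfield_apply_def)
  show "(vfield_apply X (ext_d \<omega> Y Z) + vfield_apply Y (ext_d \<omega> Z X) + vfield_apply Z (ext_d \<omega> X Y)
     - ext_d \<omega> (bracket X Y) Z - ext_d \<omega> (bracket Y Z) X - ext_d \<omega> (bracket Z X) Y) p = 0 p"
    using j assms by (simp add: vfield_apply_def[of X "ext_d \<omega> _ _"] vfield_apply_def[of Y "ext_d \<omega> _ _"]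
        vfield_apply_def[of Z "ext_d \<omega> _ _"] d e b field_simps)
qed

lemma section_of_add: "foliation A k L \<Longrightarrow> section_of A L X \<Longrightarrow> section_of A L Y \<Longrightarrow> section_of A L (X + Y)"
  using tv.subspace_add[OF foliation_subspace(1)] by (auto simp: section_of_def)

lemma section_of_fscale: "foliation A k L \<Longrightarrow> SF f \<Longrightarrow> section_of A L X \<Longrightarrow> section_of A L (f \<odot> X)"
  using tv.subspace_scale[OF foliation_subspace(1)] by (auto simp: section_of_def)

lemma section_of_cscale: "foliation A k L \<Longrightarrow> section_of A L X \<Longrightarrow> section_of A L (a \<cdot> X)"
  unfolding cscale_def by (intro section_of_fscale smooth_fun_const)

lemma section_of_uminus: "foliation A k L \<Longrightarrow> section_of A L X \<Longrightarrow> section_of A L (- X)"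
  by (simp add: uminus_eq_cscale section_of_cscale)

lemma section_of_diff: "foliation A k L \<Longrightarrow> section_of A L X \<Longrightarrow> section_of A L Y \<Longrightarrow> section_of A L (X - Y)"
  using section_of_add[of k L X "- Y"] by (simp add: section_of_uminus)

lemma section_of_0: "foliation A k L \<Longrightarrow> section_of A L 0"
  using tv.subspace_0[OF foliation_subspace(1)] by (auto simp: section_of_def vector_field_0)

lemma section_of_sum:
  "foliation A k L \<Longrightarrow> (\<And>i. i \<in> I \<Longrightarrow> section_of A L (X i)) \<Longrightarrow> section_of A L (\<Sum>i\<in>I. X i)"
  by (induction I rule: infinite_finite_induct) (auto simp: section_of_0 section_of_add)

lemma section_VF: "section_of A L X \<Longrightarrow> VF X"
  by (simp add: section_of_def)

end

context bi_legendrian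
begin

section \<open>Smoothness of the projections of the splitting\<close>

abbreviation "P1 \<equiv> splitting_proj L1 L2 \<xi>"
abbreviation "P2 \<equiv> splitting_proj L2 L1 \<xi>"

lemmas splitting_proj_eq' = bi_legendrian.splitting_proj_eq[OF bi_legendrian_swap]

lemma splitting_proj_both:
  assumes "u \<in> L1 p" "w \<in> L2 p" "X p = u + w + tscale a (\<xi> p)"
  shows "P1 X p = u" "P2 X p = w"
  using splitting_proj_eq[where X=X and p=p, OF assms]
    splitting_proj_eq'[where X=X and p=p, OF assms(2,1), of a] assms(3)
  by (simp_all add: add.commute)

lemma split_at:
  assumes "VF X"
  obtains a where "P1 X p \<in> L1 p" "P2 X p \<in> L2 p" "X p = P1 X p + P2 X p + tscale a (\<xi> p)"
proof -
  obtain u w a where *: "u \<in> L1 p" "w \<in> L2 p" "X p = u + w + tscale a (\<xi> p)"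
    by (rule split_exists[OF vector_field_tangent[OF assms]])
  then show thesis
    using that[of a] splitting_proj_both[where X=X and p=p, OF *] by simp
qed

text \<open>The projections are chosen point by point with \<open>THE\<close>. The coframe exhibits
  them near each point as combinations of frame fields with smooth coefficients.\<close>

lemma split_frame:
  assumes fr: "adapted V I1 I2 \<alpha>" and q: "q \<in> V" and X: "VF X"
  shows "P1 X q = (\<Sum>E\<in>I1. tscale (\<alpha> E q (X q)) (E q))" "P2 X q = (\<Sum>E\<in>I2. tscale (\<alpha> E q (X q)) (E q))"
    "X q = P1 X q + P2 X q + tscale (\<alpha> \<xi> q (X q)) (\<xi> q)"
proof -
  let ?u = "\<Sum>E\<in>I1. tscale (\<alpha> E q (X q)) (E q)" and ?w = "\<Sum>E\<in>I2. tscale (\<alpha> E q (X q)) (E q)"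
  have "X q \<in> tv.span ((\<lambda>E. E q) ` insert \<xi> (I1 \<union> I2))"
    using adaptedD(10)[OF fr q] vector_field_tangent[OF X] by blast
  then have "X q = (\<Sum>E\<in>insert \<xi> (I1 \<union> I2). tscale (\<alpha> E q (X q)) (E q))"
    by (rule coframe_expand[OF adaptedD(9)[OF fr] q])
  also have "\<dots> = tscale (\<alpha> \<xi> q (X q)) (\<xi> q) + (?u + ?w)"
    using adaptedD(1,2,5,6)[OF fr]
    by (simp only: sum.insert finite_Un sum.union_disjoint not_False_eq_True simp_thms if_True)
  also have "\<dots> = ?u + ?w + tscale (\<alpha> \<xi> q (X q)) (\<xi> q)"
    by (rule add.commute)
  finally have eq: "X q = ?u + ?w + tscale (\<alpha> \<xi> q (X q)) (\<xi> q)" .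
  have "?u \<in> L1 q" "?w \<in> L2 q"
    using adaptedD(7,8)[OF fr] by (auto intro!: tv.subspace_sum tv.subspace_scale L1_subspace L2_subspace simp: section_of_def)
  note * = splitting_proj_both[where X=X, OF this eq]
  show "P1 X q = ?u" "P2 X q = ?w"
    by (fact *)+
  show "X q = P1 X q + P2 X q + tscale (\<alpha> \<xi> q (X q)) (\<xi> q)"
    unfolding * by (rule eq)
qed

lemma section_P1:
  assumes X: "VF X"
  shows "section_of A L1 (P1 X)"
  unfolding section_of_def
proof (intro conjI allI)
  show "P1 X p \<in> L1 p" for p
    by (rule split_at[OF X, of p])
  show "VF (P1 X)"
  proof (rule vector_field_local)
    fix p
    obtain I1 I2 \<alpha> V where V: "open V" "p \<in> V" and fr: "adapted V I1 I2 \<alpha>"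
      using adapted_frame[of p] by metis
    have "VF (\<Sum>E\<in>I1. (\<lambda>q. \<alpha> E q (X q)) \<odot> E)"
      using adaptedD(7,9)[OF fr] X by (intro vector_field_sum vector_field_fscale)
         (auto simp: coframe_on_def covector_field_def section_of_def)
    moreover have "P1 X q = (\<Sum>E\<in>I1. (\<lambda>q. \<alpha> E q (X q)) \<odot> E) q" if "q \<in> V" for q
      using split_frame(1)[OF fr that X] by simp
    ultimately show "\<exists>V Y. open V \<and> p \<in> V \<and> VF Y \<and> (\<forall>q\<in>V. P1 X q = Y q)"
      using V by blast
  qed
qed

lemmas section_P2 = bi_legendrian.section_P1[OF bi_legendrian_swap]

lemma VF_P1 [simp]: "VF X \<Longrightarrow> VF (P1 X)" and VF_P2 [simp]: "VF X \<Longrightarrow> VF (P2 X)"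
  using section_P1 section_P2 section_VF by auto

lemma eta_section1: "section_of A L1 X \<Longrightarrow> \<eta> X = 0"
  by (auto simp: section_of_def intro!: ext eta_L1)

lemmas eta_section2 = bi_legendrian.eta_section1[OF bi_legendrian_swap]

lemma field_split:
  assumes X: "VF X"
  shows "X = P1 X + P2 X + \<eta> X \<odot> \<xi>"
proof -
  have "\<exists>a. X p = P1 X p + P2 X p + tscale a (\<xi> p)" for p
    using split_at[OF X, of p] by metis
  then obtain a where a: "\<And>p. X p = P1 X p + P2 X p + tscale (a p) (\<xi> p)"
    by metis
  \<comment> \<open>By uniqueness of the splitting the pointwise coefficient is a coframe component
    near each point. Once it is smooth, \<open>\<eta>\<close> can be applied to the sum and
    identifies it as \<open>\<eta> X\<close>.\<close>
  have "SF a"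
  proof (rule smooth_fun_local)
    fix p
    obtain I1 I2 \<alpha> V where V: "open V" "p \<in> V" and fr: "adapted V I1 I2 \<alpha>"
      using adapted_frame[of p] by metis
    have mem: "P1 X q \<in> L1 q" "P2 X q \<in> L2 q" for q
      using section_P1[OF X] section_P2[OF X] by (auto simp: section_of_def)
    have "a q = \<alpha> \<xi> q (X q)" if "q \<in> V" for q
      using split_unique[OF mem mem trans[OF a[symmetric] split_frame(3)[OF fr that X]]]
      by blast
    moreover have "SF (\<lambda>q. \<alpha> \<xi> q (X q))"
      using adaptedD(9)[OF fr] X by (auto simp: coframe_on_def covector_field_def)
    ultimately show "\<exists>V g. open V \<and> p \<in> V \<and> SF g \<and> (\<forall>q\<in>V. a q = g q)"
      using V by blast
  qed
  have eq: "X = P1 X + P2 X + a \<odot> \<xi>"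
    using a by (intro ext) (simp only: plus_fun_apply fscale_at)
  have "\<eta> X = \<eta> (P1 X + P2 X + a \<odot> \<xi>)"
    using eq by (rule arg_cong)
  also have "\<dots> = a"
    using \<open>SF a\<close> X by (simp add: one_formD[OF form] eta_section1 section_P1 eta_section2 section_P2 eta_xi)
  finally show ?thesis
    using eq by metis
qed

lemma field_split_at: "VF X \<Longrightarrow> X p u = P1 X p u + P2 X p u + \<eta> X p * \<xi> p u"
  using fun_cong[OF fun_cong[OF field_split[of X], of p], of u] by (simp add: fscale_def)

lemma P1_eqI:
  assumes "section_of A L1 U" "section_of A L2 W" "X = U + W + f \<odot> \<xi>"
  shows "P1 X = U"
proof
  fix p
  have "U p \<in> L1 p" "W p \<in> L2 p" "X p = U p + W p + tscale (f p) (\<xi> p)"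
    using assms(1,2) fun_cong[OF assms(3), of p] by (simp_all add: section_of_def)
  then show "P1 X p = U p"
    by (rule splitting_proj_eq)
qed

lemma P1_endo: "endo_tensor A P1"
  unfolding endo_tensor_def
proof (intro conjI allI impI)
  show "VF (P1 X)" if "VF X" for X
    using that by simp
  show "P1 (X + Y) = P1 X + P1 Y" if "VF X \<and> VF Y" for X Y
  proof (rule P1_eqI)
    show "section_of A L1 (P1 X + P1 Y)"
      using that by (intro section_of_add[OF foliations(1)] section_P1) auto
    show "section_of A L2 (P2 X + P2 Y)"
      using that by (intro section_of_add[OF foliations(2)] section_P2) auto
    show "X + Y = P1 X + P1 Y + (P2 X + P2 Y) + (\<eta> X + \<eta> Y) \<odot> \<xi>"
      using field_split_at[of X] field_split_at[of Y] that
      by (simp add: fun_eq_iff fscale_def algebra_simps)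
  qed
  show "P1 (f \<odot> X) = f \<odot> P1 X" if "SF f \<and> VF X" for f X
  proof (rule P1_eqI)
    show "section_of A L1 (f \<odot> P1 X)"
      using that by (intro section_of_fscale[OF foliations(1)] section_P1) auto
    show "section_of A L2 (f \<odot> P2 X)"
      using that by (intro section_of_fscale[OF foliations(2)] section_P2) auto
    show "f \<odot> X = f \<odot> P1 X + f \<odot> P2 X + (f * \<eta> X) \<odot> \<xi>"
      using field_split_at[of X] that by (simp add: fun_eq_iff fscale_def algebra_simps)
  qed
qed

lemmas P2_endo = bi_legendrian.P1_endo[OF bi_legendrian_swap]

lemma xi_split: "\<xi> = 0 + 0 + 1 \<odot> \<xi>"
  by (simp add: fun_eq_iff fscale_def)

lemma P1_section1: "section_of A L1 X \<Longrightarrow> P1 X = X"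
  by (rule P1_eqI[of X 0 X 0]) (auto simp: section_of_0[OF foliations(2)] fun_eq_iff fscale_def)

lemma P1_section2: "section_of A L2 X \<Longrightarrow> P1 X = 0"
  by (rule P1_eqI[of 0 X X 0]) (auto simp: section_of_0[OF foliations(1)] fun_eq_iff fscale_def)

lemma P1_xi: "P1 \<xi> = 0"
  by (rule P1_eqI[OF section_of_0[OF foliations(1)] section_of_0[OF foliations(2)] xi_split])

lemmas P2_section2 = bi_legendrian.P1_section1[OF bi_legendrian_swap]
lemmas P2_section1 = bi_legendrian.P1_section2[OF bi_legendrian_swap]
lemmas P2_xi = bi_legendrian.P1_xi[OF bi_legendrian_swap]

text \<open>The frame expansion of \<open>X\<close> holds on \<open>V\<close> only. Multiplied by a
  cut-off it holds globally, so \<open>\<omega>\<close> may be applied to it, and all its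
  coefficients vanish at \<open>p\<close> together with \<open>X\<close>.\<close>

lemma one_form_pointwise:
  assumes w: "one_form A \<omega>" and X: "VF X" "X p = 0"
  shows "\<omega> X p = 0"
proof -
  obtain I1 I2 \<alpha> V where V: "open V" "p \<in> V" and ad: "adapted V I1 I2 \<alpha>"
    using adapted_frame[of p] by metis
  note fr = V adaptedD(9,10)[OF ad]
  define I where "I = insert \<xi> (I1 \<union> I2)"
  have I: "coframe_on V I \<alpha>" "\<And>E. E \<in> I \<Longrightarrow> VF E" "\<And>E. E \<in> I \<Longrightarrow> covector_field (\<alpha> E)"
    using fr(3) by (auto simp: I_def coframe_on_def)
  obtain b W K where b: "SF b" "p \<in> W" "K \<subseteq> V" "\<And>q. q \<in> W \<Longrightarrow> b q = 1" "\<And>q. q \<notin> K \<Longrightarrow> b q = 0"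
    using bump_exists[OF fr(1,2)] by metis
  have sm: "SF (b * (\<lambda>q. \<alpha> E q (X q)))" if "E \<in> I" for E
    using I(3)[OF that] X(1) b(1) by (auto simp: covector_field_def)
  have "b \<odot> X = (\<Sum>E\<in>I. (b * (\<lambda>q. \<alpha> E q (X q))) \<odot> E)"
  proof (rule ext)
    fix q
    show "(b \<odot> X) q = (\<Sum>E\<in>I. (b * (\<lambda>q. \<alpha> E q (X q))) \<odot> E) q"
    proof (cases "q \<in> V")
      case True
      have "X q \<in> tv.span ((\<lambda>E. E q) ` I)"
        using fr(4)[OF True] vector_field_tangent[OF X(1)] by (auto simp: I_def)
      from coframe_expand[OF I(1) True this]
      have "tscale (b q) (X q) = tscale (b q) (\<Sum>E\<in>I. tscale (\<alpha> E q (X q)) (E q))"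
        by (rule arg_cong)
      then show ?thesis
        by (simp add: tv.scale_sum_right)
    next
      case False
      then have "b q = 0" using b(3,5) by blast
      then show ?thesis by simp
    qed
  qed
  then have "\<omega> (b \<odot> X) = (\<Sum>E\<in>I. (b * (\<lambda>q. \<alpha> E q (X q))) * \<omega> E)"
    using I(2) sm by (simp add: one_form_sum[OF w] one_formD(3)[OF w])
  then have "(b * \<omega> X) p = (\<Sum>E\<in>I. (b * (\<lambda>q. \<alpha> E q (X q))) * \<omega> E) p"
    using one_formD(3)[OF w b(1) X(1)] by simp
  moreover have "\<alpha> E p (X p) = 0" if "E \<in> I" for E
    using covector_field_0[OF I(3)[OF that]] X(2) by simp
  ultimately show ?thesis
    using b(2,4) by simp
qed

text \<open>Evaluation of \<open>\<Phi> X\<close> on a fixed smooth function is a one-form in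
  \<open>X\<close>; on other functions the value is 0 by default.\<close>

lemma endo_pointwise:
  assumes e: "endo_tensor A \<Phi>" and X: "VF X" "X p = 0"
  shows "\<Phi> X p = 0"
proof
  fix u
  show "\<Phi> X p u = 0 u"
  proof (cases "SF u")
    case True
    have "one_form A (\<lambda>X q. \<Phi> X q u)"
      using True vector_field_smooth_fun endo_tensorD[OF e]
      by (auto simp: one_form_def fun_eq_iff)
    from one_form_pointwise[OF this X] show ?thesis by simp
  next
    case False
    then show ?thesis
      using tangent_not_smooth[OF vector_field_tangent] endo_tensorD(1)[OF e X(1)] by auto
  qed
qed

lemma section_extend:
  assumes "v \<in> L1 p"
  obtains X where "section_of A L1 X" "X p = v"
proof -
  obtain I1 I2 \<alpha> V where V: "open V" "p \<in> V" and ad: "adapted V I1 I2 \<alpha>"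
    using adapted_frame[of p] by metis
  note fr = V(2) adaptedD(7,9,11)[OF ad]
  have "coframe_on V I1 \<alpha>"
    using fr(3) by (auto simp: coframe_on_def)
  from coframe_expand[OF this fr(1)] assms fr(1,4)
  have "v = (\<Sum>E\<in>I1. tscale (\<alpha> E p v) (E p))" by blast
  then have "(\<Sum>E\<in>I1. \<alpha> E p v \<cdot> E) p = v" by simp
  moreover have "section_of A L1 (\<Sum>E\<in>I1. \<alpha> E p v \<cdot> E)"
    using fr(2) by (intro section_of_sum[OF foliations(1)] section_of_cscale[OF foliations(1)])
  ultimately show thesis using that by blast
qed

text \<open>Near \<open>p\<close> sections of \<open>L1\<close> annihilate the coordinate functions
  transverse to the leaves, so their bracket annihilates these at \<open>p\<close>. As every
  derivation at \<open>p\<close> is a coordinate vector, the bracket has leaf coordinates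
  only.\<close>

lemma involutive:
  assumes X: "section_of A L1 X" and Y: "section_of A L1 Y"
  shows "section_of A L1 (bracket X Y)"
  unfolding section_of_def
proof (intro conjI allI)
  show V: "VF (bracket X Y)"
    using X Y by (auto simp: section_of_def)
  fix p
  obtain c B where c0: "smooth_chart A c" "p \<in> fst c" "B \<subseteq> Basis"
    and L0: "\<forall>q\<in>fst c. L1 q = coord_vector A c q ` span B"
    using foliations(1) unfolding foliation_def by metis
  obtain U \<psi> where cU: "c = (U, \<psi>)" by (cases c)
  note c = c0[unfolded cU fst_conv] and L = L0[unfolded cU fst_conv]
  have "TS p = range (coord_vector A (U, \<psi>) p)"
    using tangent_space_chart c by blast
  then obtain w where w: "bracket X Y p = coord_vector A (U, \<psi>) p w"
    using vector_field_tangent[OF V, of p] by auto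
  have orth: "v \<bullet> b = 0" if "b \<in> Basis - B" "v \<in> span B" for b v
  proof -
    have "orthogonal b y" if "y \<in> B" for y
      using inner_not_same_Basis[of b y] that \<open>b \<in> Basis - B\<close> c(3) by (auto simp: orthogonal_def)
    then show ?thesis
      using orthogonal_to_span[OF \<open>v \<in> span B\<close>, of b] by (simp add: orthogonal_def inner_commute)
  qed
  have "w \<bullet> b = 0" if b: "b \<in> Basis - B" for b
  proof -
    obtain x W where x: "SF x" "open W" "p \<in> W" "W \<subseteq> U"
      "\<And>q v. q \<in> W \<Longrightarrow> coord_vector A (U, \<psi>) q v x = v \<bullet> b"
      using coord_function[OF c(1,2) bounded_linear_inner_left[of b]] by metis
    have z: "vfield_apply Z x q = 0" if Z: "section_of A L1 Z" and q: "q \<in> W" for Z q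
    proof -
      have "Z q \<in> coord_vector A (U, \<psi>) q ` span B"
        using Z q unfolding section_of_def by (metis L subsetD x(4))
      then obtain v where "Z q = coord_vector A (U, \<psi>) q v" "v \<in> span B" by auto
      then show ?thesis
        using x(5)[OF q, of v] orth[OF b] by (simp add: vfield_apply_def)
    qed
    have zero: "Z p (vfield_apply Z' x) = 0" if "section_of A L1 Z" "section_of A L1 Z'" for Z Z'
    proof -
      have "Z p (vfield_apply Z' x) = Z p 0"
        by (rule tangent_local[OF vector_field_tangent[OF section_VF[OF that(1)]] _ smooth_fun_0 x(2,3)])
           (use z[OF that(2)] vector_field_smooth[OF section_VF[OF that(2)] x(1)] in auto)
      then show ?thesis
        using tangent_0[OF vector_field_tangent[OF section_VF[OF that(1)]]] by simp
    qed
    have "bracket X Y p x = 0"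
      by (simp add: bracket_def zero[OF X Y] zero[OF Y X])
    then show ?thesis
      using w x(5)[OF x(3), of w] by simp
  qed
  then have "(\<Sum>b\<in>Basis. (w \<bullet> b) *\<^sub>R b) = (\<Sum>b\<in>B. (w \<bullet> b) *\<^sub>R b)"
    by (intro sum.mono_neutral_right) (use c(3) in auto)
  then have "w = (\<Sum>b\<in>B. (w \<bullet> b) *\<^sub>R b)"
    by (simp only: euclidean_representation)
  also have "\<dots> \<in> span B"
    by (intro span_sum span_scale span_base)
  finally show "bracket X Y p \<in> L1 p"
    using w L c(2) by simp
qed

end

section \<open>The Pang invariant as a bundle map\<close>

context smooth_manifold
begin

lemma vfield_apply_0 [simp]: "VF X \<Longrightarrow> vfield_apply X 0 = 0"
  and vfield_apply_1 [simp]: "VF X \<Longrightarrow> vfield_apply X 1 = 0"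
  by (simp_all add: vfield_apply_def fun_eq_iff one_fun_def tangent_0[OF vector_field_tangent]
      tangent_const[OF vector_field_tangent])

lemma covector_field_sum: "covector_field \<alpha> \<Longrightarrow> \<alpha> q (\<Sum>i\<in>I. v i) = (\<Sum>i\<in>I. \<alpha> q (v i))"
  by (induction I rule: infinite_finite_induct) (simp_all add: covector_field_0, simp add: covector_field_def)

lemma coframe_coeff:
  assumes "coframe_on V I \<alpha>" "q \<in> V" "E \<in> I"
  shows "\<alpha> E q (\<Sum>E'\<in>I. tscale (a E') (E' q)) = a E"
proof -
  have *: "covector_field (\<alpha> E)" "finite I" "\<And>E'. E' \<in> I \<Longrightarrow> \<alpha> E q (E' q) = of_bool (E = E')"
    using assms by (auto simp: coframe_on_def)
  have "\<alpha> E q (\<Sum>E'\<in>I. tscale (a E') (E' q)) = (\<Sum>E'\<in>I. a E' * \<alpha> E q (E' q))"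
    using *(1) by (simp only: covector_field_sum[OF *(1)]) (simp add: covector_field_def)
  also have "\<dots> = (\<Sum>E'\<in>I. if E' = E then a E' else 0)"
    using *(3) by (intro sum.cong) auto
  also have "\<dots> = a E"
    using *(2) assms(3) by simp
  finally show ?thesis .
qed

lemma endo_tensor_sum:
  "endo_tensor A \<Phi> \<Longrightarrow> (\<And>i. i \<in> I \<Longrightarrow> VF (X i)) \<Longrightarrow> \<Phi> (\<Sum>i\<in>I. X i) = (\<Sum>i\<in>I. \<Phi> (X i))"
  by (induction I rule: infinite_finite_induct)
     (simp_all add: endo_tensor_0 endo_tensorD(2) vector_field_sum fun_eq_iff)

end

context bi_legendrian
begin

section \<open>The two-form \<open>d\<close>, the Pang form and the bundle map\<close>

abbreviation "d \<equiv> ext_d \<eta>"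

lemma d_skew: "VF X \<Longrightarrow> VF Y \<Longrightarrow> d X Y = - d Y X"
  by (rule ext_d_antisym[OF form])

lemma d_form: "VF X \<Longrightarrow> one_form A (d X)"
  by (rule ext_d_one_form[OF form])

lemma d_right:
  assumes "VF X" "VF Y"
  shows "VF Z \<Longrightarrow> d X (Y + Z) p = d X Y p + d X Z p" "VF Z \<Longrightarrow> d X (Y - Z) p = d X Y p - d X Z p"
    "d X (- Y) p = - d X Y p" "SF f \<Longrightarrow> d X (f \<odot> Y) p = f p * d X Y p" "d X (a \<cdot> Y) p = a * d X Y p"
  using one_formD[OF d_form[OF assms(1)]] one_form_diff[OF d_form[OF assms(1)]]
    one_form_uminus[OF d_form[OF assms(1)]] one_form_cscale[OF d_form[OF assms(1)]] assms by simp_all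

lemma d_left:
  assumes "VF X" "VF Y"
  shows "VF Z \<Longrightarrow> d (Y + Z) X p = d Y X p + d Z X p" "VF Z \<Longrightarrow> d (Y - Z) X p = d Y X p - d Z X p"
    "d (- Y) X p = - d Y X p" "SF f \<Longrightarrow> d (f \<odot> Y) X p = f p * d Y X p" "d (a \<cdot> Y) X p = a * d Y X p"
  using d_right[OF assms] assms by (simp_all add: d_skew[of _ X])

lemma d_zero_right: "VF X \<Longrightarrow> d X 0 p = 0"
  and d_zero_left: "VF X \<Longrightarrow> d 0 X p = 0"
  using one_form_0[OF d_form[of X]] d_skew[of 0 X] vector_field_0 by simp_all

lemma d_xi: "VF X \<Longrightarrow> d \<xi> X p = 0" "VF X \<Longrightarrow> d X \<xi> p = 0"
  using d_eta_xi[of X] d_skew[of X \<xi>] by simp_all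

lemma d_iso1: "section_of A L1 X \<Longrightarrow> section_of A L1 Y \<Longrightarrow> d X Y p = 0"
  by (simp add: ext_d_def eta_section1 involutive section_VF)

lemmas d_iso2 = bi_legendrian.d_iso1[OF bi_legendrian_swap]

lemma d_pointwise: "VF X \<Longrightarrow> VF Y \<Longrightarrow> Y p = 0 \<Longrightarrow> d X Y p = 0" "VF X \<Longrightarrow> VF Y \<Longrightarrow> X p = 0 \<Longrightarrow> d X Y p = 0"
  using one_form_pointwise[OF d_form[of X], of Y p] one_form_pointwise[OF d_form[of Y], of X p]
    d_skew[of X Y] by auto

text \<open>Both subbundles are isotropic for \<open>d\<close>, and \<open>\<xi>\<close> lies in its
  kernel, so only the mixed terms survive.\<close>

lemma d_split:
  assumes "VF X" "VF Y"
  shows "d X Y p = d (P1 X) (P2 Y) p + d (P2 X) (P1 Y) p"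
proof -
  have VF: "VF (\<eta> Z \<odot> \<xi>)" "SF (\<eta> Z)" if "VF Z" for Z
    using one_formD(1)[OF form that] by simp_all
  have "d X Y p = d (P1 X + P2 X + \<eta> X \<odot> \<xi>) (P1 Y + P2 Y + \<eta> Y \<odot> \<xi>) p"
    using field_split assms by metis
  also have "\<dots> = d (P1 X) (P2 Y) p + d (P2 X) (P1 Y) p"
    using assms VF by (simp add: d_left d_right d_xi d_iso1 d_iso2 section_P1 section_P2)
  finally show ?thesis .
qed

lemma eta_bracket_xi: "VF X \<Longrightarrow> \<eta> (bracket \<xi> X) = vfield_apply \<xi> (\<eta> X)"
  using d_eta_xi[of X] by (simp add: ext_d_def fun_eq_iff eta_xi)

text \<open>This is the vanishing of the Lie derivative of \<open>d\<close> along
  \<open>\<xi>\<close>: \<open>d\<close> is closed and its contraction with \<open>\<xi>\<close> is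
  0.\<close>

lemma d_xi_invariant:
  assumes "VF X" "VF Y"
  shows "vfield_apply \<xi> (d X Y) p = d (bracket \<xi> X) Y p + d X (bracket \<xi> Y) p"
proof -
  have "vfield_apply \<xi> (d X Y) p + vfield_apply X (d Y \<xi>) p + vfield_apply Y (d \<xi> X) p
     - d (bracket \<xi> X) Y p - d (bracket X Y) \<xi> p - d (bracket Y \<xi>) X p = 0"
    using fun_cong[OF ext_d_closed[OF form VF_xi assms], of p] by simp
  moreover have "d Y \<xi> = 0" "d \<xi> X = 0"
    using d_xi assms by auto
  moreover have "d (bracket Y \<xi>) X p = d X (bracket \<xi> Y) p"
    using assms by (simp add: bracket_antisym[of Y \<xi>] d_left d_skew[of X])
  ultimately show ?thesis
    using assms by (simp add: d_xi)
qed

text \<open>Sections of \<open>L1\<close> and their brackets with \<open>\<xi>\<close> lie in the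
  kernel of \<open>\<eta>\<close>, so each Lie derivative reduces to a bracket term. The factor 2 is
  that of the convention for \<open>d\<close>.\<close>

lemma pang_eq:
  assumes X: "section_of A L1 X" and Y: "section_of A L1 Y"
  shows "pang_invariant \<eta> \<xi> X Y p = 2 * d (bracket \<xi> X) Y p"
proof -
  have V: "VF X" "VF Y" using X Y by (auto dest: section_VF)
  have e: "\<eta> (bracket Z \<xi>) = 0" if Z: "section_of A L1 Z" for Z
    using eta_bracket_xi[of Z] section_VF[OF Z] one_form_uminus[OF form, of "bracket \<xi> Z"]
    by (simp add: bracket_antisym[of Z \<xi>] eta_section1[OF Z])
  have "lie_form Y \<eta> \<xi> = 0"
    using V e[OF Y] by (simp add: lie_form_def eta_xi)
  then have "pang_invariant \<eta> \<xi> X Y p = lie_form Y \<eta> (bracket X \<xi>) p"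
    using V by (simp add: pang_invariant_def lie_form_def[of X])
  also have "\<dots> = - \<eta> (bracket Y (bracket X \<xi>)) p"
    using V e[OF X] by (simp add: lie_form_def)
  also have "\<dots> = 2 * d Y (bracket X \<xi>) p"
    using V e[OF X] by (simp add: ext_d_def eta_section1[OF Y])
  also have "d Y (bracket X \<xi>) p = d (bracket \<xi> X) Y p"
    using V d_right(3)[of Y "bracket \<xi> X" p]
    by (simp add: bracket_antisym[of X \<xi>] d_skew[of Y "bracket \<xi> X"])
  finally show ?thesis .
qed

lemmas pang_eq2 = bi_legendrian.pang_eq[OF bi_legendrian_swap]

definition \<psi> :: "'m vfield \<Rightarrow> 'm vfield" where
  "\<psi> X = P2 (bracket \<xi> (P1 X))"

lemma psi_endo: "endo_tensor A \<psi>"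
  unfolding endo_tensor_def
proof (intro conjI allI impI)
  show "VF (\<psi> X)" if "VF X" for X
    using that by (simp add: \<psi>_def)
  show "\<psi> (X + Y) = \<psi> X + \<psi> Y" if "VF X \<and> VF Y" for X Y
    using that by (simp add: \<psi>_def endo_tensorD[OF P1_endo] bracket_add_right endo_tensorD[OF P2_endo])
  show "\<psi> (f \<odot> X) = f \<odot> \<psi> X" if f: "SF f \<and> VF X" for f X
  proof -
    \<comment> \<open>The derivative term in the Leibniz rule of the bracket is a multiple of
      \<open>P1 X\<close> and is killed by \<open>P2\<close>; this is why \<open>\<psi>\<close> is
      tensorial.\<close>
    have "P2 (vfield_apply \<xi> f \<odot> P1 X) = 0"
      using f by (intro P2_section1 section_of_fscale[OF foliations(1)] section_P1) auto
    then show ?thesis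
      using f by (simp add: \<psi>_def endo_tensorD[OF P1_endo] bracket_fscale_right endo_tensorD[OF P2_endo])
  qed
qed

lemma section_psi: "VF X \<Longrightarrow> section_of A L2 (\<psi> X)"
  unfolding \<psi>_def by (intro section_P2 vector_field_bracket VF_P1 VF_xi)

lemma VF_psi [simp]: "VF X \<Longrightarrow> VF (\<psi> X)"
  using section_psi section_VF by blast

lemma psi_P1: "VF X \<Longrightarrow> \<psi> (P1 X) = \<psi> X"
  by (simp add: \<psi>_def P1_section1 section_P1)

lemma d_psi_sections:
  assumes "section_of A L1 X" "section_of A L1 Y"
  shows "d (\<psi> X) Y p = d (bracket \<xi> X) Y p"
  using d_split[of "bracket \<xi> X" Y p] section_VF[OF assms(1)] section_VF[OF assms(2)]
    P1_section1[OF assms(1)] P1_section1[OF assms(2)] P2_section1[OF assms(2)]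
    d_zero_right[of "P1 (bracket \<xi> X)" p] by (simp add: \<psi>_def)

lemma d_psi_P1: "VF X \<Longrightarrow> VF Y \<Longrightarrow> d (\<psi> X) Y p = d (\<psi> (P1 X)) (P1 Y) p"
  using d_split[of "\<psi> X" Y p] P1_section2[OF section_psi[of X]] P2_section2[OF section_psi[of X]]
    d_zero_left[of "P2 Y" p] by (simp add: psi_P1)

text \<open>\<open>d\<close> vanishes on pairs of sections of \<open>L1\<close>; differentiating
  this along \<open>\<xi>\<close> gives the symmetry. It is the symmetry of the Pang form, extended
  by 0 to all fields.\<close>

lemma psi_sym:
  assumes "VF X" "VF Y"
  shows "d (\<psi> X) Y p = d (\<psi> Y) X p"
proof -
  have *: "section_of A L1 (P1 X)" "section_of A L1 (P1 Y)"
    using assms section_P1 by auto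
  have "d (P1 X) (P1 Y) = 0"
    using d_iso1[OF *] by auto
  then have "d (bracket \<xi> (P1 X)) (P1 Y) p = - d (P1 X) (bracket \<xi> (P1 Y)) p"
    using d_xi_invariant[of "P1 X" "P1 Y" p] assms by simp
  also have "\<dots> = d (bracket \<xi> (P1 Y)) (P1 X) p"
    using assms by (simp add: d_skew[of "P1 X" "bracket \<xi> (P1 Y)"])
  finally show ?thesis
    using d_psi_P1[OF assms, of p] d_psi_P1[OF assms(2,1), of p] by (simp add: d_psi_sections *)
qed

end

text \<open>Division by \<open>c\<close> lets one locale serve both cases: a positive definite Pang
  form with c > 0 and a negative definite one with c < 0.\<close>

locale definite_flat = bi_legendrian A n \<eta> \<xi> L1 L2
  for A :: "('m::t2_space, 'e::euclidean_space) chart set" and n \<eta> \<xi> L1 L2 +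
  fixes c :: real
  assumes c_neq_0: "c \<noteq> 0"
    and definite: "section_of A L1 X \<Longrightarrow> X p \<noteq> 0 \<Longrightarrow> pang_invariant \<eta> \<xi> X X p / c > 0"
    and flat: "flat_foliation A \<eta> \<xi> L2"
begin

lemma psi_definite:
  assumes "section_of A L1 X" "X p \<noteq> 0"
  shows "d (\<psi> X) X p / c > 0"
  using definite[OF assms] by (simp add: pang_eq d_psi_sections assms)

lemma psi_zero_at:
  assumes X: "section_of A L1 X" and "\<psi> X p = 0"
  shows "X p = 0"
proof (rule ccontr)
  assume "X p \<noteq> 0"
  then have "d (\<psi> X) X p \<noteq> 0"
    using psi_definite[OF X] by force
  then show False
    using d_pointwise(2)[of "\<psi> X" X p] assms section_VF[OF X] by simp
qed

lemma psi_inj: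
  assumes "section_of A L1 X" "section_of A L1 Y" "\<psi> X p = \<psi> Y p"
  shows "X p = Y p"
proof -
  have "\<psi> (X - Y) p = 0"
    using assms section_VF by (simp add: endo_tensor_diff[OF psi_endo])
  then have "(X - Y) p = 0"
    using psi_zero_at[OF section_of_diff[OF foliations(1) assms(1,2)]] by simp
  then show ?thesis by simp
qed

text \<open>The images under \<open>\<psi>\<close> of a frame of \<open>L1\<close> are n independent
  sections of \<open>L2\<close>, hence a frame of it near \<open>p\<close>. The coefficients of
  \<open>Y\<close> in the coframe dual to it are smooth, and attached to the original frame they
  give a preimage.\<close>

lemma psi_local_surj:
  assumes Y: "section_of A L2 Y"
  shows "\<exists>Z W. open W \<and> p \<in> W \<and> section_of A L1 Z \<and> (\<forall>q\<in>W. \<psi> Z q = Y q)"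
proof -
  obtain I1 I2 \<alpha> V where V: "open V" "p \<in> V" and ad: "adapted V I1 I2 \<alpha>"
    using adapted_frame[of p] by metis
  have cof: "coframe_on V I1 \<alpha>"
    using adaptedD(9)[OF ad] by (auto simp: coframe_on_def)
  have sec: "section_of A L1 E" "VF E" if "E \<in> I1" for E
    using adaptedD(7)[OF ad that] section_VF by auto
  have inj: "inj_on (\<lambda>E. \<psi> E p) I1"
  proof (rule inj_onI)
    fix E E' assume *: "E \<in> I1" "E' \<in> I1" "\<psi> E p = \<psi> E' p"
    then have "E p = E' p"
      by (intro psi_inj[of E E' p] sec(1))
    then show "E = E'"
      using inj_onD[OF coframe_independent(2)[OF cof V(2)], of E E'] *(1,2) by blast
  qed
  define J where "J = \<psi> ` I1"
  have Jp: "(\<lambda>E. E p) ` J = (\<lambda>E. \<psi> E p) ` I1"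
    by (simp add: J_def image_image)
  have "finite J"
    using adaptedD(1)[OF ad] by (simp add: J_def)
  have injJ: "inj_on (\<lambda>E. E p) J"
    unfolding J_def by (rule inj_on_imageI) (use inj in \<open>simp add: o_def\<close>)
  have inj\<psi>: "inj_on \<psi> I1"
    by (rule inj_on_imageI2[of "\<lambda>E. E p"]) (use inj in \<open>simp add: o_def\<close>)
  then have cardJ: "card J = n"
    using adaptedD(3)[OF ad] by (simp add: J_def card_image)
  have VFJ: "VF E" "section_of A L2 E" if "E \<in> J" for E
    using that sec(2) section_psi section_VF unfolding J_def by blast+
  define S where "S = (\<lambda>E. \<psi> E p) ` I1"
  have S: "finite S" "(\<lambda>E. E p) ` J = S"
    using adaptedD(1)[OF ad] Jp by (simp_all add: S_def)
  \<comment> \<open>A linear relation between the images at \<open>p\<close> is realised by the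
    section \<open>Z\<close> with constant coefficients. Since \<open>\<psi> Z p = 0\<close> forces
    \<open>Z p = 0\<close>, it becomes a relation in the original, independent frame.\<close>
  have coeff: "f x = 0" if sum: "(\<Sum>x\<in>S. tscale (f x) x) = 0" and x: "x \<in> S" for f x
  proof -
    define Z where "Z = (\<Sum>E\<in>I1. f (\<psi> E p) \<cdot> E)"
    have "section_of A L1 Z"
      unfolding Z_def using sec by (intro section_of_sum[OF foliations(1)] section_of_cscale[OF foliations(1)])
    moreover have "\<psi> Z = (\<Sum>E\<in>I1. f (\<psi> E p) \<cdot> \<psi> E)"
      unfolding Z_def using sec
      by (subst endo_tensor_sum[OF psi_endo]) (auto intro!: sum.cong endo_tensor_cscale[OF psi_endo])
    then have "\<psi> Z p = (\<Sum>E\<in>I1. tscale (f (\<psi> E p)) (\<psi> E p))"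
      by simp
    then have "\<psi> Z p = 0"
      using sum unfolding S_def by (simp only: sum.reindex[OF inj] o_def)
    ultimately have "Z p = 0"
      by (rule psi_zero_at)
    then have z: "(\<Sum>E\<in>I1. tscale (f (\<psi> E p)) (E p)) = 0"
      by (simp add: Z_def)
    obtain E where E: "E \<in> I1" "x = \<psi> E p" using x unfolding S_def by blast
    have "f (\<psi> E p) = \<alpha> E p 0"
      using coframe_coeff[OF cof V(2) E(1), of "\<lambda>E. f (\<psi> E p)"] unfolding z by simp
    also have "\<dots> = 0"
      using cof E(1) by (intro covector_field_0) (auto simp: coframe_on_def)
    finally show ?thesis
      by (simp only: E(2))
  qed
  have "tv.independent S"
    using tv.independent_if_scalars_zero[OF S(1)] coeff by blast
  then have indJ: "tv.independent ((\<lambda>E. E p) ` J)"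
    unfolding S(2) .
  have "\<exists>\<beta> V'. open V' \<and> p \<in> V' \<and> coframe_on V' J \<beta>"
    by (rule dual_coframe_exists[OF \<open>finite J\<close> VFJ(1) indJ injJ])
  then obtain \<beta> V' where V': "open V'" "p \<in> V'" "coframe_on V' J \<beta>"
    by (elim exE conjE)
  define Z where "Z = (\<Sum>E\<in>I1. (\<lambda>q. \<beta> (\<psi> E) q (Y q)) \<odot> E)"
  have sm: "SF (\<lambda>q. \<beta> (\<psi> E) q (Y q))" if "E \<in> I1" for E
    using V'(3) that section_VF[OF Y] by (auto simp: coframe_on_def covector_field_def J_def)
  have "section_of A L1 Z"
    unfolding Z_def using sec sm by (intro section_of_sum[OF foliations(1)] section_of_fscale[OF foliations(1)])
  moreover have "\<psi> Z q = Y q" if q: "q \<in> V \<inter> V'" for q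
  proof -
    have q': "q \<in> V" "q \<in> V'" using q by auto
    \<comment> \<open>At nearby points independence comes from the coframe \<open>\<beta>\<close>;
      being as many as the spanning set from \<open>I2\<close>, the images then span
      \<open>L2 q\<close>.\<close>
    have ind: "tv.independent ((\<lambda>E. E q) ` J)" "inj_on (\<lambda>E. E q) J"
      using coframe_independent[OF V'(3) q'(2)] by auto
    have "(\<lambda>E. E q) ` J \<subseteq> tv.span ((\<lambda>E. E q) ` I2)"
      using VFJ(2) adaptedD(12)[OF ad q'(1)] by (auto simp: section_of_def)
    moreover have "card ((\<lambda>E. E q) ` I2) \<le> card ((\<lambda>E. E q) ` J)"
      using card_image[OF ind(2)] cardJ card_image_le[OF adaptedD(2)[OF ad], of "\<lambda>E. E q"] adaptedD(4)[OF ad]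
      by simp
    ultimately have "tv.span ((\<lambda>E. E q) ` I2) \<subseteq> tv.span ((\<lambda>E. E q) ` J)"
      using tv.span_independent_card(1)[OF finite_imageI[OF adaptedD(2)[OF ad]] ind(1)] by blast
    then have "Y q \<in> tv.span ((\<lambda>E. E q) ` J)"
      using Y adaptedD(12)[OF ad q'(1)] by (auto simp: section_of_def)
    then have "Y q = (\<Sum>E\<in>J. tscale (\<beta> E q (Y q)) (E q))"
      by (rule coframe_expand[OF V'(3) q'(2)])
    also have "\<dots> = (\<Sum>E\<in>I1. tscale (\<beta> (\<psi> E) q (Y q)) (\<psi> E q))"
      unfolding J_def by (simp only: sum.reindex[OF inj\<psi>] o_def)
    also have "\<dots> = (\<Sum>E\<in>I1. (\<lambda>q. \<beta> (\<psi> E) q (Y q)) \<odot> \<psi> E) q"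
      by simp
    also have "(\<Sum>E\<in>I1. (\<lambda>q. \<beta> (\<psi> E) q (Y q)) \<odot> \<psi> E) = \<psi> Z"
      unfolding Z_def using sec sm
      by (subst endo_tensor_sum[OF psi_endo]) (auto intro!: sum.cong endo_tensorD(3)[OF psi_endo, symmetric])
    finally show ?thesis by (rule sym)
  qed
  ultimately show ?thesis
    using V V' by (intro exI[of _ Z] exI[of _ "V \<inter> V'"]) auto
qed

text \<open>Pointwise injectivity makes local preimages agree where they overlap, so the diagonal
  \<open>Z p p\<close> glues them to a smooth field.\<close>

lemma psi_surj:
  assumes Y: "section_of A L2 Y"
  shows "\<exists>Z. section_of A L1 Z \<and> \<psi> Z = Y"
proof -
  obtain Z W where ZW: "\<And>p. open (W p)" "\<And>p. p \<in> W p" "\<And>p. section_of A L1 (Z p)"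
    "\<And>p q. q \<in> W p \<Longrightarrow> \<psi> (Z p) q = Y q"
    using psi_local_surj[OF Y] by metis
  define X where "X = (\<lambda>p. Z p p)"
  have eq: "X q = Z p q" if "q \<in> W p" for p q
    unfolding X_def using ZW(2-4) ZW(4)[OF that]
    by (intro psi_inj[of "Z q" "Z p" q]) auto
  have "VF X"
  proof (rule vector_field_local)
    show "\<exists>V Y. open V \<and> p \<in> V \<and> VF Y \<and> (\<forall>q\<in>V. X q = Y q)" for p
      using ZW(1,2) section_VF[OF ZW(3)] eq by metis
  qed
  then have X: "section_of A L1 X"
    using ZW(3) by (simp add: section_of_def X_def)
  \<comment> \<open>\<open>\<psi>\<close> takes whole fields as arguments. That \<open>X\<close> and
    \<open>Z p\<close> agree at \<open>p\<close> passes to their images by tensoriality.\<close>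
  have "\<psi> X p = Y p" for p
  proof -
    have "\<psi> (X - Z p) p = 0"
      using \<open>VF X\<close> section_VF[OF ZW(3)] by (intro endo_pointwise[OF psi_endo]) (simp_all add: X_def)
    then show ?thesis
      using ZW(2) ZW(4)[of p p] \<open>VF X\<close> section_VF[OF ZW(3)] by (simp add: endo_tensor_diff[OF psi_endo])
  qed
  with X show ?thesis by blast
qed

text \<open>The inverse of the isomorphism of \<open>L1\<close> onto \<open>L2\<close> induced by
  \<open>\<psi>\<close>, extended by 0 to \<open>L1\<close> and \<open>\<xi>\<close>. Injectivity
  makes the choice unique, which is how its tensoriality is obtained.\<close>

definition \<rho> :: "'m vfield \<Rightarrow> 'm vfield" where
  "\<rho> Y = (SOME Z. section_of A L1 Z \<and> \<psi> Z = P2 Y)"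

lemma
  assumes "VF Y"
  shows section_rho: "section_of A L1 (\<rho> Y)" and psi_rho: "\<psi> (\<rho> Y) = P2 Y"
proof -
  have "section_of A L1 (\<rho> Y) \<and> \<psi> (\<rho> Y) = P2 Y"
    unfolding \<rho>_def by (rule someI_ex[OF psi_surj[OF section_P2[OF assms]]])
  then show "section_of A L1 (\<rho> Y)" "\<psi> (\<rho> Y) = P2 Y" by auto
qed

lemma rho_eqI:
  assumes "VF Y" "section_of A L1 Z" "\<psi> Z = P2 Y"
  shows "\<rho> Y = Z"
proof
  show "\<rho> Y p = Z p" for p
    using assms by (intro psi_inj[of "\<rho> Y" Z p] section_rho) (simp_all add: psi_rho)
qed

lemma VF_rho [simp]: "VF X \<Longrightarrow> VF (\<rho> X)"
  using section_rho section_VF by blast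

lemma rho_endo: "endo_tensor A \<rho>"
  unfolding endo_tensor_def
proof (intro conjI allI impI)
  show "VF (\<rho> X)" if "VF X" for X
    using that by simp
  show "\<rho> (X + Y) = \<rho> X + \<rho> Y" if "VF X \<and> VF Y" for X Y
    using that
    by (intro rho_eqI section_of_add[OF foliations(1)] section_rho)
       (simp_all add: endo_tensorD[OF psi_endo] psi_rho endo_tensorD[OF P2_endo])
  show "\<rho> (f \<odot> X) = f \<odot> \<rho> X" if "SF f \<and> VF X" for f X
    using that
    by (intro rho_eqI section_of_fscale[OF foliations(1)] section_rho)
       (simp_all add: endo_tensorD[OF psi_endo] psi_rho endo_tensorD[OF P2_endo])
qed

end

section \<open>The bi-Legendrian connection\<close>

context definite_flat
begin

lemma psi_0 [simp]: "\<psi> 0 = 0" and rho_0 [simp]: "\<rho> 0 = 0"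
  by (rule endo_tensor_0[OF psi_endo], rule endo_tensor_0[OF rho_endo])

lemma P2_0 [simp]: "P2 0 = 0"
  by (rule endo_tensor_0[OF P2_endo])

text \<open>The product of any two of the four operators is one of them or 0. As rewrite rules these
  facts reduce the tensor identities below to scalar algebra.\<close>

lemma operator_table [simp]:
  assumes "VF X"
  shows "P1 (P1 X) = P1 X" "P1 (P2 X) = 0" "P2 (P1 X) = 0" "P2 (P2 X) = P2 X"
    "P1 (\<psi> X) = 0" "P2 (\<psi> X) = \<psi> X" "\<psi> (P1 X) = \<psi> X" "\<psi> (P2 X) = 0"
    "P1 (\<rho> X) = \<rho> X" "P2 (\<rho> X) = 0" "\<rho> (P1 X) = 0" "\<rho> (P2 X) = \<rho> X"
    "\<psi> (\<psi> X) = 0" "\<rho> (\<rho> X) = 0" "\<psi> (\<rho> X) = P2 X" "\<rho> (\<psi> X) = P1 X"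
proof -
  show P: "P1 (P1 X) = P1 X" "P1 (P2 X) = 0" "P2 (P1 X) = 0" "P2 (P2 X) = P2 X"
    "P1 (\<psi> X) = 0" "P2 (\<psi> X) = \<psi> X" "P1 (\<rho> X) = \<rho> X" "P2 (\<rho> X) = 0"
    by (intro P1_section1 P1_section2 P2_section1 P2_section2 section_P1 section_P2 section_psi section_rho assms)+
  show p: "\<psi> (P1 X) = \<psi> X"
    by (rule psi_P1[OF assms])
  show "\<psi> (P2 X) = 0"
    using psi_P1[of "P2 X"] assms P(2) by simp
  show "\<psi> (\<psi> X) = 0"
    using psi_P1[of "\<psi> X"] assms P(5) by simp
  show "\<psi> (\<rho> X) = P2 X"
    by (rule psi_rho[OF assms])
  show "\<rho> (P1 X) = 0" "\<rho> (\<rho> X) = 0"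
    using assms P by (auto intro!: rho_eqI section_of_0[OF foliations(1)])
  show "\<rho> (P2 X) = \<rho> X" "\<rho> (\<psi> X) = P1 X"
    using assms P p by (auto intro!: rho_eqI section_rho section_P1 simp: psi_rho)
qed

lemma operator_xi [simp]: "P1 \<xi> = 0" "P2 \<xi> = 0" "\<psi> \<xi> = 0" "\<rho> \<xi> = 0"
proof -
  show P: "P1 \<xi> = 0" "P2 \<xi> = 0"
    by (rule P1_xi P2_xi)+
  show "\<psi> \<xi> = 0"
    using psi_P1[of \<xi>] P by simp
  show "\<rho> \<xi> = 0"
    using P by (auto intro!: rho_eqI section_of_0[OF foliations(1)])
qed

lemma eta_operator [simp]: "VF X \<Longrightarrow> \<eta> (P1 X) = 0" "VF X \<Longrightarrow> \<eta> (P2 X) = 0" "VF X \<Longrightarrow> \<eta> (\<psi> X) = 0" "VF X \<Longrightarrow> \<eta> (\<rho> X) = 0"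
  using eta_section1 eta_section2 section_P1 section_P2 section_psi section_rho by auto

lemma psi_zeroI:
  assumes "section_of A L1 X" "\<And>p. d (\<psi> X) X p = 0"
  shows "X = 0"
proof
  show "X p = 0 p" for p
    using psi_definite[OF assms(1), of p] assms(2)[of p] by (cases "X p = 0") auto
qed

text \<open>Nondegeneracy of \<open>d\<close> between \<open>L1\<close> and \<open>L2\<close>, drawn
  from definiteness: the section \<open>\<psi> X\<close> of \<open>L2\<close> is already a
  sufficient test for \<open>X\<close>.\<close>

lemma section1_zeroI:
  assumes X: "section_of A L1 X" and "\<And>Y p. section_of A L2 Y \<Longrightarrow> d X Y p = 0"
  shows "X = 0"
proof (rule psi_zeroI[OF X])
  have V: "VF X" "VF (\<psi> X)" using section_VF[OF X] by auto
  show "d (\<psi> X) X p = 0" for p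
    using assms(2)[OF section_psi[OF V(1)], of p] d_skew[OF V(2,1)] by simp
qed

lemma section2_zeroI:
  assumes Y: "section_of A L2 Y" and "\<And>X p. section_of A L1 X \<Longrightarrow> d Y X p = 0"
  shows "Y = 0"
proof -
  have V: "VF Y" using section_VF[OF Y] .
  have eq: "\<psi> (\<rho> Y) = Y"
    using V P2_section2[OF Y] by simp
  have "\<rho> Y = 0"
    using assms(2)[OF section_rho[OF V]] eq by (intro psi_zeroI section_rho V) simp
  then show ?thesis
    using eq by simp
qed

text \<open>Flatness says that the bracket pairs to 0 under \<open>d\<close> with every section of
  \<open>L2\<close>. The pairing sees only its \<open>L1\<close> part, and nondegeneracy removes
  that.\<close>

lemma P1_bracket_xi:
  assumes Y: "section_of A L2 Y"
  shows "P1 (bracket \<xi> Y) = 0"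
proof (rule section1_zeroI)
  have V: "VF Y" using section_VF[OF Y] .
  then show "section_of A L1 (P1 (bracket \<xi> Y))"
    by (intro section_P1) simp
  fix Z p assume Z: "section_of A L2 Z"
  have "pang_invariant \<eta> \<xi> Y Z = 0"
    using flat Y Z by (auto simp: flat_foliation_def)
  then have "d (bracket \<xi> Y) Z p = 0"
    using pang_eq2[OF Y Z, of p] by simp
  then show "d (P1 (bracket \<xi> Y)) Z p = 0"
    using d_split[of "bracket \<xi> Y" Z p] V section_VF[OF Z] P1_section2[OF Z] P2_section2[OF Z]
      d_zero_right[of "P2 (bracket \<xi> Y)" p] by simp
qed

text \<open>The symmetry of \<open>\<psi>\<close> passes to its inverse: the \<open>L2\<close> part
  of the second argument is written as the image of a section of \<open>L1\<close>.\<close>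

lemma rho_sym:
  assumes "VF X" "VF Y"
  shows "d (\<rho> X) Y p = d (\<rho> Y) X p"
proof -
  have e: "d (\<rho> U) W p = d (\<rho> U) (\<psi> (\<rho> W)) p" if "VF U" "VF W" for U W
    using d_split[of "\<rho> U" W p] d_zero_left[of "P1 W" p] that by simp
  have "d (\<rho> X) Y p = - d (\<psi> (\<rho> Y)) (\<rho> X) p"
    using e[OF assms] assms d_skew[of "\<rho> X" "\<psi> (\<rho> Y)"] by simp
  also have "\<dots> = - d (\<psi> (\<rho> X)) (\<rho> Y) p"
    using psi_sym[of "\<rho> Y" "\<rho> X" p] assms by simp
  also have "\<dots> = d (\<rho> Y) X p"
    using e[OF assms(2,1)] assms d_skew[of "\<rho> Y" "\<psi> (\<rho> X)"] by simp
  finally show ?thesis .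
qed

end

locale parallel_definite_flat = definite_flat A n \<eta> \<xi> L1 L2 c
  for A :: "('m::t2_space, 'e::euclidean_space) chart set" and n \<eta> \<xi> L1 L2 c +
  fixes D :: "'m vfield \<Rightarrow> 'm vfield \<Rightarrow> 'm vfield"
  assumes conn: "bi_legendrian_connection A \<eta> \<xi> L1 L2 D"
    and parallel: "pang_parallel A \<eta> \<xi> L1 D"
begin

lemma D_linear: "linear_connection A D"
  using conn by (simp add: bi_legendrian_connection_def)

lemma D_left: "VF Y \<Longrightarrow> endo_tensor A (\<lambda>X. D X Y)"
  using D_linear by (simp add: linear_connection_def)

lemma VF_D [simp]: "VF X \<Longrightarrow> VF Y \<Longrightarrow> VF (D X Y)"
  using endo_tensorD(1)[OF D_left] by blast

lemma D_right:
  "VF X \<Longrightarrow> VF Y \<Longrightarrow> VF Z \<Longrightarrow> D X (Y + Z) = D X Y + D X Z"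
  "SF f \<Longrightarrow> VF X \<Longrightarrow> VF Y \<Longrightarrow> D X (f \<odot> Y) = vfield_apply X f \<odot> Y + f \<odot> D X Y"
  using D_linear by (auto simp: linear_connection_def)

lemma D_cscale: "VF X \<Longrightarrow> VF Y \<Longrightarrow> D X (a \<cdot> Y) = a \<cdot> D X Y"
  using D_right(2)[OF smooth_fun_const[of a]] tangent_const[OF vector_field_tangent, of X _ a]
  by (auto simp: cscale_def fscale_def vfield_apply_def fun_eq_iff)

lemma D_sections:
  "VF X \<Longrightarrow> section_of A L1 Y \<Longrightarrow> section_of A L1 (D X Y)"
  "VF X \<Longrightarrow> section_of A L2 Y \<Longrightarrow> section_of A L2 (D X Y)"
  using conn unfolding bi_legendrian_connection_def by blast+

lemma D_xi: "VF X \<Longrightarrow> D X \<xi> = 0"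
  using conn unfolding bi_legendrian_connection_def by blast+

lemma D_d:
  assumes "VF X" "VF Y" "VF Z"
  shows "vfield_apply Z (d X Y) p = d (D Z X) Y p + d X (D Z Y) p"
proof -
  have "vfield_apply Z (d X Y) = d (D Z X) Y + d X (D Z Y)"
    using conn assms unfolding bi_legendrian_connection_def by blast
  from fun_cong[OF this, of p] show ?thesis by simp
qed

lemma torsion_L1_L2: "section_of A L1 X \<Longrightarrow> section_of A L2 Y \<Longrightarrow> torsion D X Y = (\<lambda>p. 2 * d X Y p) \<odot> \<xi>"
  using conn unfolding bi_legendrian_connection_def by blast+

lemma torsion_xi:
  assumes "VF X"
  shows "torsion D X \<xi> = \<psi> X"
proof -
  have "torsion D X \<xi> = P2 (bracket \<xi> (P1 X)) + P1 (bracket \<xi> (P2 X))"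
    using conn assms unfolding bi_legendrian_connection_def by blast
  then show ?thesis
    using P1_bracket_xi[OF section_P2[OF assms]] by (simp add: \<psi>_def)
qed

lemma bracket_xi:
  assumes "VF X"
  shows "bracket \<xi> X = D \<xi> X + \<psi> X"
proof (intro ext)
  fix p u
  have "torsion D X \<xi> p u = \<psi> X p u"
    using torsion_xi[OF assms] by simp
  then show "bracket \<xi> X p u = (D \<xi> X + \<psi> X) p u"
    by (simp add: torsion_def D_xi[OF assms] bracket_antisym[of X \<xi>])
qed

lemma D_split:
  assumes "VF X" "VF Y"
  shows "D X Y = D X (P1 Y) + D X (P2 Y) + vfield_apply X (\<eta> Y) \<odot> \<xi>"
proof -
  have s: "SF (\<eta> Y)" using one_formD(1)[OF form assms(2)] .
  have "D X Y = D X (P1 Y + P2 Y + \<eta> Y \<odot> \<xi>)"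
    using field_split[OF assms(2)] by (rule arg_cong)
  also have "\<dots> = D X (P1 Y) + D X (P2 Y) + (vfield_apply X (\<eta> Y) \<odot> \<xi> + \<eta> Y \<odot> 0)"
    using assms s D_xi[OF assms(1)] by (simp only: D_right vector_field_add vector_field_fscale VF_P1 VF_P2 VF_xi)
  finally show ?thesis
    by (simp add: fscale_def fun_eq_iff)
qed

lemma D_P1: "VF X \<Longrightarrow> VF Y \<Longrightarrow> P1 (D X Y) = D X (P1 Y)"
  by (rule P1_eqI[OF D_sections(1)[OF _ section_P1] D_sections(2)[OF _ section_P2] D_split])

lemma D_P2:
  assumes "VF X" "VF Y"
  shows "P2 (D X Y) = D X (P2 Y)"
proof (rule bi_legendrian.P1_eqI[OF bi_legendrian_swap])
  show "section_of A L2 (D X (P2 Y))" "section_of A L1 (D X (P1 Y))"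
    using D_sections section_P1 section_P2 assms by auto
  show "D X Y = D X (P2 Y) + D X (P1 Y) + vfield_apply X (\<eta> Y) \<odot> \<xi>"
    using D_split[OF assms] by (simp add: add.commute)
qed

lemma eta_D:
  assumes "VF X" "VF Y"
  shows "\<eta> (D X Y) = vfield_apply X (\<eta> Y)"
proof -
  have s: "SF (vfield_apply X (\<eta> Y))" using one_formD(1)[OF form] assms by simp
  have z: "\<eta> (D X (P1 Y)) = 0" "\<eta> (D X (P2 Y)) = 0"
    using eta_section1[OF D_sections(1)] eta_section2[OF D_sections(2)] section_P1 section_P2 assms by auto
  have "\<eta> (D X Y) = \<eta> (D X (P1 Y) + D X (P2 Y) + vfield_apply X (\<eta> Y) \<odot> \<xi>)"
    using D_split[OF assms] by (rule arg_cong)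
  also have "\<dots> = vfield_apply X (\<eta> Y)"
    using assms s z by (simp add: one_formD[OF form] eta_xi)
  finally show ?thesis .
qed

text \<open>Differentiating the Pang form both by parallelism and as 2 d(\<psi> X, Y) leaves the
  covariant derivative of \<open>\<psi>\<close> paired with an arbitrary section of
  \<open>L1\<close>; nondegeneracy of \<open>d\<close> removes the pairing.\<close>

lemma D_psi_section:
  assumes Z: "VF Z" and X: "section_of A L1 X"
  shows "D Z (\<psi> X) = \<psi> (D Z X)"
proof -
  have V: "VF X" using section_VF[OF X] .
  have "D Z (\<psi> X) - \<psi> (D Z X) = 0"
  proof (rule section2_zeroI)
    show "section_of A L2 (D Z (\<psi> X) - \<psi> (D Z X))"
      using Z V by (intro section_of_diff[OF foliations(2)] D_sections section_psi VF_D)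
    fix Y p assume Y: "section_of A L1 Y"
    have W: "VF Y" using section_VF[OF Y] .
    have e: "pang_invariant \<eta> \<xi> U U' p = 2 * d (\<psi> U) U' p" if "section_of A L1 U" "section_of A L1 U'" for U U' p
      using that by (simp add: pang_eq d_psi_sections)
    have fe: "pang_invariant \<eta> \<xi> X Y = (\<lambda>p. 2 * d (\<psi> X) Y p)"
      using e[OF X Y] by auto
    have "vfield_apply Z (pang_invariant \<eta> \<xi> X Y) p
        = pang_invariant \<eta> \<xi> (D Z X) Y p + pang_invariant \<eta> \<xi> X (D Z Y) p"
      using parallel Z X Y by (simp add: pang_parallel_def)
    also have "\<dots> = 2 * d (\<psi> (D Z X)) Y p + 2 * d (\<psi> X) (D Z Y) p"
      using D_sections(1)[OF Z X] D_sections(1)[OF Z Y] by (simp add: e X Y)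
    finally have "vfield_apply Z (pang_invariant \<eta> \<xi> X Y) p
        = 2 * d (\<psi> (D Z X)) Y p + 2 * d (\<psi> X) (D Z Y) p" .
    moreover have "vfield_apply Z (pang_invariant \<eta> \<xi> X Y) p = 2 * vfield_apply Z (d (\<psi> X) Y) p"
      unfolding fe using tangent_scale[OF vector_field_tangent[OF Z] one_formD(1)[OF d_form]] V W
      by (simp add: vfield_apply_def)
    ultimately have "d (D Z (\<psi> X)) Y p = d (\<psi> (D Z X)) Y p"
      using D_d[of "\<psi> X" Y Z p] V W Z by simp
    then show "d (D Z (\<psi> X) - \<psi> (D Z X)) Y p = 0"
      using V W Z by (simp add: d_left)
  qed
  then show ?thesis by simp
qed

lemma D_psi:
  assumes "VF Z" "VF X"
  shows "D Z (\<psi> X) = \<psi> (D Z X)"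
proof -
  have "D Z (\<psi> X) = \<psi> (D Z (P1 X))"
    using D_psi_section[OF assms(1) section_P1[OF assms(2)]] assms by simp
  also have "\<dots> = \<psi> (D Z X)"
    using D_P1[OF assms] psi_P1[of "D Z X"] assms by simp
  finally show ?thesis .
qed

lemma D_rho:
  assumes "VF Z" "VF X"
  shows "D Z (\<rho> X) = \<rho> (D Z X)"
proof (rule sym, rule rho_eqI)
  show "section_of A L1 (D Z (\<rho> X))"
    using assms by (intro D_sections section_rho)
  show "\<psi> (D Z (\<rho> X)) = P2 (D Z X)"
    using D_psi[of Z "\<rho> X"] D_P2[of Z X] assms by simp
qed (use assms in simp)

section \<open>Full torsion of the bi-Legendrian connection\<close>

lemma torsion_skew: "torsion D X Y = - torsion D Y X"
  by (simp add: torsion_def bracket_antisym[of X Y])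

lemma torsion_endo:
  assumes X: "VF X"
  shows "endo_tensor A (torsion D X)"
  unfolding endo_tensor_def
proof (intro conjI allI impI)
  show "VF (torsion D X Y)" if "VF Y" for Y
    using that X by (simp add: torsion_def)
  show "torsion D X (Y + Z) = torsion D X Y + torsion D X Z" if "VF Y \<and> VF Z" for Y Z
    using that X by (simp add: torsion_def D_right bracket_add_right endo_tensorD(2)[OF D_left])
  show "torsion D X (f \<odot> Y) = f \<odot> torsion D X Y" if "SF f \<and> VF Y" for f Y
    using that X endo_tensorD(3)[OF D_left[OF X], of f Y]
    by (simp add: torsion_def D_right bracket_fscale_right) (simp add: fscale_def fun_eq_iff algebra_simps)
qed

text \<open>In the closedness identity the derivatives of \<open>d\<close> are expanded by
  parallelism; together with the brackets they assemble into torsions.\<close>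

lemma d_torsion_cyclic:
  assumes "VF X" "VF Y" "VF Z"
  shows "d (torsion D X Y) Z p + d (torsion D Y Z) X p + d (torsion D Z X) Y p = 0"
proof -
  have "vfield_apply X (d Y Z) p + vfield_apply Y (d Z X) p + vfield_apply Z (d X Y) p
     - d (bracket X Y) Z p - d (bracket Y Z) X p - d (bracket Z X) Y p = 0"
    using fun_cong[OF ext_d_closed[OF form assms], of p] by simp
  moreover have "d Y (D X Z) p = - d (D X Z) Y p" "d Z (D Y X) p = - d (D Y X) Z p" "d X (D Z Y) p = - d (D Z Y) X p"
    using assms d_skew[of Y "D X Z"] d_skew[of Z "D Y X"] d_skew[of X "D Z Y"] by simp_all
  ultimately show ?thesis
    using assms by (simp add: torsion_def d_left D_d)
qed

text \<open>The axioms of the connection prescribe only mixed torsion and torsion with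
  \<open>\<xi>\<close>. In the cyclic identity with a third argument from \<open>L2\<close> the
  mixed terms are multiples of \<open>\<xi>\<close>, which \<open>d\<close> kills, so the remaining
  term pairs to 0.\<close>

lemma torsion_L1_L1:
  assumes X: "section_of A L1 X" and Y: "section_of A L1 Y"
  shows "torsion D X Y = 0"
proof (rule section1_zeroI)
  have V: "VF X" "VF Y" using X Y section_VF by auto
  show "section_of A L1 (torsion D X Y)"
    unfolding torsion_def using X Y V
    by (intro section_of_diff[OF foliations(1)] D_sections(1) involutive)
  fix Z p assume Z: "section_of A L2 Z"
  have W: "VF Z" using section_VF[OF Z] .
  have "d (torsion D U Z) U' p = 0" if "section_of A L1 U" "section_of A L1 U'" for U U'
  proof -
    have "SF ((\<lambda>_. 2) * d U Z)"
      using one_formD(1)[OF d_form] section_VF[OF that(1)] W by (intro smooth_fun_mult smooth_fun_const) auto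
    then have "SF (\<lambda>p. 2 * d U Z p)"
      by (simp add: times_fun_def)
    then show ?thesis
      using torsion_L1_L2[OF that(1) Z] section_VF[OF that(2)] by (simp add: d_left d_xi)
  qed
  from this[OF Y X] this[OF X Y] d_torsion_cyclic[OF V W, of p]
  show "d (torsion D X Y) Z p = 0"
    using V W endo_tensorD(1)[OF torsion_endo[OF V(1)] W] by (simp add: torsion_skew[of Z X] d_left)
qed

lemma torsion_L2_L2:
  assumes X: "section_of A L2 X" and Y: "section_of A L2 Y"
  shows "torsion D X Y = 0"
proof (rule section2_zeroI)
  have V: "VF X" "VF Y" using X Y section_VF by auto
  show "section_of A L2 (torsion D X Y)"
    unfolding torsion_def using X Y V
    by (intro section_of_diff[OF foliations(2)] D_sections(2) bi_legendrian.involutive[OF bi_legendrian_swap])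
  fix Z p assume Z: "section_of A L1 Z"
  have W: "VF Z" using section_VF[OF Z] .
  have "d (torsion D Z U) U' p = 0" if "section_of A L2 U" "section_of A L2 U'" for U U'
  proof -
    have "SF ((\<lambda>_. 2) * d Z U)"
      using one_formD(1)[OF d_form] section_VF[OF that(1)] W by (intro smooth_fun_mult smooth_fun_const) auto
    then have "SF (\<lambda>p. 2 * d Z U p)"
      by (simp add: times_fun_def)
    then show ?thesis
      using torsion_L1_L2[OF Z that(1)] section_VF[OF that(2)] by (simp add: d_left d_xi)
  qed
  from this[OF Y X] this[OF X Y] d_torsion_cyclic[OF V W, of p]
  show "d (torsion D X Y) Z p = 0"
    using V W endo_tensorD(1)[OF torsion_endo[OF W] V(2)] by (simp add: torsion_skew[of Y Z] d_left)
qed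

lemma torsion_eq:
  assumes X: "VF X" and Y: "VF Y"
  shows "torsion D X Y p u = 2 * d X Y p * \<xi> p u + \<eta> Y p * \<psi> X p u - \<eta> X p * \<psi> Y p u"
proof -
  have s: "SF (\<eta> Z)" if "VF Z" for Z using one_formD(1)[OF form that] .
  have right: "torsion D U Z p u = torsion D U (P1 Z) p u + torsion D U (P2 Z) p u + \<eta> Z p * \<psi> U p u"
    if "VF U" "VF Z" for U Z
  proof -
    have "torsion D U Z = torsion D U (P1 Z + P2 Z + \<eta> Z \<odot> \<xi>)"
      using field_split[OF that(2)] by (rule arg_cong)
    also have "\<dots> = torsion D U (P1 Z) + torsion D U (P2 Z) + \<eta> Z \<odot> \<psi> U"
      using that s torsion_xi[OF that(1)]
      by (simp only: endo_tensorD[OF torsion_endo[OF that(1)]] vector_field_add vector_field_fscale VF_P1 VF_P2 VF_xi)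
    finally show ?thesis
      by (simp add: fscale_def)
  qed
  have left: "torsion D U Z p u = torsion D (P1 U) Z p u + torsion D (P2 U) Z p u - \<eta> U p * \<psi> Z p u"
    if "VF U" "VF Z" for U Z
    using right[OF that(2,1)] torsion_skew[of U Z] torsion_skew[of "P1 U" Z] torsion_skew[of "P2 U" Z] by simp
  have sec: "section_of A L1 (P1 X)" "section_of A L2 (P2 X)" "section_of A L1 (P1 Y)" "section_of A L2 (P2 Y)"
    using X Y section_P1 section_P2 by auto
  have "torsion D (P1 X) (P2 Y) p u = 2 * d (P1 X) (P2 Y) p * \<xi> p u"
    using torsion_L1_L2[OF sec(1,4)] by (simp add: fscale_def)
  moreover have "torsion D (P2 X) (P1 Y) p u = 2 * d (P2 X) (P1 Y) p * \<xi> p u"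
    using torsion_L1_L2[OF sec(3,2)] torsion_skew[of "P2 X" "P1 Y"] d_skew[of "P2 X" "P1 Y"] X Y
    by (simp add: fscale_def)
  ultimately show ?thesis
    using right[OF X Y] left[of X "P1 Y"] left[of X "P2 Y"] X Y d_split[OF X Y, of p]
      torsion_L1_L1[OF sec(1,3)] torsion_L2_L2[OF sec(2,4)] by (simp add: algebra_simps)
qed

end

section \<open>The contact metric structure and its Levi-Civita connection\<close>

context definite_flat
begin

text \<open>The eigenvalue c/4 of h on \<open>L1\<close> dictates the first coefficient; the second
  makes \<phi>^2 equal to -I on both subbundles.\<close>

definition \<phi> :: "'m vfield \<Rightarrow> 'm vfield" where
  "\<phi> X = (2 / c) \<cdot> \<psi> X - (c / 2) \<cdot> \<rho> X"

text \<open>Compatibility leaves no choice: replacing Y by \<phi> Y in d(X, Y) = g(X, \<phi> Y)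
  gives g(X, Y) = - d(X, \<phi> Y) + \<eta>(X) \<eta>(Y), and \<phi> moves to the other side with a
  sign.\<close>

definition g :: "'m vfield \<Rightarrow> 'm vfield \<Rightarrow> 'm \<Rightarrow> real" where
  "g X Y = d (\<phi> X) Y + \<eta> X * \<eta> Y"

lemmas operator_linear = endo_tensorD(2,3)[OF psi_endo] endo_tensorD(2,3)[OF rho_endo]
  endo_tensorD(2,3)[OF P1_endo] endo_tensorD(2,3)[OF P2_endo]
  endo_tensor_diff[OF psi_endo] endo_tensor_diff[OF rho_endo] endo_tensor_diff[OF P1_endo] endo_tensor_diff[OF P2_endo]
  endo_tensor_cscale[OF psi_endo] endo_tensor_cscale[OF rho_endo]
  endo_tensor_cscale[OF P1_endo] endo_tensor_cscale[OF P2_endo]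

lemma SF_eta [simp]: "VF X \<Longrightarrow> SF (\<eta> X)"
  by (rule one_formD(1)[OF form])

lemma VF_phi [simp]: "VF X \<Longrightarrow> VF (\<phi> X)"
  by (simp add: \<phi>_def)

lemma phi_apply: "\<phi> X p u = 2 / c * \<psi> X p u - c / 2 * \<rho> X p u"
  by (simp add: \<phi>_def)

lemma phi_endo: "endo_tensor A \<phi>"
  unfolding endo_tensor_def
proof (intro conjI allI impI)
  show "\<phi> (X + Y) = \<phi> X + \<phi> Y" if "VF X \<and> VF Y" for X Y
    using that by (intro ext) (simp add: phi_apply operator_linear algebra_simps)
  show "\<phi> (f \<odot> X) = f \<odot> \<phi> X" if "SF f \<and> VF X" for f X
    using that by (intro ext) (simp add: phi_apply operator_linear algebra_simps)
qed simp

lemma psi_phi: "VF X \<Longrightarrow> \<psi> (\<phi> X) = (- (c / 2)) \<cdot> P2 X"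
  and rho_phi: "VF X \<Longrightarrow> \<rho> (\<phi> X) = (2 / c) \<cdot> P1 X"
  by (intro ext, simp add: \<phi>_def operator_linear)+

lemma phi_psi: "VF X \<Longrightarrow> \<phi> (\<psi> X) = (- (c / 2)) \<cdot> P1 X"
  and phi_rho: "VF X \<Longrightarrow> \<phi> (\<rho> X) = (2 / c) \<cdot> P2 X"
  by (intro ext, simp add: \<phi>_def)+

lemma phi_phi:
  assumes "VF X"
  shows "\<phi> (\<phi> X) = - X + \<eta> X \<odot> \<xi>"
proof (intro ext)
  fix p u
  have "\<phi> (\<phi> X) p u = - P2 X p u - P1 X p u"
    using assms c_neq_0 by (simp add: phi_apply psi_phi rho_phi)
  then show "\<phi> (\<phi> X) p u = (- X + \<eta> X \<odot> \<xi>) p u"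
    using field_split_at[OF assms, of p u] by simp
qed

lemma eta_phi: "VF X \<Longrightarrow> \<eta> (\<phi> X) = 0"
  by (intro ext) (simp add: \<phi>_def one_form_diff[OF form] one_form_cscale[OF form])

lemma phi_xi: "\<phi> \<xi> = 0"
  by (intro ext) (simp add: phi_apply)

lemma d_phi_left: "VF X \<Longrightarrow> VF Y \<Longrightarrow> d (\<phi> X) Y p = 2 / c * d (\<psi> X) Y p - c / 2 * d (\<rho> X) Y p"
  by (simp add: \<phi>_def d_left)

lemma d_phi_sym: "VF X \<Longrightarrow> VF Y \<Longrightarrow> d (\<phi> X) Y p = d (\<phi> Y) X p"
  by (simp add: d_phi_left psi_sym[of X Y] rho_sym[of X Y])

lemma d_phi_phi:
  assumes "VF X" "VF Y"
  shows "d (\<phi> (\<phi> X)) Y p = - d X Y p"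
  using assms by (simp add: phi_phi d_left d_xi)

lemma d_phi_right: "VF X \<Longrightarrow> VF Y \<Longrightarrow> d X (\<phi> Y) p = - d (\<phi> X) Y p"
  using d_skew[of X "\<phi> Y"] d_phi_sym[of X Y p] by simp

lemma g_apply: "g X Y p = d (\<phi> X) Y p + \<eta> X p * \<eta> Y p"
  by (simp add: g_def)

lemma g_sym: "VF X \<Longrightarrow> VF Y \<Longrightarrow> g X Y p = g Y X p"
  by (simp add: g_apply d_phi_sym[of X Y] mult.commute)

lemma g_form:
  assumes "VF X"
  shows "one_form A (g X)"
  unfolding one_form_def
proof (intro conjI allI impI)
  show "SF (g X Y)" if "VF Y" for Y
    unfolding g_def using that assms one_formD(1)[OF d_form[of "\<phi> X"]] by simp
  show "g X (Y + Z) = g X Y + g X Z" if "VF Y \<and> VF Z" for Y Z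
    using that assms by (intro ext) (simp add: g_apply d_right one_formD[OF form] algebra_simps)
  show "g X (f \<odot> Y) = f * g X Y" if "SF f \<and> VF Y" for f Y
    using that assms by (intro ext) (simp add: g_apply d_right one_formD[OF form] algebra_simps)
qed

lemma psi_nonneg: "section_of A L1 X \<Longrightarrow> d (\<psi> X) X p / c \<ge> 0"
  using psi_definite[of X p] d_pointwise(1)[of "\<psi> X" X p] section_VF[of L1 X] by (cases "X p = 0") auto

text \<open>The \<open>L2\<close> part of \<open>X\<close> is pulled back to \<open>L1\<close> by
  \<open>\<rho>\<close>, so both blocks of the metric are values of the Pang form divided by
  \<open>c\<close> with positive weights.\<close>

lemma g_diag:
  assumes "VF X"
  shows "g X X p = 2 * (d (\<psi> (P1 X)) (P1 X) p / c) + c\<^sup>2 / 2 * (d (\<psi> (\<rho> X)) (\<rho> X) p / c) + (\<eta> X p)\<^sup>2"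
proof -
  have "d (\<rho> X) X p = - d (\<psi> (\<rho> X)) (\<rho> X) p"
    using d_split[of "\<rho> X" X p] d_zero_left[of "P1 X" p] d_skew[of "\<rho> X" "P2 X"] assms by simp
  then show ?thesis
    using d_psi_P1[OF assms assms, of p] assms c_neq_0
    by (simp add: g_apply d_phi_left power2_eq_square)
qed

lemma g_pos:
  assumes X: "VF X" and nz: "X p \<noteq> 0"
  shows "g X X p > 0"
proof -
  define x y where "x = d (\<psi> (P1 X)) (P1 X) p / c" and "y = d (\<psi> (\<rho> X)) (\<rho> X) p / c"
  have n: "x \<ge> 0" "y \<ge> 0"
    unfolding x_def y_def using psi_nonneg[OF section_P1[OF X]] psi_nonneg[OF section_rho[OF X]] by auto
  have diag: "g X X p = 2 * x + c\<^sup>2 / 2 * y + (\<eta> X p)\<^sup>2"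
    unfolding x_def y_def by (rule g_diag[OF X])
  have cy: "c\<^sup>2 / 2 * y \<ge> 0" "y > 0 \<Longrightarrow> c\<^sup>2 / 2 * y > 0" and e: "(\<eta> X p)\<^sup>2 \<ge> 0"
    using n c_neq_0 by simp_all
  consider "P1 X p \<noteq> 0" | "P2 X p \<noteq> 0" | "\<eta> X p \<noteq> 0"
  proof -
    have "X p = 0" if "P1 X p = 0" "P2 X p = 0" "\<eta> X p = 0"
      using field_split_at[OF X, of p] that by (intro ext) simp
    then show thesis using nz that by blast
  qed
  then show ?thesis
  proof cases
    case 1
    then have "x > 0"
      unfolding x_def by (rule psi_definite[OF section_P1[OF X]])
    then show ?thesis
      using diag cy(1) e by linarith
  next
    case 2
    \<comment> \<open>\<open>P2 X\<close> is the image of \<open>\<rho> X\<close> under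
      \<open>\<psi>\<close>, so by tensoriality it vanishes wherever \<open>\<rho> X\<close>
      does.\<close>
    have "\<rho> X p \<noteq> 0"
    proof
      assume "\<rho> X p = 0"
      then have "\<psi> (\<rho> X) p = 0"
        using X by (intro endo_pointwise[OF psi_endo]) simp_all
      with 2 X show False by simp
    qed
    then have "y > 0"
      unfolding y_def by (rule psi_definite[OF section_rho[OF X]])
    then show ?thesis
      using diag cy(2) n e by linarith
  next
    case 3
    then have "(\<eta> X p)\<^sup>2 > 0" by simp
    then show ?thesis
      using diag cy(1) n by linarith
  qed
qed

lemma contact_metric: "contact_metric_structure A \<phi> \<xi> \<eta> g"
  unfolding contact_metric_structure_def
proof (intro conjI allI impI)
  show "riemannian_metric A g"
    unfolding riemannian_metric_def using g_form g_sym g_pos by auto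
  show "d X Y = g X (\<phi> Y)" if "VF X \<and> VF Y" for X Y
  proof
    fix p
    have "d (\<phi> X) (\<phi> Y) p = - d (\<phi> (\<phi> X)) Y p"
      using that by (simp add: d_phi_right)
    then show "d X Y p = g X (\<phi> Y) p"
      using that by (simp add: g_apply eta_phi d_phi_phi)
  qed
  show "g (\<phi> X) (\<phi> Y) = g X Y - \<eta> X * \<eta> Y" if "VF X \<and> VF Y" for X Y
  proof
    fix p
    show "g (\<phi> X) (\<phi> Y) p = (g X Y - \<eta> X * \<eta> Y) p"
      using that by (simp add: g_apply eta_phi d_phi_phi d_phi_right)
  qed
qed (use reeb phi_endo phi_phi in auto)

end

context parallel_definite_flat
begin

section \<open>Parallel tensors, the Levi-Civita connection and its curvature\<close>

lemma D_diff:
  assumes "VF X" "VF Y" "VF Z"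
  shows "D X (Y - Z) = D X Y - D X Z"
  using D_right(1)[of X Y "(- 1) \<cdot> Z"] D_cscale[of X Z "- 1"] assms by (simp flip: uminus_eq_cscale)

lemma D_phi:
  assumes "VF Z" "VF X"
  shows "D Z (\<phi> X) = \<phi> (D Z X)"
  unfolding \<phi>_def using assms by (simp only: D_diff D_cscale VF_psi VF_rho vector_field_cscale D_psi D_rho)

text \<open>The bracket with \<open>\<xi>\<close> is \<open>D \<xi>\<close> plus
  \<open>\<psi>\<close>, and \<open>\<phi>\<close> commutes with \<open>D \<xi>\<close>. Thus h is
  half the commutator of \<open>\<psi>\<close> and \<open>\<phi>\<close>, a purely algebraic
  expression.\<close>

lemma h_eq:
  assumes "VF X"
  shows "h_tensor \<phi> \<xi> X p u = c / 4 * (P1 X p u - P2 X p u)"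
proof -
  have "lie_endo \<xi> \<phi> X = D \<xi> (\<phi> X) + \<psi> (\<phi> X) - \<phi> (D \<xi> X + \<psi> X)"
    using assms by (simp add: lie_endo_def bracket_xi)
  also have "\<phi> (D \<xi> X + \<psi> X) = D \<xi> (\<phi> X) + \<phi> (\<psi> X)"
    using assms by (simp add: endo_tensorD(2)[OF phi_endo] D_phi)
  finally have "lie_endo \<xi> \<phi> X p u = \<psi> (\<phi> X) p u - \<phi> (\<psi> X) p u"
    by simp
  then show ?thesis
    using assms by (simp add: h_tensor_def psi_phi phi_psi field_simps)
qed

text \<open>\<open>D\<close> minus its contorsion with respect to \<open>g\<close>\<close>

definition LC :: "'m vfield \<Rightarrow> 'm vfield \<Rightarrow> 'm vfield" where
  "LC X Y = D X Y - ((1 + c / 4) \<cdot> (d (P1 X) Y \<odot> \<xi>) + (1 - c / 4) \<cdot> (d (P2 X) Y \<odot> \<xi>)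
     + \<eta> Y \<odot> ((2 / c * (1 + c / 4)) \<cdot> \<psi> X - (c / 2 * (1 - c / 4)) \<cdot> \<rho> X)
     + (1 - c / 4) \<cdot> (\<eta> X \<odot> \<phi> Y))"

lemma SF_d [simp]: "VF X \<Longrightarrow> VF Y \<Longrightarrow> SF (d X Y)"
  by (rule one_formD(1)[OF d_form])

lemma LC_apply:
  "LC X Y p u = D X Y p u - ((1 + c / 4) * d (P1 X) Y p * \<xi> p u + (1 - c / 4) * d (P2 X) Y p * \<xi> p u
     + \<eta> Y p * (2 / c * (1 + c / 4) * \<psi> X p u - c / 2 * (1 - c / 4) * \<rho> X p u)
     + (1 - c / 4) * \<eta> X p * \<phi> Y p u)"
  by (simp add: LC_def)

lemma VF_LC [simp]: "VF X \<Longrightarrow> VF Y \<Longrightarrow> VF (LC X Y)"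
  by (simp add: LC_def)

lemma LC_linear: "linear_connection A LC"
  unfolding linear_connection_def endo_tensor_def
proof (intro conjI allI impI)
  show "LC (X + X') Y = LC X Y + LC X' Y" if "VF Y" "VF X \<and> VF X'" for X X' Y
    using that endo_tensorD(2)[OF D_left[OF that(1)], of X X']
    by (intro ext) (simp add: LC_apply operator_linear d_left one_formD[OF form] algebra_simps add_divide_distrib diff_divide_distrib)
  show "LC (f \<odot> X) Y = f \<odot> LC X Y" if "VF Y" "SF f \<and> VF X" for f X Y
    using that endo_tensorD(3)[OF D_left[OF that(1)], of f X]
    by (intro ext) (simp add: LC_apply operator_linear d_left one_formD[OF form] algebra_simps add_divide_distrib diff_divide_distrib)
  show "LC X (Y + Z) = LC X Y + LC X Z" if "VF X \<and> VF Y \<and> VF Z" for X Y Z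
    using that
    by (intro ext) (simp add: LC_apply D_right endo_tensorD[OF phi_endo] d_right one_formD[OF form] algebra_simps add_divide_distrib diff_divide_distrib)
  show "LC X (f \<odot> Y) = vfield_apply X f \<odot> Y + f \<odot> LC X Y" if "SF f \<and> VF X \<and> VF Y" for f X Y
    using that
    by (intro ext) (simp add: LC_apply D_right endo_tensorD[OF phi_endo] d_right one_formD[OF form] algebra_simps add_divide_distrib diff_divide_distrib)
qed simp

lemma d_P:
  assumes "VF X" "VF Y"
  shows "d (P1 X) Y p = d (P1 X) (P2 Y) p" "d (P2 X) Y p = d (P2 X) (P1 Y) p"
  using d_split[of "P1 X" Y p] d_split[of "P2 X" Y p] assms
    d_zero_left[of "P1 Y" p] d_zero_left[of "P2 Y" p] by simp_all

text \<open>The contorsion K of a metric connection with torsion T solves K(X,Y) - K(Y,X) = T(X,Y)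
  with g(K(X,Y),Z) skew in Y and Z, which gives 2 g(K(X,Y),Z) = g(T(X,Y),Z) - g(T(Y,Z),X) +
  g(T(Z,X),Y). In the factors 1 + c/4 and 1 - c/4 of \<open>LC\<close>, the 1 stems from the term 2
  d(X,Y) \<xi> of T and the c/4 from the terms with \<open>\<psi>\<close>. The first of the two
  conditions is checked here, the second in \<open>LC_metric\<close>.\<close>

lemma LC_torsion:
  assumes "VF X" "VF Y"
  shows "torsion LC X Y = 0"
proof (intro ext)
  fix p u
  define s t where "s = d (P1 X) (P2 Y) p" and "t = d (P2 X) (P1 Y) p"
  have st: "d (P1 X) Y p = s" "d (P2 X) Y p = t" "d (P1 Y) X p = - t" "d (P2 Y) X p = - s" "d X Y p = s + t"
    using assms d_P[of X Y p] d_P[of Y X p] d_split[of X Y p] d_skew[of "P1 Y" "P2 X"] d_skew[of "P2 Y" "P1 X"]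
    by (simp_all add: s_def t_def)
  have T: "D X Y p u - D Y X p u - bracket X Y p u = 2 * (s + t) * \<xi> p u + \<eta> Y p * \<psi> X p u - \<eta> X p * \<psi> Y p u"
    using torsion_eq[OF assms, of p u] st(5) by (simp add: torsion_def)
  have "torsion LC X Y p u = (D X Y p u - D Y X p u - bracket X Y p u)
     - ((1 + c / 4) * s * \<xi> p u + (1 - c / 4) * t * \<xi> p u
     + \<eta> Y p * (2 / c * (1 + c / 4) * \<psi> X p u - c / 2 * (1 - c / 4) * \<rho> X p u)
     + (1 - c / 4) * \<eta> X p * (2 / c * \<psi> Y p u - c / 2 * \<rho> Y p u))
     + ((1 + c / 4) * (- t) * \<xi> p u + (1 - c / 4) * (- s) * \<xi> p u
     + \<eta> X p * (2 / c * (1 + c / 4) * \<psi> Y p u - c / 2 * (1 - c / 4) * \<rho> Y p u)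
     + (1 - c / 4) * \<eta> Y p * (2 / c * \<psi> X p u - c / 2 * \<rho> X p u))"
    by (simp add: torsion_def LC_apply st phi_apply)
  also have "\<dots> = 0"
    unfolding T using c_neq_0 by (simp add: field_simps)
  finally show "torsion LC X Y p u = 0 p u" by simp
qed

lemma LC_metric:
  assumes "VF X" "VF Y" "VF Z"
  shows "vfield_apply Z (g X Y) = g (LC Z X) Y + g X (LC Z Y)"
proof
  fix p
  have Dg: "vfield_apply Z (g X Y) p = g (D Z X) Y p + g X (D Z Y) p"
    using assms by (simp add: g_def vfield_apply_function D_d D_phi eta_D algebra_simps)
  define K where "K = (\<lambda>X. (1 + c / 4) \<cdot> (d (P1 Z) X \<odot> \<xi>) + (1 - c / 4) \<cdot> (d (P2 Z) X \<odot> \<xi>)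
     + \<eta> X \<odot> ((2 / c * (1 + c / 4)) \<cdot> \<psi> Z - (c / 2 * (1 - c / 4)) \<cdot> \<rho> Z)
     + (1 - c / 4) \<cdot> (\<eta> Z \<odot> \<phi> X))"
  have K: "VF (K U)" "LC Z U = D Z U - K U" if "VF U" for U
    using that assms by (simp_all add: K_def LC_def)
  have gl: "one_form A (g U)" if "VF U" for U
    by (rule g_form[OF that])
  \<comment> \<open>The right-hand side is skew in \<open>U\<close> and \<open>W\<close>, so the
    correction terms of the two arguments cancel and metricity is inherited from
    \<open>D\<close>.\<close>
  have gK: "g W (K U) p = ((1 + c / 4) * d (P1 Z) U p + (1 - c / 4) * d (P2 Z) U p) * \<eta> W p
      + \<eta> U p * (- (1 + c / 4) * d (P1 Z) W p - (1 - c / 4) * d (P2 Z) W p) + (1 - c / 4) * \<eta> Z p * d W U p"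
    if "VF U" "VF W" for U W
  proof -
    have xi: "g W \<xi> p = \<eta> W p"
      using that by (simp add: g_apply d_xi eta_xi)
    have psi: "g W (\<psi> Z) p = - (c / 2) * d (P1 Z) W p"
      using that assms g_sym[of W "\<psi> Z" p] g_apply[of "\<psi> Z" W p] by (simp add: phi_psi d_left)
    have rho: "g W (\<rho> Z) p = 2 / c * d (P2 Z) W p"
      using that assms g_sym[of W "\<rho> Z" p] g_apply[of "\<rho> Z" W p] by (simp add: phi_rho d_left)
    have phi: "g W (\<phi> U) p = d W U p"
      using that by (simp add: g_apply eta_phi d_phi_right d_phi_phi)
    have "g W (K U) p = (1 + c / 4) * (d (P1 Z) U p * g W \<xi> p) + (1 - c / 4) * (d (P2 Z) U p * g W \<xi> p)
      + \<eta> U p * (2 / c * (1 + c / 4) * g W (\<psi> Z) p - c / 2 * (1 - c / 4) * g W (\<rho> Z) p)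
      + (1 - c / 4) * (\<eta> Z p * g W (\<phi> U) p)"
      unfolding K_def using that assms
      by (simp add: one_formD(2,3)[OF gl] one_form_diff[OF gl] one_form_cscale[OF gl])
    moreover have e: "2 / c * (1 + c / 4) * (- (c / 2) * r) = - (1 + c / 4) * r"
      "c / 2 * (1 - c / 4) * (2 / c * r) = (1 - c / 4) * r" for r
      using c_neq_0 by (simp_all add: field_simps)
    ultimately show ?thesis
      unfolding xi psi rho phi e by (simp add: algebra_simps)
  qed
  have "g (LC Z X) Y p + g X (LC Z Y) p = g Y (D Z X - K X) p + g X (D Z Y - K Y) p"
    using assms K by (simp add: g_sym[of _ Y])
  also have "\<dots> = g (D Z X) Y p + g X (D Z Y) p - (g Y (K X) p + g X (K Y) p)"
    using assms K(1) by (simp add: one_form_diff[OF gl] g_sym[of "D Z X" Y])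
  also have "g Y (K X) p + g X (K Y) p = 0"
    using assms d_skew[of X Y] by (simp add: gK algebra_simps)
  finally show "vfield_apply Z (g X Y) p = (g (LC Z X) Y + g X (LC Z Y)) p"
    using Dg by simp
qed

lemma LC_levi_civita: "levi_civita A g LC"
  unfolding levi_civita_def using LC_linear LC_torsion LC_metric by blast

text \<open>Since \<open>LC U \<xi> = N U\<close> with \<open>N\<close> parallel for
  \<open>D\<close>, the derivatives and the bracket combine into \<open>N\<close> of the torsion of
  \<open>D\<close>. All other contributions are contorsion terms, so the result is algebraic in
  \<open>X\<close> and \<open>Y\<close>.\<close>

lemma LC_curvature:
  assumes X: "VF X" and Y: "VF Y"
  shows "curvature LC X Y \<xi> = (1 - c\<^sup>2 / 16) \<cdot> (\<eta> Y \<odot> X - \<eta> X \<odot> Y)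
     + (2 * (1 - c / 4)) \<cdot> (\<eta> Y \<odot> h_tensor \<phi> \<xi> X - \<eta> X \<odot> h_tensor \<phi> \<xi> Y)"
proof (intro ext)
  fix p u
  define a b where "a = 2 / c * (1 + c / 4)" and "b = c / 2 * (1 - c / 4)"
  \<comment> \<open>\<open>N = - \<phi> - \<phi> \<circ> h\<close>, which is parallel for \<open>D\<close>\<close>
  define N where "N = (\<lambda>U. b \<cdot> \<rho> U - a \<cdot> \<psi> U)"
  have VN: "VF (N U)" if "VF U" for U
    using that by (simp add: N_def)
  have N_apply: "N U p u = b * \<rho> U p u - a * \<psi> U p u" for U
    by (simp add: N_def)
  have N_xi: "LC U \<xi> = N U" if "VF U" for U
    using that by (intro ext) (simp add: LC_apply D_xi N_def d_xi eta_xi phi_xi a_def b_def)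
  have D_N: "D U (N W) p v = N (D U W) p v" if "VF U" "VF W" for U W v
    using that by (simp add: D_diff D_cscale D_psi D_rho N_def)
  have phi_N: "\<phi> (N U) p v = b * (2 / c) * P2 U p v + a * (c / 2) * P1 U p v" if "VF U" for U v
    using that by (simp add: N_def endo_tensor_diff[OF phi_endo] endo_tensor_cscale[OF phi_endo] phi_psi phi_rho)
  have eta_N: "\<eta> (N U) p = 0" if "VF U" for U
    using that by (simp add: N_def one_form_diff[OF form] one_form_cscale[OF form])
  define k where "k = (\<lambda>U W. (1 + c / 4) * d (P1 U) (N W) p + (1 - c / 4) * d (P2 U) (N W) p)"
  have LCN: "LC U (N W) p u = N (D U W) p u - k U W * \<xi> p u
      - (1 - c / 4) * \<eta> U p * (b * (2 / c) * P2 W p u + a * (c / 2) * P1 W p u)" if "VF U" "VF W" for U W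
    using that VN by (simp add: LC_apply D_N phi_N eta_N k_def algebra_simps)
  have k: "k U W = (1 + c / 4) * a * d (\<psi> W) U p - (1 - c / 4) * b * d (\<rho> W) U p" if "VF U" "VF W" for U W
  proof -
    have "d (P1 U) (\<rho> W) p = 0" "d (P2 U) (\<psi> W) p = 0"
      using that d_iso1[OF section_P1 section_rho] d_iso2[OF section_P2 section_psi] by blast+
    moreover have "d (P1 U) (\<psi> W) p = - d (\<psi> W) U p" "d (P2 U) (\<rho> W) p = - d (\<rho> W) U p"
      using that d_split[of "\<psi> W" U p] d_split[of "\<rho> W" U p] d_zero_left[of "P2 U" p]
        d_zero_left[of "P1 U" p] d_skew[of "P1 U" "\<psi> W"] d_skew[of "P2 U" "\<rho> W"] by simp_all
    ultimately show ?thesis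
      using that by (simp add: k_def N_def d_right algebra_simps)
  qed
  \<comment> \<open>The \<open>\<xi>\<close> components of the two second derivatives are thus equal
    and cancel in the curvature.\<close>
  have k_sym: "k X Y = k Y X"
    using X Y by (simp add: k psi_sym[of X Y] rho_sym[of X Y])
  have T: "D X Y - D Y X - bracket X Y = 2 \<cdot> (d X Y \<odot> \<xi>) + \<eta> Y \<odot> \<psi> X - \<eta> X \<odot> \<psi> Y"
  proof (intro ext)
    show "(D X Y - D Y X - bracket X Y) q v = (2 \<cdot> (d X Y \<odot> \<xi>) + \<eta> Y \<odot> \<psi> X - \<eta> X \<odot> \<psi> Y) q v" for q v
      using torsion_eq[OF X Y, of q v] by (simp add: torsion_def)
  qed
  have "N (D X Y) p u - N (D Y X) p u - N (bracket X Y) p u = N (D X Y - D Y X - bracket X Y) p u"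
    using X Y by (simp add: N_apply operator_linear algebra_simps)
  also have "\<dots> = \<eta> Y p * (b * P1 X p u) - \<eta> X p * (b * P1 Y p u)"
    unfolding T using X Y by (simp add: N_apply operator_linear algebra_simps)
  finally have TN: "N (D X Y) p u - N (D Y X) p u - N (bracket X Y) p u
      = \<eta> Y p * (b * P1 X p u) - \<eta> X p * (b * P1 Y p u)" .
  have "curvature LC X Y \<xi> p u = LC X (N Y) p u - LC Y (N X) p u - N (bracket X Y) p u"
    using X Y by (simp add: curvature_def N_xi)
  also have "\<dots> = (N (D X Y) p u - N (D Y X) p u - N (bracket X Y) p u)
      - (1 - c / 4) * \<eta> X p * (b * (2 / c) * P2 Y p u + a * (c / 2) * P1 Y p u)
      + (1 - c / 4) * \<eta> Y p * (b * (2 / c) * P2 X p u + a * (c / 2) * P1 X p u)"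
    using LCN[OF X Y] LCN[OF Y X] k_sym by simp
  \<comment> \<open>The coefficients of \<eta>(Y) P1 X and \<eta>(Y) P2 X are (1 - c/4) (1 + 3c/4)
    and (1 - c/4)^2. They equal \<kappa> + \<mu> c/4 and \<kappa> - \<mu> c/4; half their sum is
    \<kappa>, half their difference is \<mu> c/4.\<close>
  also have "\<dots> = (1 - c\<^sup>2 / 16) * (\<eta> Y p * (P1 X p u + P2 X p u) - \<eta> X p * (P1 Y p u + P2 Y p u))
     + 2 * (1 - c / 4) * (\<eta> Y p * (c / 4 * (P1 X p u - P2 X p u)) - \<eta> X p * (c / 4 * (P1 Y p u - P2 Y p u)))"
    unfolding TN a_def b_def using c_neq_0 by (simp add: field_simps power2_eq_square)
  also have "\<dots> = (1 - c\<^sup>2 / 16) * (\<eta> Y p * X p u - \<eta> X p * Y p u)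
     + 2 * (1 - c / 4) * (\<eta> Y p * h_tensor \<phi> \<xi> X p u - \<eta> X p * h_tensor \<phi> \<xi> Y p u)"
    using field_split_at[OF X, of p u] field_split_at[OF Y, of p u]
    by (simp add: h_eq[OF X] h_eq[OF Y]) (simp add: algebra_simps)
  finally show "curvature LC X Y \<xi> p u = ((1 - c\<^sup>2 / 16) \<cdot> (\<eta> Y \<odot> X - \<eta> X \<odot> Y)
     + (2 * (1 - c / 4)) \<cdot> (\<eta> Y \<odot> h_tensor \<phi> \<xi> X - \<eta> X \<odot> h_tensor \<phi> \<xi> Y)) p u"
    by simp
qed

text \<open>h acts as c/4, -c/4 and 0 on the three summands, so an eigenvector equation at a single
  point is compared component by component.\<close>

lemma eigen_split:
  assumes X: "VF X" and h: "h_tensor \<phi> \<xi> X p = (r \<cdot> X) p"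
  shows "tscale (c / 4 - r) (P1 X p) = 0 \<and> tscale (- (c / 4) - r) (P2 X p) = 0 \<and> - (r * \<eta> X p) = 0"
proof (rule split_unique)
  show "tscale (c / 4 - r) (P1 X p) \<in> L1 p" "0 \<in> L1 p"
    using section_P1[OF X] by (auto simp: section_of_def intro: tv.subspace_scale tv.subspace_0 L1_subspace)
  show "tscale (- (c / 4) - r) (P2 X p) \<in> L2 p" "0 \<in> L2 p"
    using section_P2[OF X] by (auto simp: section_of_def intro: tv.subspace_scale tv.subspace_0 L2_subspace)
  show "tscale (c / 4 - r) (P1 X p) + tscale (- (c / 4) - r) (P2 X p) + tscale (- (r * \<eta> X p)) (\<xi> p)
      = 0 + 0 + tscale 0 (\<xi> p)"
  proof
    fix u
    have "c / 4 * (P1 X p u - P2 X p u) = r * X p u"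
      using fun_cong[OF h, of u] h_eq[OF X, of p u] by simp
    then show "(tscale (c / 4 - r) (P1 X p) + tscale (- (c / 4) - r) (P2 X p) + tscale (- (r * \<eta> X p)) (\<xi> p)) u
      = (0 + 0 + tscale 0 (\<xi> p)) u"
      using field_split_at[OF X, of p u] by (simp add: algebra_simps)
  qed
qed

text \<open>An eigenvector has no component outside \<open>L1\<close> because c is nonzero.
  Conversely, the distribution consists of values of fields, so a vector of \<open>L1 p\<close> is
  first extended to a section.\<close>

lemma eigen_L1: "h_eigendistribution A \<phi> \<xi> (c / 4) = L1"
proof (intro ext set_eqI iffI)
  fix p v
  assume "v \<in> h_eigendistribution A \<phi> \<xi> (c / 4) p"
  then obtain X where X: "VF X" "v = X p" "h_tensor \<phi> \<xi> X p = ((c / 4) \<cdot> X) p"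
    by (auto simp: h_eigendistribution_def)
  have "P2 X p = 0" "\<eta> X p = 0"
    using eigen_split[OF X(1,3)] c_neq_0 by (auto simp: tv.scale_eq_0_iff)
  then have "v = P1 X p"
    using X(2) field_split_at[OF X(1), of p] by (intro ext) simp
  then show "v \<in> L1 p"
    using section_P1[OF X(1)] by (simp add: section_of_def)
next
  fix p v
  assume "v \<in> L1 p"
  then obtain X where X: "section_of A L1 X" "X p = v"
    by (rule section_extend)
  have "h_tensor \<phi> \<xi> X p = ((c / 4) \<cdot> X) p"
    using h_eq[OF section_VF[OF X(1)], of p] by (intro ext) (simp add: P1_section1[OF X(1)] P2_section1[OF X(1)])
  then show "v \<in> h_eigendistribution A \<phi> \<xi> (c / 4) p"
    using X section_VF[OF X(1)] by (auto simp: h_eigendistribution_def)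
qed

lemma eigen_L2: "h_eigendistribution A \<phi> \<xi> (- (c / 4)) = L2"
proof (intro ext set_eqI iffI)
  fix p v
  assume "v \<in> h_eigendistribution A \<phi> \<xi> (- (c / 4)) p"
  then obtain X where X: "VF X" "v = X p" "h_tensor \<phi> \<xi> X p = ((- (c / 4)) \<cdot> X) p"
    by (auto simp: h_eigendistribution_def)
  have "P1 X p = 0" "\<eta> X p = 0"
    using eigen_split[OF X(1,3)] c_neq_0 by (auto simp: tv.scale_eq_0_iff)
  then have "v = P2 X p"
    using X(2) field_split_at[OF X(1), of p] by (intro ext) simp
  then show "v \<in> L2 p"
    using section_P2[OF X(1)] by (simp add: section_of_def)
next
  fix p v
  assume "v \<in> L2 p"
  then obtain X where X: "section_of A L2 X" "X p = v"
    by (rule bi_legendrian.section_extend[OF bi_legendrian_swap])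
  have "h_tensor \<phi> \<xi> X p = ((- (c / 4)) \<cdot> X) p"
    using h_eq[OF section_VF[OF X(1)], of p] by (intro ext) (simp add: P1_section2[OF X(1)] P2_section2[OF X(1)])
  then show "v \<in> h_eigendistribution A \<phi> \<xi> (- (c / 4)) p"
    using X section_VF[OF X(1)] by (auto simp: h_eigendistribution_def)
qed

lemma kappa_mu: "contact_metric_kappa_mu A (1 - c\<^sup>2 / 16) (2 * (1 - c / 4)) \<phi> \<xi> \<eta> g"
  unfolding contact_metric_kappa_mu_def
proof (intro conjI exI allI impI)
  show "curvature LC X Y \<xi> = (1 - c\<^sup>2 / 16) \<cdot> (\<eta> Y \<odot> X - \<eta> X \<odot> Y)
     + (2 * (1 - c / 4)) \<cdot> (\<eta> Y \<odot> h_tensor \<phi> \<xi> X - \<eta> X \<odot> h_tensor \<phi> \<xi> Y)" if "VF X \<and> VF Y" for X Y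
    using that LC_curvature by blast
qed (rule contact_metric LC_levi_civita)+

end

text \<open>The mixed torsion condition is symmetric because torsion and \<open>d\<close> are both
  skew; the condition on \<open>\<xi>\<close> only has its two summands exchanged.\<close>

lemma (in bi_legendrian) bi_legendrian_connection_swap:
  assumes conn: "bi_legendrian_connection A \<eta> \<xi> L1 L2 D"
  shows "bi_legendrian_connection A \<eta> \<xi> L2 L1 D"
proof -
  have t: "torsion D X Y = (\<lambda>p. 2 * d X Y p) \<odot> \<xi>" if X: "section_of A L2 X" and Y: "section_of A L1 Y" for X Y
  proof -
    have "torsion D Y X = (\<lambda>p. 2 * d Y X p) \<odot> \<xi>"
      using conn X Y unfolding bi_legendrian_connection_def by blast
    moreover have "torsion D X Y = - torsion D Y X"
      by (simp add: torsion_def bracket_antisym[of X Y])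
    ultimately show ?thesis
      using d_skew[of X Y] section_VF[OF X] section_VF[OF Y] by (simp add: fscale_def fun_eq_iff)
  qed
  have "torsion D X \<xi> = P1 (bracket \<xi> (P2 X)) + P2 (bracket \<xi> (P1 X))" if "VF X" for X
  proof -
    have "torsion D X \<xi> = P2 (bracket \<xi> (P1 X)) + P1 (bracket \<xi> (P2 X))"
      using conn that unfolding bi_legendrian_connection_def by blast
    then show ?thesis
      by (simp only: add.commute)
  qed
  with t conn show ?thesis
    unfolding bi_legendrian_connection_def by blast
qed

theorem theorem3p4:
  fixes A :: "('m::{t2_space, second_countable_topology}, 'e::euclidean_space) chart set"
    and n :: nat
    and \<eta> :: "'m vfield \<Rightarrow> 'm \<Rightarrow> real"
    and \<xi> :: "'m vfield"
    and L1 L2 :: "'m distrib"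
    and D :: "'m vfield \<Rightarrow> 'm vfield \<Rightarrow> 'm vfield"
  assumes "smooth_atlas A"
    and "contact_form A n \<eta>"
    and "reeb_field A \<eta> \<xi>"
    and "bi_legendrian_structure A n \<eta> \<xi> L1 L2"
    and "bi_legendrian_connection A \<eta> \<xi> L1 L2 D"
  shows
    "(pang_parallel A \<eta> \<xi> L1 D \<and> positive_definite_foliation A \<eta> \<xi> L1 \<and> flat_foliation A \<eta> \<xi> L2 \<longrightarrow>
        (\<forall>c::real. 0 < c \<and> c \<le> 4 \<longrightarrow>
           admits_kappa_mu A \<eta> \<xi> L1 L2 (1 - c\<^sup>2 / 16) (2 * (1 - c / 4)))) \<and>
     (pang_parallel A \<eta> \<xi> L2 D \<and> flat_foliation A \<eta> \<xi> L1 \<and> negative_definite_foliation A \<eta> \<xi> L2 \<longrightarrow>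
        (\<forall>c::real. - 4 \<le> c \<and> c < 0 \<longrightarrow>
           admits_kappa_mu A \<eta> \<xi> L1 L2 (1 - c\<^sup>2 / 16) (2 * (1 - c / 4))))"
proof (intro conjI impI allI)
  have "smooth_manifold A"
    using assms(1) by (simp add: smooth_manifold_def)
  then interpret bi_legendrian A n \<eta> \<xi> L1 L2
    using assms(2-4) unfolding contact_form_def
    by (intro bi_legendrian.intro bi_legendrian_axioms.intro) auto
  {
    fix c :: real
    assume *: "pang_parallel A \<eta> \<xi> L1 D \<and> positive_definite_foliation A \<eta> \<xi> L1 \<and> flat_foliation A \<eta> \<xi> L2"
      and c: "0 < c \<and> c \<le> 4"
    interpret parallel_definite_flat A n \<eta> \<xi> L1 L2 c D
      using * c assms(5) by unfold_locales (auto simp: positive_definite_foliation_def)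
    have sq: "sqrt (1 - (1 - c\<^sup>2 / 16)) = c / 4"
      using c by (intro real_sqrt_unique) (auto simp: power2_eq_square)
    have "associated_bi_legendrian A (1 - c\<^sup>2 / 16) \<phi> \<xi> L1 L2"
      unfolding associated_bi_legendrian_def sq minus_minus using c_neq_0 eigen_L1 eigen_L2 by simp
    then show "admits_kappa_mu A \<eta> \<xi> L1 L2 (1 - c\<^sup>2 / 16) (2 * (1 - c / 4))"
      unfolding admits_kappa_mu_def using kappa_mu by blast
  next
    fix c :: real
    assume *: "pang_parallel A \<eta> \<xi> L2 D \<and> flat_foliation A \<eta> \<xi> L1 \<and> negative_definite_foliation A \<eta> \<xi> L2"
      and c: "- 4 \<le> c \<and> c < 0"
    interpret swap: bi_legendrian A n \<eta> \<xi> L2 L1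
      by (rule bi_legendrian_swap)
    interpret parallel_definite_flat A n \<eta> \<xi> L2 L1 c D
      using * c bi_legendrian_connection_swap[OF assms(5)]
      by unfold_locales (auto simp: negative_definite_foliation_def divide_neg_neg)
    \<comment> \<open>Here c is negative, so \<lambda> = - c/4. The definite foliation
      \<open>L2\<close>, on which h is c/4, is the eigenbundle for -\<lambda> and keeps the second
      place in the pair.\<close>
    have sq: "sqrt (1 - (1 - c\<^sup>2 / 16)) = - (c / 4)"
      using c by (intro real_sqrt_unique) (auto simp: power2_eq_square)
    have "associated_bi_legendrian A (1 - c\<^sup>2 / 16) \<phi> \<xi> L1 L2"
      unfolding associated_bi_legendrian_def sq minus_minus using c_neq_0 eigen_L1 eigen_L2 by simp
    then show "admits_kappa_mu A \<eta> \<xi> L1 L2 (1 - c\<^sup>2 / 16) (2 * (1 - c / 4))"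
      unfolding admits_kappa_mu_def using kappa_mu by blast
  }
qed

end
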